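(* Let $2 \leq k \leq n-1$, let $\Omega\subseteq\mathbb{R}^n$ be a smooth bounded $(k-1)$-admissible domain, and let $\varphi$ be a spacelike function on $\overline\Omega$. Suppose $\psi(x,z) \in C^{\infty}(\overline{\Omega} \times \mathbb{R})$ is positive and $\psi_z \geq 0$. Assume further that there exists a $k$-admissible subsolution $\underline{u}$, i.e. a $k$-admissible function with \[\sigma_k[\underline{u}]\geq \psi(x,\underline{u})\ \text{ in } \Omega,\qquad \underline{u}=\varphi\ \text{ on } \partial\Omega.\] If $u \in C^3(\Omega) \cap C^1(\overline{\Omega})$ is a $k$-admissible solution of \[\sigma_k[u]=\psi(x,u)\ \text{ in } \Omega,\qquad u=\varphi\ \text{ on } \partial\Omega,\] then \[\sup_{\overline{\Omega}} |Du| \leq 1-\theta\] for some $\theta \in (0,1)$ depending on $n,k, \theta_0, \operatorname{diam}(\Omega), \sup_{\partial \Omega}|\varphi|, \sup_{\mathcal{D}} |D\psi|$ and $\inf_{\mathcal{D}} \psi$, where $\mathcal{D}:=\overline{\Omega} \times [\inf_{\Omega}u,\sup_{\Omega}u]$ and $\theta_0\in(0,1)$ is defined by \[1-\theta_0:=\max\Big\{\sup_{\partial \Omega} |D\underline{u}|,\ \max_{\partial \Omega} |D\overline{u}|\Big\},\] with $\overline{u}$ the $1$-admissible function satisfying \[\sigma_{1}[\overline{u}]=n \left[\binom{n}{k}^{-1}\psi(x,\overline{u})\right]^{1/k}\ \text{ in } \Omega,\qquad \overline{u}=\varphi\ \text{ on } \partial \Omega\] (whose existence is known by work of Bartnik and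 Simon).
   Context: The Minkowski space $\mathbb{R}^{n,1}$ is $\mathbb{R}^{n+1}$ with the metric $dx_1^2+\cdots+dx_n^2-dx_{n+1}^2$. $D$ and $D^2$ denote the ordinary gradient and Hessian; $D\psi$ is the gradient of $\psi$. A function $u$ on $\overline{\Omega}$ is spacelike if $\sup_{\overline{\Omega}}|Du|<1$ (equivalently, its graph $\Sigma=\{(x,u(x)) : x\in\overline\Omega\}$ is a spacelike hypersurface of $\mathbb{R}^{n,1}$). For spacelike $u$, the principal curvatures $\kappa(x)=(\kappa_1,\ldots,\kappa_n)$ of its graph at $(x,u(x))$ are the eigenvalues of the matrix \[\frac{1}{w}\left(I+\frac{Du\otimes Du}{w^2}\right)D^2u,\qquad w=\sqrt{1-|Du|^2}.\] $\sigma_k(\kappa)=\sum_{1\le i_1<\cdots<i_k\le n}\kappa_{i_1}\cdots\kappa_{i_k}$ is the $k$-th elementary symmetric polynomial, and $\sigma_k[u](x):=\sigma_k(\kappa(x))$. A function $u$ is $k$-admissible if its graph over $\overline\Omega$ is a $k$-convex spacelike hypersurface, i.e. $\sup_{\overline\Omega}|Du|<1$ and $\sigma_j[u]>0$ for all $1\le j\le k$ at all points of $\overline\Omega$ (where the second derivatives are defined). A smooth bounded domain $\Omega\subseteq\mathbb{R}^n$ is $(k-1)$-admissible if at every point of $\partial\Omega$ at least $k-1$ principal curvatures of $\partial\Omega$ (relative to the interior normal) are positive. *)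

theory Defs
  imports "HOL-Analysis.Analysis"
begin

section \<open>Differential calculus up to the boundary\<close>

text \<open>
  All derivatives are taken within a set \<open>S\<close>.  If \<open>S\<close> is open they are the ordinary
  derivatives.  The other instances used are \<open>S = closure \<Omega>\<close> and \<open>S = closure \<Omega> \<times> UNIV\<close> for a
  smooth bounded domain \<open>\<Omega>\<close>: there the derivative within \<open>S\<close> is unique at every point of \<open>S\<close>,
  it is the ordinary derivative at interior points, and at boundary points it is the continuous
  extension of the interior derivative as soon as such an extension exists.
\<close>

definition gradient :: "'a::euclidean_space set \<Rightarrow> ('a \<Rightarrow> real) \<Rightarrow> 'a \<Rightarrow> 'a" where
  "gradient S f x = (\<Sum>b\<in>Basis. frechet_derivative f (at x within S) b *\<^sub>R b)"

definition hessian :: "(real^'n) set \<Rightarrow> (real^'n \<Rightarrow> real) \<Rightarrow> real^'n \<Rightarrow> real^'n^'n" where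
  "hessian S f x = matrix (frechet_derivative (gradient S f) (at x within S))"

primrec Ck_on :: "nat \<Rightarrow> 'a::euclidean_space set \<Rightarrow> ('a \<Rightarrow> real) \<Rightarrow> bool" where
  "Ck_on 0 S f \<longleftrightarrow> continuous_on S f"
| "Ck_on (Suc m) S f \<longleftrightarrow> f differentiable_on S \<and>
     (\<forall>b\<in>Basis. Ck_on m S (\<lambda>x. frechet_derivative f (at x within S) b))"

definition smooth_on :: "'a::euclidean_space set \<Rightarrow> ('a \<Rightarrow> real) \<Rightarrow> bool" where
  "smooth_on S f \<longleftrightarrow> (\<forall>m. Ck_on m S f)"


section \<open>Curvatures of spacelike graphs in Minkowski space\<close>

definition elem_sym :: "nat \<Rightarrow> real^'n \<Rightarrow> real" where
  "elem_sym k \<kappa> = (\<Sum>I\<in>{I. card I = k}. \<Prod>i\<in>I. \<kappa> $ i)"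

definition curvature_matrix :: "(real^'n) set \<Rightarrow> (real^'n \<Rightarrow> real) \<Rightarrow> real^'n \<Rightarrow> real^'n^'n" where
  "curvature_matrix S u x =
     (let p = gradient S u x; w = sqrt (1 - (norm p)\<^sup>2)
      in (1 / w) *\<^sub>R ((mat 1 + (1 / w\<^sup>2) *\<^sub>R (\<chi> i j. p $ i * p $ j)) ** hessian S u x))"

text \<open>
  The eigenvalues, listed with multiplicity in some order, as the roots of the characteristic
  polynomial.  The order is irrelevant for \<^const>\<open>elem_sym\<close>.  The matrix
  is diagonalizable over the reals whenever \<open>u\<close> is spacelike and its Hessian is symmetric, being
  the product of a positive definite and a symmetric matrix.
\<close>

definition principal_curvatures :: "(real^'n) set \<Rightarrow> (real^'n \<Rightarrow> real) \<Rightarrow> real^'n \<Rightarrow> real^'n" where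
  "principal_curvatures S u x =
     (SOME \<kappa>. \<forall>t. det (mat t - curvature_matrix S u x) = (\<Prod>i\<in>UNIV. t - \<kappa> $ i))"

definition graph_sigma :: "nat \<Rightarrow> (real^'n) set \<Rightarrow> (real^'n \<Rightarrow> real) \<Rightarrow> real^'n \<Rightarrow> real" where
  "graph_sigma k \<Omega> u x = elem_sym k (principal_curvatures (closure \<Omega>) u x)"

definition spacelike :: "(real^'n) set \<Rightarrow> (real^'n \<Rightarrow> real) \<Rightarrow> bool" where
  "spacelike \<Omega> u \<longleftrightarrow> Ck_on 1 (closure \<Omega>) u \<and>
     (SUP x\<in>closure \<Omega>. norm (gradient (closure \<Omega>) u x)) < 1"

text \<open>
  Second derivatives exist everywhere in \<open>\<Omega>\<close>; at a boundary point the curvature condition is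
  imposed only if they exist there.
\<close>

definition admissible :: "nat \<Rightarrow> (real^'n) set \<Rightarrow> (real^'n \<Rightarrow> real) \<Rightarrow> bool" where
  "admissible k \<Omega> u \<longleftrightarrow> spacelike \<Omega> u \<and> Ck_on 2 \<Omega> u \<and>
     (\<forall>x\<in>closure \<Omega>. gradient (closure \<Omega>) u differentiable (at x within closure \<Omega>) \<longrightarrow>
        (\<forall>j\<in>{1..k}. graph_sigma j \<Omega> u x > 0))"


section \<open>Smooth bounded domains and the curvatures of their boundary\<close>

definition local_defining_function ::
    "(real^'n) set \<Rightarrow> real^'n \<Rightarrow> (real^'n) set \<Rightarrow> (real^'n \<Rightarrow> real) \<Rightarrow> bool" where
  "local_defining_function \<Omega> p U \<rho> \<longleftrightarrow> open U \<and> p \<in> U \<and> smooth_on U \<rho> \<and>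
     (\<forall>x\<in>U. gradient UNIV \<rho> x \<noteq> 0) \<and> \<Omega> \<inter> U = {x\<in>U. \<rho> x > 0}"

definition smooth_bounded_domain :: "(real^'n) set \<Rightarrow> bool" where
  "smooth_bounded_domain \<Omega> \<longleftrightarrow> open \<Omega> \<and> connected \<Omega> \<and> \<Omega> \<noteq> {} \<and> bounded \<Omega> \<and>
     (\<forall>p\<in>frontier \<Omega>. \<exists>U \<rho>. local_defining_function \<Omega> p U \<rho>)"

text \<open>
  Normal to the level sets of \<open>\<rho>\<close>; on the boundary it is the interior unit normal when \<open>\<rho>\<close> is a
  local defining function, since then \<open>\<rho> > 0\<close> inside.
\<close>

definition unit_normal :: "(real^'n \<Rightarrow> real) \<Rightarrow> real^'n \<Rightarrow> real^'n" where
  "unit_normal \<rho> x = gradient UNIV \<rho> x /\<^sub>R norm (gradient UNIV \<rho> x)"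

text \<open>
  The numbers \<open>\<kappa> 1, \<dots>, \<kappa> (n-1)\<close> are the principal curvatures of the boundary at \<open>p\<close> with respect to
  the interior normal \<open>\<nu>\<close>, i.e. the eigenvalues with multiplicity of the shape operator \<open>-d\<nu>\<close> on
  the tangent space; \<open>e\<close> is an orthonormal basis of principal directions.  With this sign the
  boundary of a ball of radius \<open>R\<close> has curvatures \<open>1/R\<close>.
\<close>

definition boundary_curvatures :: "(real^'n) set \<Rightarrow> real^'n \<Rightarrow> (nat \<Rightarrow> real) \<Rightarrow> bool" where
  "boundary_curvatures \<Omega> p \<kappa> \<longleftrightarrow>
     (\<exists>U \<rho> (e :: nat \<Rightarrow> real^'n). local_defining_function \<Omega> p U \<rho> \<and>
        (\<forall>i\<in>{1..<CARD('n)}. \<forall>j\<in>{1..<CARD('n)}. e i \<bullet> e j = (if i = j then 1 else 0)) \<and>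
        (\<forall>i\<in>{1..<CARD('n)}. e i \<bullet> unit_normal \<rho> p = 0 \<and>
           - frechet_derivative (unit_normal \<rho>) (at p) (e i) = \<kappa> i *\<^sub>R e i))"

definition admissible_domain :: "nat \<Rightarrow> (real^'n) set \<Rightarrow> bool" where
  "admissible_domain m \<Omega> \<longleftrightarrow>
     (\<forall>p\<in>frontier \<Omega>. \<exists>\<kappa>. boundary_curvatures \<Omega> p \<kappa> \<and> card {i\<in>{1..<CARD('n)}. \<kappa> i > 0} \<ge> m)"
  for \<Omega> :: "(real^'n) set"

end

theory Submission
  imports Defs
begin

text \<open>
  By the comparison principle the solution lies between the subsolution and the \<open>1\<close>-admissible
  function \<open>uu\<close>, to which it is a subsolution by Maclaurin's inequality. As all three agree on the
  boundary, the gradient of the solution there is a convex combination of the other two. In the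
  interior consider a maximum of \<open>log (1 / w) + B u\<close>, where \<open>w\<^sup>2 = 1 - \<bar>Du\<bar>\<^sup>2\<close>. There the gradient
  \<open>p\<close> is an eigenvector of the Hessian with eigenvalue \<open>- B w\<^sup>2\<close>, and the derivative of the curvature
  matrix \<open>A\<close> in direction \<open>p\<close> is \<open>- B A\<close> minus a matrix on which the linearized operator is
  nonnegative. By homogeneity \<open>B k \<psi> \<le> - D\<psi> \<bullet> (p, \<bar>p\<bar>\<^sup>2)\<close>, which is impossible for \<open>B\<close> large compared
  with \<open>sup \<bar>D\<psi>\<bar> / inf \<psi>\<close>. So the maximum is attained on the boundary or where \<open>p = 0\<close>.
\<close>

section \<open>Elementary symmetric functions and the Garding cone\<close>

text \<open>The curvatures are chosen roots of a characteristic polynomial and as such offer nothing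
  to differentiate. Their symmetric functions are the coefficients of that polynomial, that is, sums
  of principal minors, which are polynomial in the matrix entries. Derivatives are taken there,
  while eigenvalues only decide signs at a single point. The curvature matrix is not symmetric, but
  it is similar to a congruence of the Hessian by a matrix that depends on the gradient alone. Hence
  monotonicity in the Hessian holds at a fixed gradient, and ellipticity appears as a sign on
  positive semidefinite directions. The term \<open>B u\<close> in the test function makes the
  derivative of the curvature matrix along \<open>p\<close> reproduce the matrix itself, where
  Euler's identity evaluates the linearized operator. The choice
  \<open>B = (|L| + 1) / (k c)\<close> forces \<open>B k c > L\<close>. Its price is the factor
  \<open>exp (- 4 B (|M| + |d|))\<close>, in which the height of \<open>u\<close> is bounded by
  boundary values and diameter because \<open>|Du| < 1\<close>.\<close>

definition esym :: "nat \<Rightarrow> 'i set \<Rightarrow> ('i \<Rightarrow> real) \<Rightarrow> real" where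
  "esym k A f = (\<Sum>I | I \<subseteq> A \<and> card I = k. prod f I)"

lemma elem_sym_esym: "elem_sym k \<kappa> = esym k UNIV (($) \<kappa>)"
  by (simp add: elem_sym_def esym_def)

lemma esym_0 [simp]: "finite A \<Longrightarrow> esym 0 A f = 1"
proof -
  assume "finite A"
  then have "{I. I \<subseteq> A \<and> card I = 0} = {{}}"
    by (auto dest: finite_subset)
  then show ?thesis by (simp add: esym_def)
qed

lemma esym_empty [simp]: "esym (Suc k) {} f = 0"
proof -
  have "{I::'a set. I \<subseteq> {} \<and> card I = Suc k} = {}" by auto
  then show ?thesis by (simp only: esym_def sum.empty)
qed

lemma esym_insert:
  assumes "finite A" "a \<notin> A"
  shows "esym (Suc k) (insert a A) f = esym (Suc k) A f + f a * esym k A f"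
proof -
  have eq: "{I. I \<subseteq> insert a A \<and> card I = Suc k} =
      {I. I \<subseteq> A \<and> card I = Suc k} \<union> insert a ` {I. I \<subseteq> A \<and> card I = k}" (is "_ = ?P \<union> _ ` ?Q")
  proof (intro equalityI subsetI)
    fix I assume I: "I \<in> {I. I \<subseteq> insert a A \<and> card I = Suc k}"
    show "I \<in> ?P \<union> insert a ` ?Q"
    proof (cases "a \<in> I")
      case True
      then have "I = insert a (I - {a})" "I - {a} \<subseteq> A" "card (I - {a}) = k" using I by auto
      then show ?thesis by blast
    next
      case False
      then show ?thesis using I by auto
    qed
  next
    fix I assume "I \<in> ?P \<union> insert a ` ?Q"
    then show "I \<in> {I. I \<subseteq> insert a A \<and> card I = Suc k}"
    proof
      assume "I \<in> insert a ` ?Q"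
      then obtain J where J: "J \<subseteq> A" "card J = k" "I = insert a J" by auto
      then have "finite J" "a \<notin> J" using assms finite_subset by auto
      then show ?thesis using J by auto
    qed auto
  qed
  have inj: "inj_on (insert a) ?Q"
  proof (rule inj_onI)
    fix I J assume "I \<in> ?Q" "J \<in> ?Q" "insert a I = insert a J"
    moreover have "a \<notin> I" "a \<notin> J" using assms(2) calculation by auto
    ultimately show "I = J" by (metis insert_ident)
  qed
  have fin: "finite ?P" "finite ?Q" using assms by auto
  have disj: "?P \<inter> insert a ` ?Q = {}" using assms by auto
  have "prod f (insert a J) = f a * prod f J" if "J \<in> ?Q" for J
    using that assms by (subst prod.insert) (auto dest: finite_subset)
  then have "(\<Sum>I\<in>insert a ` ?Q. prod f I) = f a * (\<Sum>J\<in>?Q. prod f J)"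
    by (simp add: sum.reindex[OF inj] sum_distrib_left del: mem_Collect_eq)
  then show ?thesis
    by (simp add: esym_def eq sum.union_disjoint[OF fin(1) _ disj] fin)
qed

text \<open>Affine in the entry at \<open>a\<close>: \<open>esym k (A - {a}) f\<close> is the
  partial derivative in that entry. The later sign arguments concern these coefficients.\<close>

lemma esym_remove:
  assumes "finite A" "a \<in> A"
  shows "esym (Suc k) A f = esym (Suc k) (A - {a}) f + f a * esym k (A - {a}) f"
  using esym_insert[of "A - {a}" a k f] assms by (simp add: insert_absorb)

lemma esym_cong: "(\<And>i. i \<in> A \<Longrightarrow> f i = g i) \<Longrightarrow> esym k A f = esym k A g"
  unfolding esym_def by (intro sum.cong prod.cong) auto

lemma esym_1 [simp]: "finite A \<Longrightarrow> esym (Suc 0) A f = sum f A"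
  by (induction A rule: finite_induct) (auto simp: esym_insert)

lemma esym_card_less: "finite A \<Longrightarrow> card A < k \<Longrightarrow> esym k A f = 0"
proof -
  assume "finite A" "card A < k"
  then have "{I. I \<subseteq> A \<and> card I = k} = {}" using card_mono[of A] by (auto simp: not_le[symmetric])
  then show ?thesis by (simp only: esym_def sum.empty)
qed

text \<open>Euler's identity for a homogeneous polynomial of degree \<open>Suc k\<close>, with the
  partial derivatives written as symmetric functions of the remaining entries.\<close>

lemma esym_euler:
  assumes "finite A"
  shows "(\<Sum>j\<in>A. f j * esym k (A - {j}) f) = real (Suc k) * esym (Suc k) A f"
  using assms
proof (induction A arbitrary: k rule: finite_induct)
  case (insert a A)
  have *: "insert a A - {j} = insert a (A - {j})" if "j \<in> A" for j using that insert by auto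
  show ?case
  proof (cases k)
    case 0
    then show ?thesis using insert by simp
  next
    case (Suc m)
    have "(\<Sum>j\<in>A. f j * esym (Suc m) (insert a A - {j}) f) =
       (\<Sum>j\<in>A. f j * esym (Suc m) (A - {j}) f + f a * (f j * esym m (A - {j}) f))"
      using insert by (intro sum.cong) (auto simp: * esym_insert algebra_simps)
    also have "\<dots> = real (Suc (Suc m)) * esym (Suc (Suc m)) A f + f a * (real (Suc m) * esym (Suc m) A f)"
      by (simp add: sum.distrib insert.IH flip: sum_distrib_left)
    finally show ?thesis using insert Suc by (simp add: esym_insert algebra_simps)
  qed
qed simp

text \<open>Each \<open>k\<close>-subset of \<open>A\<close> arises from \<open>card A - k\<close>
  of the \<open>Suc k\<close>-subsets by deleting one element; this count is the factor.\<close>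

lemma esym_shift_has_derivative:
  assumes "finite A"
  shows "((\<lambda>t. esym (Suc k) A (\<lambda>i. f i + t)) has_real_derivative
    (real (card A) - real k) * esym k A (\<lambda>i. f i + t)) (at t within S)"
  using assms
proof (induction A arbitrary: k rule: finite_induct)
  case empty
  show ?case by (cases k) auto
next
  case (insert a A)
  show ?case
  proof (cases k)
    case 0
    have "((\<lambda>t. (\<Sum>i\<in>A. f i + t) + (f a + t)) has_real_derivative real (card A) + 1) (at t within S)"
      by (auto intro!: derivative_eq_intros)
    then show ?thesis using insert 0 by (simp add: algebra_simps)
  next
    case (Suc m)
    have "((\<lambda>t. esym (Suc k) A (\<lambda>i. f i + t) + (f a + t) * esym k A (\<lambda>i. f i + t)) has_real_derivative
      (real (card A) - real k) * esym k A (\<lambda>i. f i + t) +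
      ((0 + 1) * esym k A (\<lambda>i. f i + t) + (real (card A) - real m) * esym m A (\<lambda>i. f i + t) * (f a + t))) (at t within S)"
      unfolding Suc by (intro DERIV_add[OF insert.IH DERIV_mult[OF DERIV_add[OF DERIV_const DERIV_ident] insert.IH]])
    then show ?thesis using insert Suc by (simp add: esym_insert algebra_simps)
  qed
qed

lemma continuous_on_esym_shift:
  "finite A \<Longrightarrow> continuous_on S (\<lambda>t. esym k A (\<lambda>i. f i + t))"
  unfolding esym_def by (intro continuous_intros)

text \<open>The cone is given by its inequalities, the form in which admissibility supplies it.
  Index 0 is omitted since \<open>esym 0\<close> is 1.\<close>

definition garding :: "nat \<Rightarrow> 'i set \<Rightarrow> ('i \<Rightarrow> real) \<Rightarrow> bool" where
  "garding k A f \<longleftrightarrow> (\<forall>j\<in>{1..k}. 0 < esym j A f)"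

lemma garding_pos: "finite A \<Longrightarrow> garding k A f \<Longrightarrow> j \<le> k \<Longrightarrow> 0 < esym j A f"
  by (cases j) (auto simp: garding_def)

lemma garding_mono: "garding k A f \<Longrightarrow> j \<le> k \<Longrightarrow> garding j A f"
  by (auto simp: garding_def)

lemma garding_card: "finite A \<Longrightarrow> garding k A f \<Longrightarrow> k \<le> card A"
  using garding_pos[of A k f k] esym_card_less[of A k f] by (cases "k \<le> card A") auto

text \<open>The \<open>t\<close>-derivative is a nonnegative multiple of the symmetric function one
  degree lower, which by induction stays above its positive initial value.\<close>

lemma garding_shift:
  assumes "finite A" "garding k A f" "j \<le> k" "0 \<le> t"
  shows "esym j A f \<le> esym j A (\<lambda>i. f i + t)"
  using assms(3,4)
proof (induction j arbitrary: t)
  case 0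
  then show ?case using assms by simp
next
  case (Suc m)
  let ?g = "\<lambda>t. esym (Suc m) A (\<lambda>i. f i + t)"
  have card: "k \<le> card A" using assms garding_card by blast
  have "?g 0 \<le> ?g t"
  proof (rule DERIV_nonneg_imp_nondecreasing[OF Suc.prems(2)])
    fix x :: real assume "0 \<le> x"
    then have "esym m A f \<le> esym m A (\<lambda>i. f i + x)" using Suc by auto
    moreover have "0 < esym m A f" using garding_pos[OF assms(1,2)] Suc by auto
    ultimately have "0 \<le> (real (card A) - real m) * esym m A (\<lambda>i. f i + x)"
      using card Suc by simp
    then show "\<exists>y. (?g has_real_derivative y) (at x) \<and> 0 \<le> y"
      using esym_shift_has_derivative[OF assms(1), of m f x UNIV] by (intro exI conjI)
  qed
  then show ?case by simp
qed

lemma garding_add: "finite A \<Longrightarrow> garding k A f \<Longrightarrow> 0 \<le> t \<Longrightarrow> garding k A (\<lambda>i. f i + t)"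
  using garding_shift[of A k f] unfolding garding_def by fastforce

text \<open>If \<open>esym k (A - {i}) f\<close> were not positive, a shift by a constant would make it zero while
  keeping \<open>f\<close> in the cone; but there Euler's identity makes \<open>esym (Suc k)\<close> nonpositive.\<close>

lemma garding_remove:
  assumes "finite A" "garding (Suc k) A f" "i \<in> A"
  shows "garding k (A - {i}) f"
  using assms
proof (induction k arbitrary: f A i)
  case 0
  then show ?case by (simp add: garding_def)
next
  case (Suc m)
  define B where "B = A - {i}"
  have fin: "finite B" using Suc B_def by simp
  have G: "garding m B f" using Suc.IH Suc.prems garding_mono[of "Suc (Suc m)" A f "Suc m"] by (auto simp: B_def)
  have card: "Suc m \<le> card B"
    using garding_card[OF Suc.prems(1,2)] Suc.prems by (auto simp: B_def)
  have "0 < esym (Suc m) B f"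
  proof (rule ccontr)
    assume neg: "\<not> 0 < esym (Suc m) B f"
    define g where "g t = esym (Suc m) B (\<lambda>j. f j + t)" for t
    define c where "c = (real (card B) - real m) * esym m B f"
    have c: "c > 0" using card garding_pos[OF fin G] by (simp add: c_def)
    have der: "(g has_real_derivative (real (card B) - real m) * esym m B (\<lambda>j. f j + t)) (at t)" for t
      unfolding g_def by (rule esym_shift_has_derivative[OF fin])
    have ge: "c \<le> (real (card B) - real m) * esym m B (\<lambda>j. f j + t)" if "0 \<le> t" for t
      using garding_shift[OF fin G order_refl that] card by (simp add: c_def mult_left_mono)
    \<comment> \<open>The slope of \<open>g\<close> never falls below the positive number
      \<open>c\<close>, so \<open>g\<close> reaches 0 no later than at
      \<open>T = - g 0 / c\<close>.\<close>
    have grow: "g a + c * (b - a) \<le> g b" if "0 \<le> a" "a \<le> b" for a b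
    proof -
      have "g a - c * a \<le> g b - c * b"
      proof (rule DERIV_nonneg_imp_nondecreasing[OF that(2)])
        fix x assume "a \<le> x"
        then have "0 \<le> (real (card B) - real m) * esym m B (\<lambda>j. f j + x) - c"
          using ge[of x] that by simp
        moreover have "((\<lambda>a. g a - c * a) has_real_derivative
            (real (card B) - real m) * esym m B (\<lambda>j. f j + x) - c) (at x)"
          using DERIV_diff[OF der DERIV_cmult[OF DERIV_ident, of c], of x] by simp
        ultimately show "\<exists>y. ((\<lambda>a. g a - c * a) has_real_derivative y) (at x) \<and> 0 \<le> y"
          by blast
      qed
      then show ?thesis by (simp add: algebra_simps)
    qed
    define T where "T = - g 0 / c"
    have T: "0 \<le> T" using neg c by (simp add: T_def g_def divide_nonpos_pos)
    have "0 \<le> g T" using grow[of 0 T] T c by (simp add: T_def)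
    moreover have "g 0 \<le> 0" using neg by (simp add: g_def)
    moreover have "continuous_on {0..T} g" unfolding g_def by (rule continuous_on_esym_shift[OF fin])
    ultimately obtain s where s: "0 \<le> s" "g s = 0" using IVT'[of g 0 0 T] T by auto
    define \<nu> where "\<nu> j = f j + s" for j
    have zero: "esym (Suc m) B \<nu> = 0" using s by (simp add: g_def \<nu>_def[abs_def])
    have Gt: "garding (Suc m) B (\<lambda>j. f j + t)" if "s < t" for t
    proof -
      have "0 < c * (t - s)" using c that by simp
      then have "0 < g t" using grow[of s t] s that by linarith
      moreover have "garding m B (\<lambda>j. f j + t)" using garding_add[OF fin G] s that by simp
      ultimately show ?thesis by (auto simp: garding_def g_def le_Suc_eq)
    qed
    \<comment> \<open>Beyond \<open>s\<close> the shifted entries lie in the cone of order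
      \<open>Suc m\<close> over \<open>B\<close>, so the induction hypothesis applies to
      \<open>B\<close>; at \<open>s\<close> itself the limit inequality survives.\<close>
    have nonneg: "0 \<le> esym m (B - {j}) \<nu>" if "j \<in> B" for j
    proof -
      have "continuous_on UNIV (\<lambda>t. esym m (B - {j}) (\<lambda>i. f i + t))"
        by (intro continuous_on_esym_shift) (use fin in simp)
      then have "((\<lambda>t. esym m (B - {j}) (\<lambda>i. f i + t)) \<longlongrightarrow> esym m (B - {j}) (\<lambda>i. f i + s)) (at s)"
        by (simp add: continuous_on_def)
      then have "((\<lambda>t. esym m (B - {j}) (\<lambda>i. f i + t)) \<longlongrightarrow> esym m (B - {j}) \<nu>) (at_right s)"
        unfolding \<nu>_def[abs_def] by (rule tendsto_mono[rotated]) (simp add: at_le)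
      moreover have "\<forall>\<^sub>F t in at_right s. 0 \<le> esym m (B - {j}) (\<lambda>i. f i + t)"
        using eventually_at_right_less
      proof (rule eventually_mono)
        fix t assume "s < t"
        then show "0 \<le> esym m (B - {j}) (\<lambda>i. f i + t)"
          using garding_pos[OF _ Suc.IH[OF fin Gt that], of t m] fin by simp
      qed
      ultimately show ?thesis by (rule tendsto_lowerbound) simp
    qed
    have "real (Suc (Suc m)) * esym (Suc (Suc m)) B \<nu> = (\<Sum>j\<in>B. \<nu> j * esym (Suc m) (B - {j}) \<nu>)"
      by (rule esym_euler[OF fin, symmetric])
    \<comment> \<open>Where \<open>esym (Suc m) B \<nu>\<close> vanishes, removing \<open>j\<close>
      expresses the upper coefficient through the lower one with a minus sign; each summand becomes
      minus a square times a nonnegative factor.\<close>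
    also have "\<dots> = (\<Sum>j\<in>B. - ((\<nu> j)\<^sup>2 * esym m (B - {j}) \<nu>))"
    proof (rule sum.cong[OF refl])
      fix j assume "j \<in> B"
      then have "esym (Suc m) (B - {j}) \<nu> = - \<nu> j * esym m (B - {j}) \<nu>"
        using esym_remove[OF fin, of j m \<nu>] zero by simp
      then show "\<nu> j * esym (Suc m) (B - {j}) \<nu> = - ((\<nu> j)\<^sup>2 * esym m (B - {j}) \<nu>)"
        by (simp add: power2_eq_square)
    qed
    also have "\<dots> \<le> 0" by (intro sum_nonpos) (simp add: nonneg)
    finally have "esym (Suc (Suc m)) B \<nu> \<le> 0" by (simp add: mult_le_0_iff)
    \<comment> \<open>At \<open>\<nu>\<close> the entry \<open>i\<close> has coefficient zero, so
      the value over \<open>A\<close> equals the nonpositive value over \<open>B\<close>, although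
      \<open>\<nu>\<close> lies in the cone over \<open>A\<close>.\<close>
    moreover have "esym (Suc (Suc m)) A \<nu> = esym (Suc (Suc m)) B \<nu>"
      using esym_remove[OF Suc.prems(1,3), of "Suc m" \<nu>] zero by (simp add: B_def)
    moreover have "garding (Suc (Suc m)) A \<nu>"
      unfolding \<nu>_def[abs_def] by (rule garding_add[OF Suc.prems(1,2) s(1)])
    then have "0 < esym (Suc (Suc m)) A \<nu>" by (simp add: garding_def)
    ultimately show False by simp
  qed
  with G show ?case by (auto simp: garding_def B_def le_Suc_eq)
qed

lemma esym_insert2:
  assumes "finite C" "i \<notin> C" "j \<notin> C" "i \<noteq> j"
  shows "esym (Suc (Suc m)) (insert i (insert j C)) f =
    esym (Suc (Suc m)) C f + (f i + f j) * esym (Suc m) C f + f i * f j * esym m C f"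
  using assms by (simp add: esym_insert algebra_simps)

text \<open>With the sum of the two entries fixed, only their product changes, and averaging does
  not decrease it. Its coefficient is a symmetric function with both indices removed, positive by
  \<open>garding_remove\<close> applied twice.\<close>

lemma esym_average_le:
  assumes "finite A" "garding k A f" "i \<in> A" "j \<in> A" "i \<noteq> j" "l \<le> k"
    and "a = (f i + f j) / 2"
  shows "esym l A f \<le> esym l A (f(i := a, j := a))" (is "_ \<le> esym l A ?g")
proof -
  define C where "C = A - {i} - {j}"
  have A: "A = insert i (insert j C)" and C: "finite C" "i \<notin> C" "j \<notin> C" using assms by (auto simp: C_def)
  have gC: "esym m C ?g = esym m C f" for m using C by (intro esym_cong) auto
  have "a * a - f i * f j = ((f i - f j) / 2)\<^sup>2" by (simp add: assms(7) power2_eq_square field_simps)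
  then have av: "f i + f j = a + a" "f i * f j \<le> a * a"
    using assms(7) zero_le_power2[of "(f i - f j) / 2"] by (simp, linarith)
  consider "l = 0" | "l = Suc 0" | m where "l = Suc (Suc m)" by (metis not0_implies_Suc)
  then show ?thesis
  proof cases
    case 1
    then show ?thesis using assms by simp
  next
    case 2
    have "sum ?g C = sum f C" using C by (intro sum.cong) auto
    then show ?thesis using 2 C assms(5) av by (simp add: A)
  next
    case 3
    have "garding (Suc m) (A - {i}) f"
      using garding_remove[OF assms(1) garding_mono[OF assms(2)] assms(3)] 3 assms(6) by simp
    then have "garding m C f"
      unfolding C_def by (rule garding_remove[rotated]) (use assms in auto)
    then have "0 < esym m C f" using garding_pos C by blast
    then have "f i * f j * esym m C f \<le> a * a * esym m C f" using av by (intro mult_right_mono) auto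
    then show ?thesis
      using av(1) assms(5) unfolding 3 A esym_insert2[OF C assms(5)] gC by simp
  qed
qed

text \<open>A fixed sum together with the sign of \<open>esym 2\<close> bounds the norm; this makes
  the constraint set in \<open>maclaurin\<close> compact.\<close>

lemma esym_2: "finite A \<Longrightarrow> 2 * esym 2 A f = (sum f A)\<^sup>2 - (\<Sum>i\<in>A. (f i)\<^sup>2)"
proof -
  assume A: "finite A"
  have "2 * esym 2 A f = (\<Sum>j\<in>A. f j * (sum f A - f j))"
    using esym_euler[OF A, of f 1] A by (simp add: sum_diff1 numeral_2_eq_2)
  then show ?thesis
    by (simp add: right_diff_distrib sum_subtractf power2_eq_square flip: sum_distrib_right)
qed

text \<open>Replacing two entries by their average increases every \<open>esym\<close> on the cone, so the point of
  least norm among those with the same sum and no smaller symmetric functions is constant.\<close>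

lemma maclaurin:
  fixes x :: "real^'n"
  assumes "2 \<le> k" "garding k UNIV (($) x)"
  shows "esym k UNIV (($) x) \<le> real (CARD('n) choose k) * (sum (($) x) UNIV / CARD('n)) ^ k"
proof -
  define s where "s = sum (($) x) UNIV"
  \<comment> \<open>The constraints are closed conditions, yet bounded below by the positive values
    at \<open>x\<close>, so that every point of \<open>X\<close> lies in the open cone.\<close>
  define X where "X = {y::real^'n. sum (($) y) UNIV = s \<and> (\<forall>j\<in>{1..k}. esym j UNIV (($) x) \<le> esym j UNIV (($) y))}"
  have cont: "continuous_on UNIV (\<lambda>y::real^'n. esym j UNIV (($) y))" for j
    unfolding esym_def by (intro continuous_intros)
  have "closed X"
    unfolding X_def Collect_conj_eq Collect_ball_eq
    by (intro closed_Int closed_INT ballI closed_Collect_eq closed_Collect_le cont continuous_intros)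
  moreover have "bounded X"
  proof (rule boundedI)
    fix y assume y: "y \<in> X"
    have "(norm y)\<^sup>2 = (\<Sum>i\<in>UNIV. (y $ i)\<^sup>2)"
      unfolding power2_norm_eq_inner inner_vec_def by (simp add: power2_eq_square)
    also have "\<dots> = s\<^sup>2 - 2 * esym 2 UNIV (($) y)"
      using esym_2[of UNIV "($) y"] y by (simp add: X_def)
    also have "\<dots> \<le> s\<^sup>2"
      using y assms garding_pos[OF _ assms(2), of 2] by (auto simp: X_def intro: order_trans[OF less_imp_le])
    finally show "norm y \<le> \<bar>s\<bar>" by (simp add: abs_le_square_iff[symmetric])
  qed
  ultimately have "compact X" by (simp add: compact_eq_bounded_closed)
  moreover have "x \<in> X" by (simp add: X_def s_def)
  ultimately obtain y where y: "y \<in> X" "\<And>z. z \<in> X \<Longrightarrow> norm y \<le> norm z"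
    using continuous_attains_inf[of X norm] continuous_on_norm_id by blast
  have Gy: "garding k UNIV (($) y)"
    using y(1) assms(2) by (fastforce simp: X_def garding_def)
  have eq: "y $ i = y $ j" for i j
  proof (rule ccontr)
    assume ne: "y $ i \<noteq> y $ j"
    then have ij: "i \<noteq> j" by auto
    define a where "a = (y $ i + y $ j) / 2"
    define z where "z = (\<chi> l. ((($) y)(i := a, j := a)) l)"
    have z: "($) z = (($) y)(i := a, j := a)" by (auto simp: z_def)
    have split: "sum h UNIV = h i + h j + sum h (UNIV - {i} - {j})" for h :: "'n \<Rightarrow> real"
      using ij by (simp add: sum.remove[of UNIV i] sum.remove[of "UNIV - {i}" j])
    have "sum (($) z) UNIV = s"
      using y(1) ij unfolding z split[of "(($) y)(i := a, j := a)"]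
      by (simp add: X_def split[of "($) y"] a_def)
    moreover have "esym l UNIV (($) x) \<le> esym l UNIV (($) z)" if "l \<in> {1..k}" for l
      using esym_average_le[OF _ Gy _ _ ij _ a_def, of l] y(1) that
      by (auto simp: X_def z intro: order_trans)
    ultimately have "z \<in> X" by (simp add: X_def)
    then have "(norm y)\<^sup>2 \<le> (norm z)\<^sup>2" using y(2) by simp
    moreover have "(norm w)\<^sup>2 = (\<Sum>i\<in>UNIV. (w $ i)\<^sup>2)" for w :: "real^'n"
      unfolding power2_norm_eq_inner inner_vec_def by (simp add: power2_eq_square)
    ultimately have "(\<Sum>i\<in>UNIV. (y $ i)\<^sup>2) \<le> (\<Sum>i\<in>UNIV. (z $ i)\<^sup>2)" by simp
    moreover have "(\<Sum>l\<in>UNIV - {i} - {j}. (z $ l)\<^sup>2) = (\<Sum>l\<in>UNIV - {i} - {j}. (y $ l)\<^sup>2)"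
      by (intro sum.cong) (auto simp: z)
    moreover have "z $ i = a" "z $ j = a" by (simp_all add: z)
    ultimately have "(y $ i)\<^sup>2 + (y $ j)\<^sup>2 \<le> a\<^sup>2 + a\<^sup>2"
      using split[of "\<lambda>l. (y $ l)\<^sup>2"] split[of "\<lambda>l. (z $ l)\<^sup>2"] by simp
    moreover have "(y $ i)\<^sup>2 + (y $ j)\<^sup>2 - (a\<^sup>2 + a\<^sup>2) = (y $ i - y $ j)\<^sup>2 / 2"
      by (simp add: a_def power2_eq_square field_simps)
    moreover have "0 < (y $ i - y $ j)\<^sup>2" using ne by simp
    ultimately show False by simp
  qed
  have yc: "y $ i = s / CARD('n)" for i
  proof -
    have "s = (\<Sum>j\<in>UNIV. y $ j)" using y(1) by (simp add: X_def)
    also have "\<dots> = (\<Sum>j\<in>(UNIV::'n set). y $ i)" by (rule sum.cong[OF refl eq])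
    finally have "s = (\<Sum>j\<in>(UNIV::'n set). y $ i)" .
    then show ?thesis by simp
  qed
  have "esym k UNIV (($) x) \<le> esym k UNIV (($) y)" using y(1) assms by (auto simp: X_def)
  also have "\<dots> = (\<Sum>I | I \<subseteq> (UNIV::'n set) \<and> card I = k. (s / CARD('n)) ^ k)"
    unfolding esym_def by (intro sum.cong refl) (auto simp: yc)
  also have "\<dots> = real (CARD('n) choose k) * (s / CARD('n)) ^ k"
    using n_subsets[of "UNIV::'n set" k] by simp
  finally show ?thesis by (simp add: s_def)
qed

section \<open>Diagonalization of real symmetric matrices\<close>

text \<open>Induction on the dimension: a maximizer \<open>v\<close> of the quadratic form on the
  unit sphere of \<open>V\<close> is an eigenvector, and its orthogonal complement in
  \<open>V\<close> is again invariant because \<open>A\<close> is symmetric.\<close>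

lemma symmetric_matrix_eigenbasis_subspace:
  fixes A :: "real^'n^'n"
  assumes "transpose A = A" "subspace V" "\<And>x. x \<in> V \<Longrightarrow> A *v x \<in> V"
  shows "\<exists>B. B \<subseteq> V \<and> pairwise orthogonal B \<and> (\<forall>b\<in>B. norm b = 1 \<and> (\<exists>c. A *v b = c *\<^sub>R b)) \<and> V \<subseteq> span B"
  using assms(2,3)
proof (induction "dim V" arbitrary: V rule: less_induct)
  case less
  have sym: "x \<bullet> (A *v y) = (A *v x) \<bullet> y" for x y
    using assms(1) by (metis dot_lmul_matrix vector_transpose_matrix)
  show ?case
  proof (cases "V \<subseteq> {0}")
    case True
    then show ?thesis by (intro exI[of _ "{}"]) auto
  next
    case False
    then obtain z where z: "z \<in> V" "z \<noteq> 0" by auto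
    define S where "S = V \<inter> sphere 0 1"
    have "compact S" unfolding S_def using closed_subspace[OF less(2)] by (intro closed_Int_compact) auto
    moreover have "z /\<^sub>R norm z \<in> S" using z less(2) by (simp add: S_def subspace_scale)
    moreover have "continuous_on S (\<lambda>x. x \<bullet> (A *v x))" by (intro continuous_intros)
    ultimately obtain v where v: "v \<in> S" "\<And>x. x \<in> S \<Longrightarrow> x \<bullet> (A *v x) \<le> v \<bullet> (A *v v)"
      using continuous_attains_sup[of S] by blast
    define \<mu> where "\<mu> = v \<bullet> (A *v v)"
    have vV: "v \<in> V" "norm v = 1" "v \<bullet> v = 1" using v(1) by (auto simp: S_def norm_eq_1)
    have max: "x \<bullet> (A *v x) \<le> \<mu> * (norm x)\<^sup>2" if "x \<in> V" for x
    proof (cases "x = 0")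
      case False
      then have "x /\<^sub>R norm x \<in> S" using that less(2) by (simp add: S_def subspace_scale)
      then have "(x \<bullet> (A *v x)) / (norm x)\<^sup>2 \<le> \<mu>" unfolding \<mu>_def
        using v(2)[of "x /\<^sub>R norm x"] by (simp add: scaleR_matrix_vector_assoc[symmetric] matrix_vector_mult_scaleR power2_eq_square divide_inverse ac_simps)
      then show ?thesis using False by (simp add: field_simps)
    qed simp
    have orth: "y \<bullet> (A *v v) = 0" if y: "y \<in> V" "y \<bullet> v = 0" for y
    proof -
      \<comment> \<open>First variation: along \<open>v + t y\<close> the form cannot exceed
        \<open>\<mu>\<close> times the squared norm, which leaves a quadratic polynomial in
        \<open>t\<close> that is nowhere positive and has no constant term.\<close>
      have "2 * t * (y \<bullet> (A *v v)) + t\<^sup>2 * (y \<bullet> (A *v y) - \<mu> * (norm y)\<^sup>2) \<le> 0" for t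
      proof -
        have "v + t *\<^sub>R y \<in> V" using vV y less(2) by (simp add: subspace_add subspace_scale)
        note m = max[OF this]
        have "(v + t *\<^sub>R y) \<bullet> (A *v (v + t *\<^sub>R y)) =
            v \<bullet> (A *v v) + t * (y \<bullet> (A *v v)) + t * (v \<bullet> (A *v y)) + t\<^sup>2 * (y \<bullet> (A *v y))"
          by (simp add: inner_add matrix_vector_right_distrib matrix_vector_mult_scaleR power2_eq_square)
             (simp add: algebra_simps)
        moreover have "v \<bullet> (A *v y) = y \<bullet> (A *v v)" using sym[of v y] by (simp add: inner_commute)
        moreover have "(norm (v + t *\<^sub>R y))\<^sup>2 = 1 + t\<^sup>2 * (norm y)\<^sup>2"
          using vV y unfolding power2_norm_eq_inner by (simp add: inner_add inner_commute power2_eq_square)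
        ultimately have "\<mu> + 2 * t * (y \<bullet> (A *v v)) + t\<^sup>2 * (y \<bullet> (A *v y)) \<le> \<mu> * (1 + t\<^sup>2 * (norm y)\<^sup>2)"
          using m by (simp add: \<mu>_def)
        then show ?thesis by (simp add: algebra_simps)
      qed
      note q = this
      define a b where "a = y \<bullet> (A *v v)" and "b = \<mu> * (norm y)\<^sup>2 - y \<bullet> (A *v y)"
      have q': "2 * t * a \<le> t\<^sup>2 * b" for t using q[of t] by (simp add: a_def b_def algebra_simps)
      have b: "0 \<le> b" using max[OF y(1)] by (simp add: b_def)
      \<comment> \<open>Inserting \<open>t = r\<close> yields \<open>r^2 (b + 2) \<le> 0\<close>;
        the added 1 keeps the denominator positive when \<open>b = 0\<close>.\<close>
      define r where "r = a / (b + 1)"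
      have a: "a = r * (b + 1)" using b by (simp add: r_def)
      have "2 * r * a \<le> r\<^sup>2 * b" by (rule q')
      then have "r\<^sup>2 * (b + 2) \<le> 0" by (simp add: a power2_eq_square algebra_simps)
      then have "a = 0" using b by (simp add: a mult_le_0_iff)
      then show ?thesis by (simp add: a_def)
    qed
    have eig: "A *v v = \<mu> *\<^sub>R v"
    proof -
      let ?y = "A *v v - \<mu> *\<^sub>R v"
      have "?y \<in> V" using less vV by (simp add: subspace_diff subspace_scale)
      moreover have 0: "?y \<bullet> v = 0" using vV by (simp add: \<mu>_def inner_diff inner_commute)
      ultimately have "?y \<bullet> (A *v v) = 0" by (rule orth)
      then have "?y \<bullet> ?y = 0" using 0 by (simp add: inner_diff_right)
      then show ?thesis by simp
    qed
    define W where "W = {x \<in> V. x \<bullet> v = 0}"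
    have W: "subspace W" using less(2) by (auto simp: W_def subspace_def inner_add)
    have WA: "A *v x \<in> W" if "x \<in> W" for x
      using that less(3) sym[of x v] eig by (auto simp: W_def inner_commute)
    have "v \<notin> W" using vV by (simp add: W_def)
    moreover have "W \<subseteq> V" by (auto simp: W_def)
    ultimately have "W \<subset> V" using vV(1) by blast
    then have "dim W < dim V" using dim_psubset[of W V] W less(2) by (simp add: span_eq_iff[THEN iffD2])
    from less(1)[OF this W WA] obtain B where B: "B \<subseteq> W" "pairwise orthogonal B"
      "\<forall>b\<in>B. norm b = 1 \<and> (\<exists>c. A *v b = c *\<^sub>R b)" "W \<subseteq> span B" by blast
    show ?thesis
    proof (intro exI[of _ "insert v B"] conjI)
      show "insert v B \<subseteq> V" using B vV by (auto simp: W_def)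
      show "pairwise orthogonal (insert v B)"
        using B(1,2) by (auto simp: pairwise_insert W_def orthogonal_def inner_commute)
      show "\<forall>b\<in>insert v B. norm b = 1 \<and> (\<exists>c. A *v b = c *\<^sub>R b)" using B vV eig by auto
      show "V \<subseteq> span (insert v B)"
      proof
        fix x assume "x \<in> V"
        then have "x - (x \<bullet> v) *\<^sub>R v \<in> W" using vV less(2)
          by (simp add: W_def inner_diff subspace_diff subspace_scale)
        then show "x \<in> span (insert v B)" using B(4) by (auto simp: span_breakdown_eq)
      qed
    qed
  qed
qed

definition diag :: "('n \<Rightarrow> real) \<Rightarrow> real^'n^'n" where
  "diag d = (\<chi> i j. if i = j then d i else 0)"

theorem symmetric_matrix_diagonalizable:
  fixes A :: "real^'n^'n"
  assumes "transpose A = A"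
  obtains P d where "orthogonal_matrix P" "transpose P ** A ** P = diag d"
proof -
  obtain B where B: "pairwise orthogonal B" "\<And>b. b \<in> B \<Longrightarrow> norm b = 1"
      "\<And>b. b \<in> B \<Longrightarrow> \<exists>c. A *v b = c *\<^sub>R b" "span B = UNIV"
    using symmetric_matrix_eigenbasis_subspace[OF assms, of UNIV] by auto
  have ind: "independent B"
    using B(1,2) by (intro pairwise_orthogonal_independent) force+
  then have "card B = CARD('n)" using dim_span[of B] dim_eq_card_independent[OF ind] B(4) by simp
  moreover have "finite B" using ind by (rule independent_imp_finite)
  ultimately obtain b where b: "bij_betw b (UNIV::'n set) B"
    using finite_same_card_bij[of "UNIV::'n set" B] by auto
  then have bB: "b i \<in> B" for i by (auto simp: bij_betw_def)
  have bb: "b i \<bullet> b j = (if i = j then 1 else 0)" for i j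
  proof (cases "i = j")
    case False
    then have "b i \<noteq> b j" using b by (metis UNIV_I bij_betw_inv_into_left)
    then show ?thesis using B(1) bB False by (auto simp: pairwise_def orthogonal_def)
  qed (use B(2)[OF bB] in \<open>auto simp: norm_eq_1\<close>)
  obtain d where d: "\<And>i. A *v b i = d i *\<^sub>R b i" using B(3)[OF bB] by metis
  define P where "P = (\<chi> i j. b j $ i)"
  have col: "column j P = b j" for j by (simp add: P_def column_def vec_eq_iff)
  have "orthogonal_matrix P"
    by (simp add: orthogonal_matrix_orthonormal_columns col bb norm_eq_1 orthogonal_def)
  moreover have "transpose P ** A ** P = diag d"
  proof -
    have "(transpose P ** (A ** P)) $ i $ j = (diag d) $ i $ j" for i j
    proof -
      have "column j (A ** P) = A *v b j"
        unfolding col[symmetric] by (simp add: vec_eq_iff column_def matrix_matrix_mult_def matrix_vector_mult_def)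
      moreover have "(transpose P ** (A ** P)) $ i $ j = column i P \<bullet> column j (A ** P)"
        by (simp add: matrix_matrix_mult_def transpose_def column_def inner_vec_def)
      ultimately show ?thesis by (simp add: col d bb diag_def)
    qed
    then show ?thesis by (simp add: vec_eq_iff matrix_mul_assoc)
  qed
  ultimately show ?thesis using that by blast
qed

section \<open>Sums of principal minors\<close>

text \<open>Replacing the rows outside \<open>I\<close> by unit vectors gives the principal minor on
  \<open>I\<close> without a matrix type of smaller size.\<close>

definition minor_sum :: "nat \<Rightarrow> real^'n^'n \<Rightarrow> real" where
  "minor_sum k A = (\<Sum>I | card I = k. det (\<chi> i. if i \<in> I then A $ i else axis i 1))"

lemma det_row_sums:
  "det (\<chi> i. a i + b i) = (\<Sum>I\<in>UNIV. det (\<chi> i. if i \<in> I then a i else b i))" for a b :: "'n \<Rightarrow> real^'n"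
proof -
  have "(\<Prod>i\<in>UNIV. (a i + b i) $ p i) = (\<Sum>I\<in>UNIV. \<Prod>i\<in>UNIV. (if i \<in> I then a i else b i) $ p i)" for p
  proof -
    have "(\<Prod>i\<in>UNIV. (if i \<in> I then a i else b i) $ p i) =
        (\<Prod>i\<in>I. a i $ p i) * (\<Prod>i\<in>UNIV - I. b i $ p i)" for I
      by (simp add: if_distrib[of "\<lambda>v. v $ _"] prod.If_cases Compl_eq_Diff_UNIV cong: if_cong)
    then show ?thesis using prod_add[of UNIV "\<lambda>i. a i $ p i" "\<lambda>i. b i $ p i"] by simp
  qed
  then have "det (\<chi> i. a i + b i) =
      (\<Sum>p | p permutes UNIV. \<Sum>I\<in>UNIV. of_int (sign p) * (\<Prod>i\<in>UNIV. (if i \<in> I then a i else b i) $ p i))"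
    by (simp add: det_def sum_distrib_left)
  also have "\<dots> = (\<Sum>I\<in>UNIV. \<Sum>p | p permutes UNIV. of_int (sign p) * (\<Prod>i\<in>UNIV. (if i \<in> I then a i else b i) $ p i))"
    by (rule sum.swap)
  finally show ?thesis by (simp add: det_def)
qed

lemma sum_by_card:
  fixes g :: "'n::finite set \<Rightarrow> real"
  assumes "finite A"
  shows "(\<Sum>I\<in>Pow A. g I * s ^ (card A - card I)) =
    (\<Sum>k\<le>card A. (\<Sum>I | I \<subseteq> A \<and> card I = k. g I) * s ^ (card A - k))"
proof -
  have "(\<Sum>I\<in>Pow A. g I * s ^ (card A - card I)) =
      (\<Sum>k\<in>{..card A}. \<Sum>I | I \<in> Pow A \<and> card I = k. g I * s ^ (card A - card I))"
    using assms by (intro sum.group[symmetric]) (auto intro: card_mono)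
  also have "\<dots> = (\<Sum>k\<le>card A. (\<Sum>I | I \<subseteq> A \<and> card I = k. g I) * s ^ (card A - k))"
    by (intro sum.cong refl) (auto simp: sum_distrib_right intro!: sum.cong)
  finally show ?thesis .
qed

text \<open>Each row splits into \<open>A $ i\<close> and \<open>s\<close> times a unit vector; a
  choice of \<open>I\<close> leaves one factor \<open>s\<close> per row outside \<open>I\<close>.
  Thus the minor sums are the coefficients of the characteristic polynomial, and their invariance
  can be checked on determinants.\<close>

lemma det_mat_add:
  "det (mat s + A) = (\<Sum>k\<le>CARD('n). minor_sum k A * s ^ (CARD('n) - k))" for A :: "real^'n^'n"
proof -
  have "mat s + A = (\<chi> i. A $ i + s *s axis i 1)"
    by (auto simp: vec_eq_iff mat_def axis_def)
  then have "det (mat s + A) = (\<Sum>I\<in>UNIV. det (\<chi> i. if i \<in> I then A $ i else s *s axis i 1))"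
    by (simp add: det_row_sums)
  also have "\<dots> = (\<Sum>I\<in>Pow UNIV. det (\<chi> i. if i \<in> I then A $ i else axis i 1) * s ^ (CARD('n) - card I))"
  proof (rule sum.cong)
    fix I :: "'n set"
    have "(\<chi> i. if i \<in> I then A $ i else s *s axis i 1) =
        (\<chi> i. (if i \<in> I then 1 else s) *s (if i \<in> I then A $ i else axis i 1))"
      by (simp add: vec_eq_iff)
    moreover have "(\<Prod>i\<in>UNIV. if i \<in> I then 1 else s) = s ^ (CARD('n) - card I)"
      by (simp add: prod.If_cases card_Diff_subset Compl_eq_Diff_UNIV)
    ultimately show "det (\<chi> i. if i \<in> I then A $ i else s *s axis i 1) =
        det (\<chi> i. if i \<in> I then A $ i else axis i 1) * s ^ (CARD('n) - card I)"
      by (simp add: det_rows_mul)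
  qed simp
  finally show ?thesis
    using sum_by_card[of UNIV "\<lambda>I. det (\<chi> i. if i \<in> I then A $ i else axis i 1)" s]
    by (simp add: minor_sum_def)
qed

lemma prod_add_esym:
  fixes d :: "'n::finite \<Rightarrow> real"
  shows "(\<Prod>i\<in>A. s + d i) = (\<Sum>k\<le>card A. esym k A d * s ^ (card A - k))"
proof -
  have "(\<Prod>i\<in>A. s + d i) = (\<Sum>I\<in>Pow A. prod d I * s ^ (card A - card I))"
    using prod_add[of A d "\<lambda>i. s"] by (auto simp: add.commute card_Diff_subset intro!: sum.cong)
  then show ?thesis by (simp add: sum_by_card esym_def)
qed

lemma coeffs_eqI:
  fixes a b :: "nat \<Rightarrow> real"
  assumes "\<And>s. (\<Sum>k\<le>n. a k * s ^ (n - k)) = (\<Sum>k\<le>n. b k * s ^ (n - k))" "k \<le> n"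
  shows "a k = b k"
proof -
  have rev: "(\<Sum>k\<le>n. c k * s ^ (n - k)) = (\<Sum>i\<le>n. c (n - i) * s ^ i)" for c :: "nat \<Rightarrow> real" and s
    by (rule sum.reindex_bij_witness[of _ "\<lambda>i. n - i" "\<lambda>i. n - i"]) auto
  have "\<forall>i\<le>n. a (n - i) = b (n - i)"
    using polyfun_eq_coeffs[of "\<lambda>i. a (n - i)" n "\<lambda>i. b (n - i)"] assms(1) by (simp add: rev)
  then show ?thesis using assms(2) by (metis diff_diff_cancel diff_le_self)
qed

lemma minor_sum_card_less: "CARD('n) < k \<Longrightarrow> minor_sum k (A::real^'n^'n) = 0"
proof -
  assume "CARD('n) < k"
  then have "{I::'n set. card I = k} = {}" using card_mono[of "UNIV::'n set"] by (auto simp: not_le[symmetric])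
  then show ?thesis by (simp only: minor_sum_def sum.empty)
qed

lemma minor_sum_cong_charpoly:
  fixes A B :: "real^'n^'n"
  assumes "\<And>s. det (mat s + A) = det (mat s + B)"
  shows "minor_sum k A = minor_sum k B"
proof (cases "k \<le> CARD('n)")
  case True
  show ?thesis by (rule coeffs_eqI[OF _ True]) (use assms in \<open>simp add: det_mat_add\<close>)
qed (simp add: minor_sum_card_less)

lemma minor_sum_esym:
  fixes A :: "real^'n^'n" and d :: "'n \<Rightarrow> real"
  assumes "\<And>s. det (mat s + A) = (\<Prod>i\<in>UNIV. s + d i)"
  shows "minor_sum k A = esym k UNIV d"
proof (cases "k \<le> CARD('n)")
  case True
  have "(\<Sum>k\<le>CARD('n). minor_sum k A * s ^ (CARD('n) - k)) =
      (\<Sum>k\<le>CARD('n). esym k UNIV d * s ^ (CARD('n) - k))" for s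
    using assms[of s] prod_add_esym[where A=UNIV and d=d and s=s] by (simp add: det_mat_add)
  from coeffs_eqI[OF this True] show ?thesis .
qed (simp add: minor_sum_card_less esym_card_less)

lemma mat_mult_commute: "mat s ** A = A ** mat s" for A :: "real^'n^'n"
  by (simp add: vec_eq_iff matrix_matrix_mult_def mat_def if_distrib[of "\<lambda>x. x * _"]
      if_distrib[of "\<lambda>x. _ * x"] mult.commute cong: if_cong)

lemma matrix_add_rdistrib: "(A + B) ** C = A ** C + B ** C" for A B C :: "real^'n^'n"
  by (simp add: vec_eq_iff matrix_matrix_mult_def distrib_right sum.distrib)

text \<open>\<open>X\<close> intertwines the two matrices, and \<open>det X\<close> cancels. With
  \<open>X\<close> the square root of the inverse metric this symmetrizes the curvature matrix; with
  \<open>X\<close> a transposed orthogonal matrix it gives invariance under conjugation.\<close>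

lemma det_mat_add_mult_commute:
  fixes X Y :: "real^'n^'n"
  assumes "invertible X"
  shows "det (mat s + X ** Y) = det (mat s + Y ** X)"
proof -
  have "(mat s + X ** Y) ** X = X ** (mat s + Y ** X)"
    by (simp add: matrix_add_ldistrib matrix_add_rdistrib mat_mult_commute matrix_mul_assoc)
  then have "det (mat s + X ** Y) * det X = det X * det (mat s + Y ** X)" by (metis det_mul)
  then show ?thesis using assms by (simp add: invertible_det_nz)
qed

lemma minor_sum_mult_commute:
  "invertible X \<Longrightarrow> minor_sum k (X ** Y) = minor_sum k (Y ** X)" for X Y :: "real^'n^'n"
  by (intro minor_sum_cong_charpoly det_mat_add_mult_commute)

lemma det_mat_add_diag: "det (mat s + diag d) = (\<Prod>i\<in>UNIV. s + d i)" for d :: "'n::finite \<Rightarrow> real"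
proof -
  have "det (mat s + diag d) = (\<Prod>i\<in>UNIV. (mat s + diag d) $ i $ i)"
    by (rule det_diagonal) (simp add: mat_def diag_def)
  then show ?thesis by (simp add: mat_def diag_def)
qed

lemma minor_sum_diag: "minor_sum k (diag d) = esym k UNIV d"
  by (intro minor_sum_esym det_mat_add_diag)

lemma minor_sum_conj:
  fixes A :: "real^'n^'n"
  assumes "orthogonal_matrix P"
  shows "minor_sum k (transpose P ** A ** P) = minor_sum k A"
proof -
  have "invertible (transpose P)" using assms by (auto simp: orthogonal_matrix_def invertible_def)
  then have "minor_sum k (transpose P ** (A ** P)) = minor_sum k ((A ** P) ** transpose P)"
    by (rule minor_sum_mult_commute)
  also have "\<dots> = minor_sum k A" using assms by (simp add: orthogonal_matrix_def flip: matrix_mul_assoc)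
  finally show ?thesis by (simp add: matrix_mul_assoc)
qed

lemma minor_sum_scale: "minor_sum k (c *\<^sub>R A) = c ^ k * minor_sum k A" for A :: "real^'n^'n"
proof -
  have "det (\<chi> i. if i \<in> I then (c *\<^sub>R A) $ i else axis i 1) =
      c ^ card I * det (\<chi> i. if i \<in> I then A $ i else axis i 1)" for I
  proof -
    have "(\<chi> i. if i \<in> I then (c *\<^sub>R A) $ i else axis i 1) =
        (\<chi> i. (if i \<in> I then c else 1) *s (if i \<in> I then A $ i else axis i 1))"
      by (simp add: vec_eq_iff)
    moreover have "(\<Prod>i\<in>UNIV. if i \<in> I then c else 1) = c ^ card I" by (simp add: prod.If_cases)
    ultimately show ?thesis by (simp add: det_rows_mul)
  qed
  then show ?thesis by (simp add: minor_sum_def sum_distrib_left)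
qed

definition outer :: "real^'n \<Rightarrow> real^'n^'n" where
  "outer v = (\<chi> i j. v $ i * v $ j)"

text \<open>In the expansion by rows, a choice containing two multiples of \<open>v\<close> has
  determinant zero, so the terms with at most one such row remain. The identity is polynomial and
  holds also when some \<open>d i\<close> vanish.\<close>

lemma det_diag_add_rank_one:
  fixes v :: "real^'n"
  shows "det (\<chi> i. c i *s v + d i *s axis i 1) =
    (\<Prod>i\<in>UNIV. d i) + (\<Sum>j\<in>UNIV. c j * v $ j * (\<Prod>i\<in>UNIV - {j}. d i))"
proof -
  define D where "D I = det (\<chi> i. if i \<in> I then c i *s v else d i *s axis i 1)" for I
  have D: "D I = (\<Prod>i\<in>UNIV. if i \<in> I then c i else d i) * det (\<chi> i. if i \<in> I then v else axis i 1)" for I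
  proof -
    have "(\<chi> i. if i \<in> I then c i *s v else d i *s axis i 1) =
      (\<chi> i. (if i \<in> I then c i else d i) *s (if i \<in> I then v else axis i 1))"
      by (simp add: vec_eq_iff)
    then show ?thesis unfolding D_def by (simp only: det_rows_mul)
  qed
  have mat1: "(\<chi> i. axis i 1) = (mat 1 :: real^'n^'n)"
    by (simp add: vec_eq_iff mat_def axis_def)
  have D0: "D {} = (\<Prod>i\<in>UNIV. d i)" by (simp add: D mat1)
  have D1: "D {j} = c j * v $ j * (\<Prod>i\<in>UNIV - {j}. d i)" for j
  proof -
    have "(\<chi> i. if i = j then v else axis i 1) =
       (\<chi> i. if i = j then sum (\<lambda>i. v$i *s row i (mat 1)) UNIV else row i (mat 1 :: real^'n^'n))"
      by (simp add: vec_eq_iff row_def mat_def axis_def if_distrib[of "\<lambda>x. _ * x"] eq_commute cong: if_cong)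
    then have "det (\<chi> i. if i = j then v else axis i 1) = v $ j"
      using cramer_lemma_transpose[of j v "mat 1"] by simp
    moreover have "(\<Prod>i\<in>UNIV. if i = j then c i else d i) = c j * (\<Prod>i\<in>UNIV - {j}. d i)"
      by (simp add: prod.remove[of UNIV j])
    ultimately show ?thesis by (simp add: D)
  qed
  have D2: "D I = 0" if "I \<notin> insert {} ((\<lambda>j. {j}) ` UNIV)" for I
  proof -
    have "I \<noteq> {}" "\<And>j. I \<noteq> {j}" using that by auto
    then obtain i j where "i \<in> I" "j \<in> I" "i \<noteq> j" by (metis all_not_in_conv insertI1 is_singletonI' is_singleton_def)
    then have "det (\<chi> i. if i \<in> I then v else axis i 1) = 0"
      by (intro det_identical_rows[of i j]) (auto simp: row_def)
    then show ?thesis by (simp add: D)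
  qed
  have "det (\<chi> i. c i *s v + d i *s axis i 1) = (\<Sum>I\<in>UNIV. D I)"
    by (simp add: det_row_sums D_def)
  also have "\<dots> = (\<Sum>I\<in>insert {} ((\<lambda>j. {j}) ` UNIV). D I)"
    by (rule sum.mono_neutral_right) (use D2 in auto)
  also have "\<dots> = D {} + (\<Sum>j\<in>UNIV. D {j})"
    by (subst sum.insert) (auto simp: sum.reindex inj_on_def)
  finally show ?thesis by (simp add: D0 D1)
qed

text \<open>A rank-one term enters affinely, and its slope is a weighted sum of the partial
  derivatives of \<open>esym\<close>.\<close>

lemma minor_sum_diag_add_outer:
  fixes v :: "real^'n"
  shows "minor_sum (Suc k) (diag d + r *\<^sub>R outer v) =
    esym (Suc k) UNIV d + r * (\<Sum>j\<in>UNIV. (v $ j)\<^sup>2 * esym k (UNIV - {j}) d)"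
proof (cases "Suc k \<le> CARD('n)")
  case True
  define N where "N = CARD('n) - 1"
  have N: "CARD('n) = Suc N" by (simp add: N_def)
  define b where "b k = r * (\<Sum>j\<in>UNIV. (v $ j)\<^sup>2 * esym k (UNIV - {j}) d)" for k
  \<comment> \<open>A product omitting one index has one factor less, so its coefficient
    \<open>b m\<close> contributes at index \<open>Suc m\<close>, and nothing is added at index
    0.\<close>
  have "(\<Sum>k\<le>Suc N. minor_sum k (diag d + r *\<^sub>R outer v) * s ^ (Suc N - k)) =
     (\<Sum>k\<le>Suc N. (esym k UNIV d + (case k of 0 \<Rightarrow> 0 | Suc m \<Rightarrow> b m)) * s ^ (Suc N - k))" for s
  proof -
    have "mat s + (diag d + r *\<^sub>R outer v) = (\<chi> i. (r * v $ i) *s v + (s + d i) *s axis i 1)"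
      by (auto simp: vec_eq_iff mat_def axis_def diag_def outer_def)
    then have "det (mat s + (diag d + r *\<^sub>R outer v)) =
        (\<Prod>i\<in>UNIV. s + d i) + (\<Sum>j\<in>UNIV. r * v $ j * v $ j * (\<Prod>i\<in>UNIV - {j}. s + d i))"
      by (simp only: det_diag_add_rank_one)
    also have "(\<Sum>j\<in>UNIV. r * v $ j * v $ j * (\<Prod>i\<in>UNIV - {j}. s + d i)) = (\<Sum>k\<le>N. b k * s ^ (N - k))"
    proof -
      have "(\<Prod>i\<in>UNIV - {j}. s + d i) = (\<Sum>k\<le>N. esym k (UNIV - {j}) d * s ^ (N - k))" for j
        by (simp add: prod_add_esym N_def)
      then have "(\<Sum>j\<in>UNIV. r * v $ j * v $ j * (\<Prod>i\<in>UNIV - {j}. s + d i)) =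
         (\<Sum>j\<in>UNIV. \<Sum>k\<le>N. r * v $ j * v $ j * (esym k (UNIV - {j}) d * s ^ (N - k)))"
        by (simp add: sum_distrib_left)
      also have "\<dots> = (\<Sum>k\<le>N. \<Sum>j\<in>UNIV. r * v $ j * v $ j * (esym k (UNIV - {j}) d * s ^ (N - k)))"
        by (rule sum.swap)
      also have "\<dots> = (\<Sum>k\<le>N. b k * s ^ (N - k))"
        by (simp add: b_def sum_distrib_left sum_distrib_right power2_eq_square ac_simps)
      finally show ?thesis .
    qed
    also have "(\<Sum>k\<le>N. b k * s ^ (N - k)) = (\<Sum>k\<le>Suc N. (case k of 0 \<Rightarrow> 0 | Suc m \<Rightarrow> b m) * s ^ (Suc N - k))"
      unfolding sum.atMost_Suc_shift by simp
    finally show ?thesis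
      by (simp only: det_mat_add N prod_add_esym distrib_right sum.distrib)
  qed
  from coeffs_eqI[OF this, of "Suc k"] True show ?thesis by (simp add: N b_def)
next
  case False
  have "esym k (UNIV - {j}) d = 0" for j :: 'n
  proof (rule esym_card_less)
    show "card (UNIV - {j}) < k"
      using False zero_less_card_finite[where 'a='n] card_Diff_singleton[OF UNIV_I, of j] by linarith
  qed simp
  then show ?thesis using False by (simp add: minor_sum_card_less esym_card_less)
qed

section \<open>Monotonicity of minor sums along positive semidefinite matrices\<close>

definition mgarding :: "nat \<Rightarrow> real^'n^'n \<Rightarrow> bool" where
  "mgarding k A \<longleftrightarrow> (\<forall>j\<in>{1..k}. 0 < minor_sum j A)"

lemma transpose_outer [simp]: "transpose (outer v) = outer v"
  by (simp add: outer_def transpose_def vec_eq_iff mult.commute)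

lemma transpose_conj_outer: "transpose P ** outer v ** P = outer (transpose P *v v)" for P :: "real^'n^'n"
  by (simp add: vec_eq_iff matrix_matrix_mult_def matrix_vector_mult_def outer_def transpose_def
      sum_distrib_left sum_distrib_right sum_product ac_simps)

text \<open>In an eigenbasis of \<open>A\<close> the slope \<open>c\<close> combines the values
  \<open>esym k (UNIV - {j}) d\<close> with the squared components of \<open>v\<close> as weights;
  \<open>garding_remove\<close> makes these values positive. Ellipticity of the curvature operator
  goes back to this.\<close>

lemma minor_sum_add_outer:
  fixes A :: "real^'n^'n"
  assumes "transpose A = A"
  obtains c where "\<And>r. minor_sum (Suc k) (A + r *\<^sub>R outer v) = minor_sum (Suc k) A + r * c"
    "mgarding (Suc k) A \<Longrightarrow> 0 \<le> c" "mgarding (Suc k) A \<Longrightarrow> v \<noteq> 0 \<Longrightarrow> 0 < c"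
proof -
  obtain P d where P: "orthogonal_matrix P" and d: "transpose P ** A ** P = diag d"
    using symmetric_matrix_diagonalizable[OF assms] .
  define w where "w = transpose P *v v"
  define c where "c = (\<Sum>j\<in>UNIV. (w $ j)\<^sup>2 * esym k (UNIV - {j}) d)"
  have conj: "minor_sum m (A + r *\<^sub>R outer v) = minor_sum m (diag d + r *\<^sub>R outer w)" for m r
    using minor_sum_conj[OF P, of m "A + r *\<^sub>R outer v"]
    by (simp add: matrix_add_ldistrib matrix_add_rdistrib matrix_scalar_ac d w_def transpose_conj_outer
        del: transpose_matrix_vector flip: scalar_matrix_assoc)
  have conj0: "minor_sum m A = esym m UNIV d" for m
    using minor_sum_conj[OF P, of m A] by (simp add: d minor_sum_diag)
  have pos: "0 < esym k (UNIV - {j}) d" if "mgarding (Suc k) A" for j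
    using garding_pos[OF _ garding_remove[of UNIV k d j], of k] that
    by (simp add: mgarding_def garding_def conj0)
  show thesis
  proof (rule that[of c])
    show "minor_sum (Suc k) (A + r *\<^sub>R outer v) = minor_sum (Suc k) A + r * c" for r
      by (simp add: conj conj0 minor_sum_diag_add_outer c_def)
    show "0 \<le> c" if "mgarding (Suc k) A"
      unfolding c_def by (intro sum_nonneg mult_nonneg_nonneg) (auto intro: less_imp_le[OF pos[OF that]])
    show "0 < c" if "mgarding (Suc k) A" "v \<noteq> 0"
    proof -
      have "P *v w = v" using P by (simp add: w_def orthogonal_matrix_def matrix_vector_mul_assoc del: transpose_matrix_vector)
      then have "w \<noteq> 0" using that(2) by auto
      then obtain j where j: "w $ j \<noteq> 0" by (auto simp: vec_eq_iff)
      show ?thesis unfolding c_def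
      proof (rule sum_pos2[of _ j])
        show "0 < (w $ j)\<^sup>2 * esym k (UNIV - {j}) d" using j pos[OF that(1)] by simp
      qed (auto intro!: mult_nonneg_nonneg less_imp_le[OF pos[OF that(1)]])
    qed
  qed
qed

lemma psd_eq_sum_outer:
  fixes M :: "real^'n^'n"
  assumes "transpose M = M" "\<And>v. 0 \<le> v \<bullet> (M *v v)"
  obtains m v where "\<And>i. 0 \<le> m i" "M = (\<Sum>i\<in>(UNIV::'n set). m i *\<^sub>R outer (v i))"
proof -
  obtain P d where P: "orthogonal_matrix P" and d: "transpose P ** M ** P = diag d"
    using symmetric_matrix_diagonalizable[OF assms(1)] .
  have "P ** (transpose P ** M ** P) ** transpose P = (P ** transpose P) ** M ** (P ** transpose P)"
    by (simp add: matrix_mul_assoc)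
  then have M: "M = P ** diag d ** transpose P" using P by (simp add: d orthogonal_matrix_def)
  have "d i = column i P \<bullet> (M *v column i P)" for i
  proof -
    have "d i = (transpose P ** (M ** P)) $ i $ i" by (simp add: matrix_mul_assoc d diag_def)
    also have "\<dots> = column i P \<bullet> (M *v column i P)"
      by (simp add: matrix_matrix_mult_def transpose_def column_def inner_vec_def matrix_vector_mult_def)
    finally show ?thesis .
  qed
  then have "0 \<le> d i" for i using assms(2) by simp
  moreover have "M = (\<Sum>i\<in>UNIV. d i *\<^sub>R outer (column i P))"
    unfolding M by (simp add: vec_eq_iff matrix_matrix_mult_def transpose_def column_def outer_def diag_def
        if_distrib[of "\<lambda>x. _ * x"] cong: if_cong) (simp add: ac_simps)
  ultimately show thesis by (rule that)
qed

text \<open>The positive semidefinite matrix is added one rank-one term at a time. The minor sums up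
  to order \<open>k\<close> do not decrease, so each intermediate matrix remains in the cone and the
  next step is justified.\<close>

lemma mgarding_minor_sum_mono:
  fixes A M :: "real^'n^'n"
  assumes "transpose A = A" "mgarding k A" "transpose M = M" "\<And>v. 0 \<le> v \<bullet> (M *v v)"
  shows "\<forall>j\<in>{1..k}. minor_sum j A \<le> minor_sum j (A + M)"
proof -
  obtain m v where m: "\<And>i. 0 \<le> m i" and M: "M = (\<Sum>i\<in>(UNIV::'n set). m i *\<^sub>R outer (v i))"
    using psd_eq_sum_outer[OF assms(3,4)] by metis
  have "transpose (A + (\<Sum>i\<in>J. m i *\<^sub>R outer (v i))) = A + (\<Sum>i\<in>J. m i *\<^sub>R outer (v i)) \<and>
      (\<forall>j\<in>{1..k}. minor_sum j A \<le> minor_sum j (A + (\<Sum>i\<in>J. m i *\<^sub>R outer (v i))))" for J :: "'n set"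
  proof (induction J rule: finite_induct[OF finite])
    case 1
    then show ?case using assms(1) by simp
  next
    case (2 i J)
    define B where "B = A + (\<Sum>i\<in>J. m i *\<^sub>R outer (v i))"
    have B: "transpose B = B" "\<forall>j\<in>{1..k}. minor_sum j A \<le> minor_sum j B" using 2 by (auto simp: B_def)
    have eq: "A + (\<Sum>i\<in>insert i J. m i *\<^sub>R outer (v i)) = B + m i *\<^sub>R outer (v i)"
      using 2 by (simp add: B_def algebra_simps)
    have "minor_sum j A \<le> minor_sum j (B + m i *\<^sub>R outer (v i))" if j: "j \<in> {1..k}" for j
    proof -
      obtain l where l: "j = Suc l" using j by (cases j) auto
      have "mgarding (Suc l) B" unfolding mgarding_def
      proof
        fix a assume "a \<in> {1..Suc l}"
        then have "a \<in> {1..k}" using j l by auto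
        then show "0 < minor_sum a B" using B(2) assms(2) unfolding mgarding_def by (meson less_le_trans)
      qed
      then show ?thesis
        using minor_sum_add_outer[OF B(1), of l "v i"] B(2) j m[of i] l
        by (metis add_increasing2 mult_nonneg_nonneg)
    qed
    moreover have "transpose (B + m i *\<^sub>R outer (v i)) = B + m i *\<^sub>R outer (v i)"
      using B(1) by (simp add: transpose_def vec_eq_iff outer_def mult.commute)
    ultimately show ?case unfolding eq by blast
  qed
  then show ?thesis by (simp add: M)
qed

lemma differentiable_prod:
  fixes f :: "'i \<Rightarrow> 'a::real_normed_vector \<Rightarrow> real"
  assumes "\<And>i. i \<in> I \<Longrightarrow> f i differentiable (at x within S)"
  shows "(\<lambda>x. \<Prod>i\<in>I. f i x) differentiable (at x within S)"
proof -
  obtain f' where "\<And>i. i \<in> I \<Longrightarrow> (f i has_derivative f' i) (at x within S)"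
    using assms unfolding differentiable_def by metis
  then show ?thesis unfolding differentiable_def using has_derivative_prod by blast
qed

text \<open>The Leibniz form displays a polynomial in the entries, from which differentiability,
  continuity and Lipschitz bounds are read off by closure rules.\<close>

lemma minor_sum_expand:
  "minor_sum k A = (\<Sum>I | card I = k. \<Sum>p | p permutes UNIV. of_int (sign p) *
    (\<Prod>i\<in>UNIV. if i \<in> I then A $ i $ p i else axis i 1 $ p i))" for A :: "real^'n^'n"
  by (simp add: minor_sum_def det_def if_distrib[of "\<lambda>v. v $ _"] cong: if_cong)

lemma minor_sum_differentiable: "minor_sum k differentiable (at (A::real^'n^'n))"
proof -
  have "bounded_linear (\<lambda>A::real^'n^'n. A $ i $ j)" for i j
    using bounded_linear_compose[OF bounded_linear_vec_nth[of j] bounded_linear_vec_nth[of i]] .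
  then have "(\<lambda>A::real^'n^'n. A $ i $ j) differentiable (at A)" for i j
    by (rule bounded_linear_imp_differentiable)
  then have *: "(\<lambda>A::real^'n^'n. if i \<in> I then A $ i $ p i else axis i 1 $ p i) differentiable (at A)" for i p I
    by (cases "i \<in> I") simp_all
  show ?thesis
    unfolding minor_sum_expand[abs_def]
    by (intro differentiable_sum ballI differentiable_mult differentiable_const differentiable_prod *) auto
qed

lemma continuous_on_minor_sum:
  fixes F :: "'b::topological_space \<Rightarrow> real^'n^'n"
  assumes "\<And>i j. continuous_on S (\<lambda>x. F x $ i $ j)"
  shows "continuous_on S (\<lambda>x. minor_sum k (F x))"
proof -
  have *: "continuous_on S (\<lambda>x. if i \<in> I then F x $ i $ p i else axis i 1 $ p i)" for i p I
    using assms by (cases "i \<in> I") simp_all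
  show ?thesis unfolding minor_sum_expand by (intro continuous_intros *)
qed

section \<open>The curvature operator of a graph\<close>

text \<open>Gradient and Hessian become independent arguments: comparison takes different Hessians
  at one gradient, and linearization takes arbitrary symmetric directions.\<close>

definition graph_matrix :: "real^'n \<Rightarrow> real^'n^'n \<Rightarrow> real^'n^'n" where
  "graph_matrix p H = (1 / sqrt (1 - (norm p)\<^sup>2)) *\<^sub>R
     ((mat 1 + (1 / (sqrt (1 - (norm p)\<^sup>2))\<^sup>2) *\<^sub>R outer p) ** H)"

lemma graph_matrix_add: "graph_matrix p (H + N) = graph_matrix p H + graph_matrix p N"
  by (simp add: graph_matrix_def matrix_add_ldistrib scaleR_add_right)

lemma graph_matrix_scaleR: "graph_matrix p (s *\<^sub>R H) = s *\<^sub>R graph_matrix p H"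
  for H :: "real^'n^'n"
proof -
  have "A ** (s *\<^sub>R H) = s *\<^sub>R (A ** H)" for A :: "real^'n^'n"
    by (simp add: matrix_scalar_ac scalar_matrix_assoc)
  then show ?thesis by (simp add: graph_matrix_def)
qed

text \<open>Defined by minors instead of by chosen curvatures, hence differentiable wherever
  \<open>norm p < 1\<close>; \<open>graph_sigma_conv\<close> relates the two.\<close>

definition \<sigma> :: "nat \<Rightarrow> real^'n \<Rightarrow> real^'n^'n \<Rightarrow> real" where
  "\<sigma> k p H = minor_sum k (graph_matrix p H)"

lemma curvature_matrix_eq: "curvature_matrix S u x = graph_matrix (gradient S u x) (hessian S u x)"
  by (simp add: curvature_matrix_def graph_matrix_def outer_def Let_def)

lemma outer_mult_outer: "outer p ** outer p = (norm p)\<^sup>2 *\<^sub>R outer p" for p :: "real^'n"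
  unfolding power2_norm_eq_inner
  by (simp add: vec_eq_iff matrix_matrix_mult_def outer_def inner_vec_def sum_distrib_right sum_distrib_left ac_simps)

lemma rank_one_mult:
  "(mat 1 + a *\<^sub>R outer p) ** (mat 1 + b *\<^sub>R outer p) = mat 1 + (a + b + a * b * (norm p)\<^sup>2) *\<^sub>R outer p"
  for p :: "real^'n"
  by (simp add: matrix_add_ldistrib matrix_add_rdistrib matrix_scalar_ac outer_mult_outer algebra_simps
      flip: scalar_matrix_assoc)

text \<open>The inverse of the induced metric has the symmetric square root \<open>I + p p\<^sup>T / (w (1 + w))\<close>,
  so the curvature matrix is similar to a symmetric one.\<close>

lemma inverse_metric_sqrt:
  fixes p :: "real^'n"
  assumes "norm p < 1"
  obtains R where "transpose R = R" "invertible R"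
    "R ** R = mat 1 + (1 / (sqrt (1 - (norm p)\<^sup>2))\<^sup>2) *\<^sub>R outer p"
proof -
  define w where "w = sqrt (1 - (norm p)\<^sup>2)"
  have "(norm p)\<^sup>2 < 1" using assms by (simp add: power_less_one_iff)
  then have w: "0 < w" "(norm p)\<^sup>2 = 1 - w\<^sup>2" by (auto simp: w_def)
  define a where "a = 1 / (w * (1 + w))"
  \<comment> \<open>The coefficient of the inverse: \<open>R\<close> times
    \<open>mat 1 + b *\<^sub>R outer p\<close> is the identity.\<close>
  define b where "b = - 1 / (1 + w)"
  define R where "R = mat 1 + a *\<^sub>R outer p"
  have "a + b + a * b * (1 - w\<^sup>2) = 0"
  proof -
    have "a = 1 / w * (1 / (1 + w))" by (simp add: a_def)
    moreover have "1 - w\<^sup>2 = (1 - w) * (1 + w)" by (simp add: power2_eq_square algebra_simps)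
    ultimately show ?thesis using w(1) by (simp add: b_def divide_simps) (simp add: algebra_simps)
  qed
  then have "R ** (mat 1 + b *\<^sub>R outer p) = mat 1"
    unfolding R_def rank_one_mult w(2) by simp
  then have "invertible R" by (auto simp: invertible_right_inverse)
  moreover have "transpose R = R" by (simp add: R_def transpose_def vec_eq_iff mat_def outer_def mult.commute)
  moreover have "a + a + a * a * (1 - w\<^sup>2) = 1 / w\<^sup>2"
    using w(1) by (simp add: a_def divide_simps power2_eq_square) (simp add: algebra_simps)
  then have "R ** R = mat 1 + (1 / w\<^sup>2) *\<^sub>R outer p"
    unfolding R_def rank_one_mult w(2) by simp
  ultimately show thesis using that by (simp add: w_def)
qed

lemma graph_matrix_similar:
  fixes p :: "real^'n"
  assumes "norm p < 1"
  obtains R w where "0 < w" "w = sqrt (1 - (norm p)\<^sup>2)" "transpose R = R" "invertible R"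
    "\<And>H. graph_matrix p H = R ** ((1 / w) *\<^sub>R (R ** H))"
proof -
  obtain R where R: "transpose R = R" "invertible R"
    "R ** R = mat 1 + (1 / (sqrt (1 - (norm p)\<^sup>2))\<^sup>2) *\<^sub>R outer p"
    using inverse_metric_sqrt[OF assms] by metis
  have "0 < sqrt (1 - (norm p)\<^sup>2)" using assms by (simp add: power_less_one_iff)
  then show thesis
    by (rule that[OF _ refl R(1,2)])
      (simp add: graph_matrix_def R(3)[symmetric] matrix_scalar_ac matrix_mul_assoc flip: scalar_matrix_assoc)
qed

text \<open>Moving the left factor \<open>R\<close> to the right preserves the characteristic
  polynomial and leaves a congruence of \<open>H\<close>. Since \<open>R\<close> and
  \<open>w\<close> depend on \<open>p\<close> alone, one pair serves for all Hessians, which allows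
  them to be compared.\<close>

lemma \<sigma>_symmetric_matrix:
  fixes p :: "real^'n"
  assumes "norm p < 1"
  obtains R w where "0 < w" "transpose R = R" "invertible R"
    "\<And>k H. \<sigma> k p H = minor_sum k ((1 / w) *\<^sub>R (R ** H ** R))"
    "\<And>H. transpose H = H \<Longrightarrow> transpose ((1 / w) *\<^sub>R (R ** H ** R)) = (1 / w) *\<^sub>R (R ** H ** R)"
    "\<And>s H. det (mat s + graph_matrix p H) = det (mat s + (1 / w) *\<^sub>R (R ** H ** R))"
proof -
  obtain R w where R: "0 < w" "w = sqrt (1 - (norm p)\<^sup>2)" "transpose R = R" "invertible R"
    "\<And>H. graph_matrix p H = R ** ((1 / w) *\<^sub>R (R ** H))"
    using graph_matrix_similar[OF assms] by metis
  have *: "(1 / w) *\<^sub>R (R ** H) ** R = (1 / w) *\<^sub>R (R ** H ** R)" for H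
    by (simp flip: scalar_matrix_assoc)
  have det: "det (mat s + graph_matrix p H) = det (mat s + (1 / w) *\<^sub>R (R ** H ** R))" for s H
    unfolding R(5) det_mat_add_mult_commute[OF R(4)] * ..
  have ms: "minor_sum k (graph_matrix p H) = minor_sum k ((1 / w) *\<^sub>R (R ** H ** R))" for k H
    by (intro minor_sum_cong_charpoly det)
  show thesis
  proof (rule that[OF R(1,3,4) _ _ det])
    show "\<sigma> k p H = minor_sum k ((1 / w) *\<^sub>R (R ** H ** R))" for k H
      by (simp add: \<sigma>_def ms)
    show "transpose ((1 / w) *\<^sub>R (R ** H ** R)) = (1 / w) *\<^sub>R (R ** H ** R)" if "transpose H = H" for H
      using that R(3) by (simp add: transpose_scalar matrix_transpose_mul matrix_mul_assoc)
  qed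
qed

lemma det_mat_diff: "det (mat t - X) = (- 1) ^ CARD('n) * det (mat (- t) + X)" for X :: "real^'n^'n"
proof -
  have "mat t - X = (\<chi> i. (- 1) *s (mat (- t) + X) $ i)"
    by (auto simp: vec_eq_iff mat_def)
  then have "det (mat t - X) = (\<Prod>i\<in>(UNIV::'n set). - 1) * det (\<chi> i. (mat (- t) + X) $ i)"
    by (simp only: det_rows_mul)
  then show ?thesis by (simp add: vec_lambda_eta del: vector_add_component)
qed

lemma prod_uminus_diff:
  "(\<Prod>i\<in>UNIV. t - d i) = (- 1) ^ CARD('n) * (\<Prod>i\<in>UNIV. - t + d i)" for d :: "'n::finite \<Rightarrow> real"
proof -
  have "(\<Prod>i\<in>UNIV. t - d i) = (\<Prod>i\<in>UNIV. (- 1) * (- t + d i))" by simp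
  then show ?thesis by (simp only: prod.distrib prod_constant)
qed

text \<open>The choice in \<open>principal_curvatures\<close> is meaningful only if the
  characteristic polynomial splits over the reals; the similar symmetric matrix supplies such a
  splitting. Sign factors arise in passing between \<open>det (mat t - X)\<close> and
  \<open>det (mat s + X)\<close>.\<close>

lemma graph_sigma_conv:
  fixes u :: "real^'n \<Rightarrow> real"
  assumes "norm (gradient (closure \<Omega>) u x) < 1"
    and "transpose (hessian (closure \<Omega>) u x) = hessian (closure \<Omega>) u x"
  shows "graph_sigma k \<Omega> u x = \<sigma> k (gradient (closure \<Omega>) u x) (hessian (closure \<Omega>) u x)"
    "\<sigma> k (gradient (closure \<Omega>) u x) (hessian (closure \<Omega>) u x) =
      esym k UNIV (($) (principal_curvatures (closure \<Omega>) u x))"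
proof -
  define p H where "p = gradient (closure \<Omega>) u x" and "H = hessian (closure \<Omega>) u x"
  define \<kappa> where "\<kappa> = principal_curvatures (closure \<Omega>) u x"
  define X where "X = graph_matrix p H"
  have p: "norm p < 1" and H: "transpose H = H" using assms by (auto simp: p_def H_def)
  obtain R w where R: "\<And>H. transpose H = H \<Longrightarrow> transpose ((1 / w) *\<^sub>R (R ** H ** R)) = (1 / w) *\<^sub>R (R ** H ** R)"
    "\<And>s H. det (mat s + graph_matrix p H) = det (mat s + (1 / w) *\<^sub>R (R ** H ** R))"
    using \<sigma>_symmetric_matrix[OF p] by metis
  define B where "B = (1 / w) *\<^sub>R (R ** H ** R)"
  obtain P d where P: "orthogonal_matrix P" "transpose P ** B ** P = diag d"
    using symmetric_matrix_diagonalizable[of B] R(1)[OF H] by (auto simp: B_def)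
  have B: "det (mat s + B) = det (mat s + diag d)" for s
  proof -
    have "invertible (transpose P)" using P(1) by (auto simp: orthogonal_matrix_def invertible_def)
    then have "det (mat s + transpose P ** (B ** P)) = det (mat s + (B ** P) ** transpose P)"
      by (rule det_mat_add_mult_commute)
    moreover have "transpose P ** (B ** P) = diag d" using P(2) by (simp add: matrix_mul_assoc)
    moreover have "(B ** P) ** transpose P = B ** (P ** transpose P)" by (rule matrix_mul_assoc[symmetric])
    then have "(B ** P) ** transpose P = B" using P(1) by (simp add: orthogonal_matrix_def)
    ultimately show ?thesis by simp
  qed
  have "det (mat t - X) = (\<Prod>i\<in>UNIV. t - (\<chi> i. d i) $ i)" for t
    unfolding det_mat_diff prod_uminus_diff[of t] X_def R(2) B_def[symmetric] B
    by (simp add: det_mat_add_diag)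
  then have "\<exists>\<kappa> :: real^'n. \<forall>t. det (mat t - X) = (\<Prod>i\<in>UNIV. t - \<kappa> $ i)"
    by (intro exI[of _ "\<chi> i. d i"] allI)
  then have "\<forall>t. det (mat t - X) = (\<Prod>i\<in>UNIV. t - \<kappa> $ i)"
    unfolding \<kappa>_def principal_curvatures_def curvature_matrix_eq p_def[symmetric] H_def[symmetric] X_def[symmetric]
    by (rule someI_ex)
  then have "(- 1) ^ CARD('n) * det (mat s + X) = (- 1) ^ CARD('n) * (\<Prod>i\<in>UNIV. s + \<kappa> $ i)" for s
    using det_mat_diff[of "- s" X] prod_uminus_diff[of "- s" "($) \<kappa>"] by simp
  then have "det (mat s + X) = (\<Prod>i\<in>UNIV. s + \<kappa> $ i)" for s by simp
  then have "minor_sum k X = esym k UNIV (($) \<kappa>)" by (rule minor_sum_esym)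
  then show "graph_sigma k \<Omega> u x = \<sigma> k (gradient (closure \<Omega>) u x) (hessian (closure \<Omega>) u x)"
    "\<sigma> k (gradient (closure \<Omega>) u x) (hessian (closure \<Omega>) u x) =
      esym k UNIV (($) (principal_curvatures (closure \<Omega>) u x))"
    by (simp_all add: graph_sigma_def elem_sym_esym \<sigma>_def X_def p_def H_def \<kappa>_def)
qed

section \<open>Ellipticity of the curvature operator\<close>

definition \<sigma>_admissible :: "nat \<Rightarrow> real^'n \<Rightarrow> real^'n^'n \<Rightarrow> bool" where
  "\<sigma>_admissible k p H \<longleftrightarrow> norm p < 1 \<and> transpose H = H \<and> (\<forall>j\<in>{1..k}. 0 < \<sigma> j p H)"

lemma \<sigma>_mono:
  fixes p :: "real^'n"
  assumes "\<sigma>_admissible k p H" "transpose M = M" "\<And>v. 0 \<le> v \<bullet> (M *v v)" "j \<in> {1..k}"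
  shows "\<sigma> j p H \<le> \<sigma> j p (H + M)"
proof -
  have p: "norm p < 1" and H: "transpose H = H" using assms(1) by (auto simp: \<sigma>_admissible_def)
  obtain R w where R: "0 < w" "transpose R = R" "\<And>k H. \<sigma> k p H = minor_sum k ((1 / w) *\<^sub>R (R ** H ** R))"
    "\<And>H. transpose H = H \<Longrightarrow> transpose ((1 / w) *\<^sub>R (R ** H ** R)) = (1 / w) *\<^sub>R (R ** H ** R)"
    using \<sigma>_symmetric_matrix[OF p] by metis
  have "mgarding k ((1 / w) *\<^sub>R (R ** H ** R))"
    using assms(1) by (simp add: mgarding_def \<sigma>_admissible_def R(3))
  moreover have "0 \<le> v \<bullet> (((1 / w) *\<^sub>R (R ** M ** R)) *v v)" for v
  proof -
    have "v \<bullet> (((1 / w) *\<^sub>R (R ** M ** R)) *v v) = (1 / w) * ((R *v v) \<bullet> (M *v (R *v v)))"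
      using R(2) by (simp add: scaleR_matrix_vector_assoc[symmetric] flip: matrix_vector_mul_assoc)
        (metis dot_lmul_matrix vector_transpose_matrix)
    then show ?thesis using R(1) assms(3) by simp
  qed
  ultimately have "\<forall>j\<in>{1..k}. minor_sum j ((1 / w) *\<^sub>R (R ** H ** R)) \<le>
      minor_sum j ((1 / w) *\<^sub>R (R ** H ** R) + (1 / w) *\<^sub>R (R ** M ** R))"
    using R(4)[OF H] R(4)[OF assms(2)] by (intro mgarding_minor_sum_mono)
  moreover have "(1 / w) *\<^sub>R (R ** H ** R) + (1 / w) *\<^sub>R (R ** M ** R) = (1 / w) *\<^sub>R (R ** (H + M) ** R)"
    by (simp add: matrix_add_ldistrib matrix_add_rdistrib scaleR_add_right)
  ultimately show ?thesis using assms(4) by (simp add: R(3))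
qed

text \<open>The slope is written as a difference of two values of \<open>\<sigma>\<close>, so that
  it inherits continuity in gradient and Hessian and has a positive lower bound on compact
  sets.\<close>

lemma \<sigma>_rank_one:
  fixes p :: "real^'n"
  assumes "norm p < 1" "transpose H = H" "1 \<le> k"
  shows "\<sigma> k p (H + r *\<^sub>R outer v) = \<sigma> k p H + r * (\<sigma> k p (H + outer v) - \<sigma> k p H)"
    "\<sigma>_admissible k p H \<Longrightarrow> v \<noteq> 0 \<Longrightarrow> 0 < \<sigma> k p (H + outer v) - \<sigma> k p H"
proof -
  obtain m where k: "k = Suc m" using assms(3) by (cases k) auto
  obtain R w where R: "0 < w" "transpose R = R" "invertible R"
    "\<And>k H. \<sigma> k p H = minor_sum k ((1 / w) *\<^sub>R (R ** H ** R))"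
    "\<And>H. transpose H = H \<Longrightarrow> transpose ((1 / w) *\<^sub>R (R ** H ** R)) = (1 / w) *\<^sub>R (R ** H ** R)"
    using \<sigma>_symmetric_matrix[OF assms(1)] by metis
  define B where "B = (1 / w) *\<^sub>R (R ** H ** R)"
  obtain c where c: "\<And>r. minor_sum k (B + r *\<^sub>R outer (R *v v)) = minor_sum k B + r * c"
    "mgarding k B \<Longrightarrow> R *v v \<noteq> 0 \<Longrightarrow> 0 < c"
    using minor_sum_add_outer[of B m "R *v v"] R(5)[OF assms(2)] by (auto simp: B_def k)
  have "R ** outer v ** R = outer (R *v v)"
    using transpose_conj_outer[of R v] R(2) by simp
  then have "(1 / w) *\<^sub>R (R ** (H + r *\<^sub>R outer v) ** R) = B + (r / w) *\<^sub>R outer (R *v v)" for r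
    by (simp add: B_def matrix_add_ldistrib matrix_add_rdistrib matrix_scalar_ac scaleR_add_right
        flip: scalar_matrix_assoc)
  then have eq: "\<sigma> k p (H + r *\<^sub>R outer v) = \<sigma> k p H + r * (c / w)" for r
    by (simp add: R(4) c(1)) (simp add: B_def)
  have eq1: "\<sigma> k p (H + outer v) = \<sigma> k p H + c / w" using eq[of 1] by simp
  show "\<sigma> k p (H + r *\<^sub>R outer v) = \<sigma> k p H + r * (\<sigma> k p (H + outer v) - \<sigma> k p H)"
    by (simp add: eq eq1)
  show "0 < \<sigma> k p (H + outer v) - \<sigma> k p H" if "\<sigma>_admissible k p H" "v \<noteq> 0"
  proof -
    have "mgarding k B" using that(1) by (simp add: mgarding_def \<sigma>_admissible_def R(4) B_def)
    moreover have "R *v v \<noteq> 0" using R(3) that(2)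
      by (metis invertible_def matrix_vector_mul_assoc matrix_vector_mul_lid matrix_vector_mult_0_right)
    ultimately show ?thesis using c(2) R(1) by (simp add: eq1)
  qed
qed

text \<open>The last clause is the ellipticity of the linearized operator.\<close>

lemma minor_sum_derivative:
  fixes p :: "real^'n"
  assumes "\<sigma>_admissible k p H" "1 \<le> k"
  obtains \<L> where "(minor_sum k has_derivative \<L>) (at (graph_matrix p H))"
    "\<L> (graph_matrix p H) = real k * \<sigma> k p H"
    "\<And>N. transpose N = N \<Longrightarrow> (\<And>v. 0 \<le> v \<bullet> (N *v v)) \<Longrightarrow> 0 \<le> \<L> (graph_matrix p N)"
proof -
  define A where "A = graph_matrix p H"
  obtain \<L> where L: "(minor_sum k has_derivative \<L>) (at A)"
    using minor_sum_differentiable unfolding differentiable_def by blast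
  interpret L: bounded_linear \<L> using L by (rule has_derivative_bounded_linear)
  have dir: "((\<lambda>s. minor_sum k (A + s *\<^sub>R X)) has_real_derivative \<L> X) (at 0)" for X
  proof -
    have "((\<lambda>s. A + s *\<^sub>R X) has_derivative (\<lambda>s. s *\<^sub>R X)) (at 0)"
      by (auto intro!: derivative_eq_intros)
    moreover have "(minor_sum k has_derivative \<L>) (at (A + 0 *\<^sub>R X))" using L by simp
    ultimately have "((\<lambda>s. minor_sum k (A + s *\<^sub>R X)) has_derivative (\<lambda>s. \<L> (s *\<^sub>R X))) (at 0)"
      using has_derivative_compose by blast
    then show ?thesis by (simp add: has_field_derivative_def L.scaleR mult.commute[of _ "\<L> X"])
  qed
  show thesis
  proof (rule that[of \<L>])
    show "(minor_sum k has_derivative \<L>) (at (graph_matrix p H))" using L by (simp add: A_def)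
    \<comment> \<open>Along \<open>A\<close> itself, homogeneity of degree \<open>k\<close>
      determines the derivative: Euler's identity.\<close>
    have "((\<lambda>s. (1 + s) ^ k * minor_sum k A) has_real_derivative real k * minor_sum k A) (at 0)"
      by (auto intro!: derivative_eq_intros)
    moreover have "A + s *\<^sub>R A = (1 + s) *\<^sub>R A" for s by (simp add: scaleR_add_left)
    ultimately show "\<L> (graph_matrix p H) = real k * \<sigma> k p H"
      using DERIV_unique[OF dir[of A]] by (simp add: minor_sum_scale \<sigma>_def flip: A_def)
    fix N :: "real^'n^'n" assume N: "transpose N = N" "\<And>v. 0 \<le> v \<bullet> (N *v v)"
    have ge: "minor_sum k A \<le> minor_sum k (A + s *\<^sub>R graph_matrix p N)" if "0 \<le> s" for s
    proof -
      have "\<sigma> k p H \<le> \<sigma> k p (H + s *\<^sub>R N)"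
        using N that assms by (intro \<sigma>_mono[of k]) (auto simp: transpose_scalar scaleR_matrix_vector_assoc[symmetric])
      moreover have "graph_matrix p (H + s *\<^sub>R N) = A + s *\<^sub>R graph_matrix p N"
        by (simp add: A_def graph_matrix_add graph_matrix_scaleR)
      ultimately show ?thesis by (simp add: \<sigma>_def A_def)
    qed
    show "0 \<le> \<L> (graph_matrix p N)"
    proof (rule ccontr)
      assume "\<not> ?thesis"
      then obtain d where "d > 0" "\<forall>h>0. h < d \<longrightarrow> minor_sum k (A + (0 + h) *\<^sub>R graph_matrix p N) < minor_sum k (A + 0 *\<^sub>R graph_matrix p N)"
        using DERIV_neg_dec_right[OF dir[of "graph_matrix p N"]] by auto
      then show False using ge[of "d / 2"] by (auto dest!: spec[of _ "d / 2"])
    qed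
  qed
qed

section \<open>Second and third derivatives\<close>

lemma has_derivative_vecI:
  fixes f :: "'a::real_normed_vector \<Rightarrow> 'b::euclidean_space^'n"
  assumes "\<And>i. ((\<lambda>x. f x $ i) has_derivative (\<lambda>h. f' h $ i)) F"
  shows "(f has_derivative f') F"
proof -
  have lin: "bounded_linear (axis i :: 'b \<Rightarrow> 'b^'n)" for i
    by (intro linear_conv_bounded_linear[THEN iffD1] linearI) (auto simp: axis_def vec_eq_iff)
  have "((\<lambda>x. \<Sum>i\<in>UNIV. axis i (f x $ i)) has_derivative (\<lambda>h. \<Sum>i\<in>UNIV. axis i (f' h $ i))) F"
    by (intro has_derivative_sum bounded_linear.has_derivative[OF lin] assms)
  moreover have "(\<Sum>i\<in>UNIV. axis i (v $ i)) = v" for v :: "'b^'n"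
    by (simp add: vec_eq_iff axis_def if_distrib cong: if_cong)
  ultimately show ?thesis by simp
qed

lemma gradient_inner:
  assumes "f differentiable (at x within S)"
  shows "gradient S f x \<bullet> h = frechet_derivative f (at x within S) h"
proof -
  interpret linear "frechet_derivative f (at x within S)"
    using assms by (rule linear_frechet_derivative)
  have "frechet_derivative f (at x within S) h = frechet_derivative f (at x within S) (\<Sum>b\<in>Basis. (h \<bullet> b) *\<^sub>R b)"
    by (simp add: euclidean_representation)
  also have "\<dots> = gradient S f x \<bullet> h"
    by (simp add: sum scale gradient_def inner_sum_left inner_commute[of _ h] inner_sum_right mult.commute)
  finally show ?thesis by simp
qed

lemma gradient_has_derivative:
  assumes "f differentiable (at x within S)"
  shows "(f has_derivative (\<lambda>h. gradient S f x \<bullet> h)) (at x within S)"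
  using assms by (simp add: gradient_inner frechet_derivative_works)

lemma gradient_interior: "x \<in> interior S \<Longrightarrow> gradient S f x = gradient UNIV f x"
  by (simp add: gradient_def at_within_interior[of x S])

text \<open>Transfers from derivatives within \<open>S\<close> to ordinary ones. The second claim is
  the proviso under which \<open>admissible\<close> imposes the curvature inequalities.\<close>

lemma hessian_open:
  assumes "open \<Omega>" "x \<in> \<Omega>" "\<Omega> \<subseteq> S"
    and "(gradient UNIV f has_derivative F) (at x)"
  shows "hessian S f x = hessian UNIV f x" "gradient S f differentiable (at x within S)"
proof -
  have int: "y \<in> interior S" if "y \<in> \<Omega>" for y using assms(1,3) that interior_maximal by blast
  have "(gradient S f has_derivative F) (at x)"
    using has_derivative_transform_within_open[OF assms(4,1,2)] gradient_interior[OF int] by metis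
  then show "hessian S f x = hessian UNIV f x" "gradient S f differentiable (at x within S)"
    using assms(4) unfolding hessian_def at_within_interior[OF int[OF assms(2)]]
    by (auto simp flip: frechet_derivative_at simp: differentiable_def)
qed

text \<open>The mean value theorem is applied once, in direction \<open>a\<close>; the difference of
  gradients that it produces is then expanded around \<open>x\<close> by differentiability of
  \<open>g\<close> at that single point.\<close>

lemma second_difference:
  fixes f :: "'a::euclidean_space \<Rightarrow> real"
  assumes "0 < r" "\<And>y. y \<in> ball x r \<Longrightarrow> (f has_derivative (\<lambda>h. g y \<bullet> h)) (at y)"
    and "(g has_derivative G) (at x)" "0 < e"
  shows "\<exists>d>0. \<forall>t. 0 < t \<and> t < d \<longrightarrow>
    \<bar>f (x + t *\<^sub>R a + t *\<^sub>R b) - f (x + t *\<^sub>R a) - f (x + t *\<^sub>R b) + f x - t\<^sup>2 * (G b \<bullet> a)\<bar> \<le> e * t\<^sup>2"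
proof -
  interpret G: bounded_linear G using assms(3) by (rule has_derivative_bounded_linear)
  \<comment> \<open>Collects the factors of the error at the end; the added ones keep it positive
    when \<open>a\<close> and \<open>b\<close> vanish.\<close>
  define C where "C = (2 * (norm a + norm b) + 1) * (norm a + 1)"
  have C: "0 < C" by (simp add: C_def add_nonneg_pos)
  define c where "c = norm a + norm b + 1"
  have c: "0 < c" by (simp add: c_def add_nonneg_pos)
  obtain \<delta> where \<delta>: "0 < \<delta>" "\<And>h. norm h < \<delta> \<Longrightarrow> norm (g (x + h) - g x - G h) \<le> e / C * norm h"
    using assms(3)[unfolded has_derivative_at_alt] assms(4) C
    by (metis add_diff_cancel_left' divide_pos_pos)
  define d where "d = min r \<delta> / c"
  have d: "0 < d" using assms(1) \<delta>(1) c by (simp add: d_def)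
  show ?thesis
  proof (intro exI[of _ d] conjI allI impI d)
    fix t assume t: "0 < t \<and> t < d"
    then have tc: "t * c < min r \<delta>" using c by (simp add: d_def pos_less_divide_eq)
    have small: "norm (s *\<^sub>R a + t' *\<^sub>R b) < min r \<delta> \<and> norm (s *\<^sub>R a + t' *\<^sub>R b) \<le> t * (norm a + norm b)"
      if "0 \<le> s" "s \<le> t" "0 \<le> t'" "t' \<le> t" for s t'
    proof -
      have "norm (s *\<^sub>R a + t' *\<^sub>R b) \<le> s * norm a + t' * norm b"
        using norm_triangle_ineq[of "s *\<^sub>R a" "t' *\<^sub>R b"] that by simp
      also have "\<dots> \<le> t * norm a + t * norm b" using that by (intro add_mono mult_right_mono) auto
      finally have "norm (s *\<^sub>R a + t' *\<^sub>R b) \<le> t * (norm a + norm b)" by (simp add: distrib_left)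
      moreover have "t * (norm a + norm b) \<le> t * c" using t by (simp add: c_def)
      ultimately show ?thesis using tc by linarith
    qed
    define F where "F s = f (x + s *\<^sub>R a + t *\<^sub>R b) - f (x + s *\<^sub>R a)" for s
    have der: "(F has_real_derivative (g (x + s *\<^sub>R a + t *\<^sub>R b) - g (x + s *\<^sub>R a)) \<bullet> a) (at s)"
      if "0 \<le> s" "s \<le> t" for s
    proof -
      have ball: "x + y \<in> ball x r" if "norm y < r" for y using that by (simp add: dist_norm)
      have in1: "x + s *\<^sub>R a + t *\<^sub>R b \<in> ball x r" "x + s *\<^sub>R a \<in> ball x r"
        using small[of s t] small[of s 0] that t ball[of "s *\<^sub>R a + t *\<^sub>R b"] ball[of "s *\<^sub>R a"]
        by (auto simp: add.assoc)
      have "((\<lambda>s. f (x + s *\<^sub>R a + t *\<^sub>R b)) has_derivative (\<lambda>h. g (x + s *\<^sub>R a + t *\<^sub>R b) \<bullet> (h *\<^sub>R a))) (at s)"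
        by (rule has_derivative_compose[where f="\<lambda>s. x + s *\<^sub>R a + t *\<^sub>R b", OF _ assms(2)[OF in1(1)]]) (auto intro!: derivative_eq_intros)
      moreover have "((\<lambda>s. f (x + s *\<^sub>R a)) has_derivative (\<lambda>h. g (x + s *\<^sub>R a) \<bullet> (h *\<^sub>R a))) (at s)"
        by (rule has_derivative_compose[where f="\<lambda>s. x + s *\<^sub>R a", OF _ assms(2)[OF in1(2)]]) (auto intro!: derivative_eq_intros)
      ultimately have "(F has_derivative (\<lambda>h. g (x + s *\<^sub>R a + t *\<^sub>R b) \<bullet> (h *\<^sub>R a) - g (x + s *\<^sub>R a) \<bullet> (h *\<^sub>R a))) (at s)"
        unfolding F_def by (rule has_derivative_diff)
      then show ?thesis unfolding has_field_derivative_def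
        by (rule has_derivative_eq_rhs) (auto simp: inner_diff_left algebra_simps)
    qed
    obtain s where s: "0 < s" "s < t"
      "F t - F 0 = (t - 0) * ((g (x + s *\<^sub>R a + t *\<^sub>R b) - g (x + s *\<^sub>R a)) \<bullet> a)"
      using MVT2[of 0 t F "\<lambda>s. (g (x + s *\<^sub>R a + t *\<^sub>R b) - g (x + s *\<^sub>R a)) \<bullet> a"] der t by auto
    define y z where "y = s *\<^sub>R a + t *\<^sub>R b" and "z = s *\<^sub>R a"
    have yz: "norm y < \<delta>" "norm y \<le> t * (norm a + norm b)" "norm z < \<delta>" "norm z \<le> t * (norm a + norm b)"
      using small[of s t] small[of s 0] s t by (auto simp: y_def z_def)
    define E where "E = (g (x + y) - g x - G y) - (g (x + z) - g x - G z)"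
    have "norm E \<le> e / C * norm y + e / C * norm z"
      unfolding E_def by (intro order_trans[OF norm_triangle_ineq4] add_mono \<delta>(2) yz)
    also have "\<dots> \<le> e / C * (t * (norm a + norm b)) + e / C * (t * (norm a + norm b))"
      using assms(4) C yz by (intro add_mono mult_left_mono) auto
    also have "\<dots> \<le> e / C * (t * (2 * (norm a + norm b) + 1))"
      using assms(4) C t by (simp add: algebra_simps)
    finally have E: "norm E \<le> e / C * (t * (2 * (norm a + norm b) + 1))" .
    have gE: "g (x + s *\<^sub>R a + t *\<^sub>R b) - g (x + s *\<^sub>R a) = t *\<^sub>R G b + E"
      by (simp add: E_def y_def z_def G.add G.scaleR add.assoc)
    have "f (x + t *\<^sub>R a + t *\<^sub>R b) - f (x + t *\<^sub>R a) - f (x + t *\<^sub>R b) + f x - t\<^sup>2 * (G b \<bullet> a) = t * (E \<bullet> a)"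
      using s(3) unfolding gE F_def by (simp add: inner_add_left power2_eq_square algebra_simps)
    also have "\<bar>t * (E \<bullet> a)\<bar> \<le> t * (norm E * (norm a + 1))"
    proof -
      have "\<bar>E \<bullet> a\<bar> \<le> norm E * norm a" by (rule Cauchy_Schwarz_ineq2)
      also have "\<dots> \<le> norm E * (norm a + 1)" by (intro mult_left_mono) auto
      finally show ?thesis using t by (simp add: abs_mult)
    qed
    also have "\<dots> \<le> t * (e / C * (t * (2 * (norm a + norm b) + 1)) * (norm a + 1))"
      using t E by (intro mult_left_mono mult_right_mono) auto
    also have "\<dots> = e * t\<^sup>2 * (C / C)" by (simp add: C_def power2_eq_square ac_simps)
    also have "\<dots> = e * t\<^sup>2" using C by simp
    finally show "\<bar>f (x + t *\<^sub>R a + t *\<^sub>R b) - f (x + t *\<^sub>R a) - f (x + t *\<^sub>R b) + f x - t\<^sup>2 * (G b \<bullet> a)\<bar> \<le> e * t\<^sup>2" .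
  qed
qed

text \<open>The mixed second difference is symmetric in \<open>a\<close> and \<open>b\<close>, and
  by \<open>second_difference\<close> it approximates both sides. With a third of their distance as
  tolerance, two errors cannot bridge the gap.\<close>

theorem symmetric_second_derivative:
  fixes f :: "'a::euclidean_space \<Rightarrow> real"
  assumes "0 < r" "\<And>y. y \<in> ball x r \<Longrightarrow> (f has_derivative (\<lambda>h. g y \<bullet> h)) (at y)"
    and "(g has_derivative G) (at x)"
  shows "G b \<bullet> a = G a \<bullet> b"
proof (rule ccontr)
  assume ne: "G b \<bullet> a \<noteq> G a \<bullet> b"
  define e where "e = \<bar>G b \<bullet> a - G a \<bullet> b\<bar> / 3"
  have e: "0 < e" using ne by (simp add: e_def)
  obtain d1 where d1: "d1 > 0" "\<And>t. 0 < t \<and> t < d1 \<Longrightarrow>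
     \<bar>f (x + t *\<^sub>R a + t *\<^sub>R b) - f (x + t *\<^sub>R a) - f (x + t *\<^sub>R b) + f x - t\<^sup>2 * (G b \<bullet> a)\<bar> \<le> e * t\<^sup>2"
    using second_difference[OF assms e, of a b] by blast
  obtain d2 where d2: "d2 > 0" "\<And>t. 0 < t \<and> t < d2 \<Longrightarrow>
     \<bar>f (x + t *\<^sub>R b + t *\<^sub>R a) - f (x + t *\<^sub>R b) - f (x + t *\<^sub>R a) + f x - t\<^sup>2 * (G a \<bullet> b)\<bar> \<le> e * t\<^sup>2"
    using second_difference[OF assms e, of b a] by blast
  define t where "t = min d1 d2 / 2"
  have t: "0 < t" "t < d1" "t < d2" using d1(1) d2(1) by (auto simp: t_def)
  have swap: "x + t *\<^sub>R b + t *\<^sub>R a = x + t *\<^sub>R a + t *\<^sub>R b" by (simp add: algebra_simps)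
  have "\<bar>t\<^sup>2 * (G b \<bullet> a) - t\<^sup>2 * (G a \<bullet> b)\<bar> \<le> 2 * (e * t\<^sup>2)"
    using d1(2)[of t] d2(2)[of t] t unfolding swap by linarith
  then have "t\<^sup>2 * \<bar>G b \<bullet> a - G a \<bullet> b\<bar> \<le> t\<^sup>2 * (2 * e)"
    by (simp add: abs_mult mult.left_commute mult.commute[of _ e] flip: right_diff_distrib)
  then have "\<bar>G b \<bullet> a - G a \<bullet> b\<bar> \<le> 2 * e" using t(1) by simp
  then show False using e by (simp add: e_def)
qed

lemma Basis_axis: "axis i (1::real) \<in> Basis"
  by (simp add: axis_in_Basis_iff)

lemma Ck_on_cong:
  assumes "\<And>x. x \<in> S \<Longrightarrow> f x = g x" "Ck_on m S f"
  shows "Ck_on m S g"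
  using assms
proof (induction m arbitrary: f g)
  case 0
  then show ?case by (metis Ck_on.simps(1) continuous_on_cong)
next
  case (Suc m)
  have hd: "(f has_derivative F) (at x within S) \<longleftrightarrow> (g has_derivative F) (at x within S)" if "x \<in> S" for x F
    using has_derivative_transform[OF that, of f g] has_derivative_transform[OF that, of g f] Suc(2) by auto
  have "frechet_derivative f (at x within S) = frechet_derivative g (at x within S)" if "x \<in> S" for x
    by (simp add: frechet_derivative_def hd[OF that])
  then have "\<forall>b\<in>Basis. Ck_on m S (\<lambda>x. frechet_derivative g (at x within S) b)"
    using Suc.prems(2) Suc.IH[of "\<lambda>x. frechet_derivative f (at x within S) b" "\<lambda>x. frechet_derivative g (at x within S) b" for b]
    by simp
  moreover have "g differentiable_on S"
    using Suc.prems(2) hd by (auto simp: differentiable_on_def differentiable_def)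
  ultimately show ?case by simp
qed

lemma Ck_on_gradient_component:
  fixes f :: "real^'n \<Rightarrow> real"
  assumes "open \<Omega>" "Ck_on (Suc m) \<Omega> f"
  shows "Ck_on m \<Omega> (\<lambda>x. gradient UNIV f x $ j)"
proof (rule Ck_on_cong)
  show "Ck_on m \<Omega> (\<lambda>x. frechet_derivative f (at x within \<Omega>) (axis j 1))"
    using assms(2) Basis_axis by auto
  fix x assume x: "x \<in> \<Omega>"
  have "f differentiable (at x within \<Omega>)" using assms(2) x by (simp add: differentiable_on_def)
  then have "f differentiable (at x)" by (simp add: at_within_open[OF x assms(1)])
  then show "frechet_derivative f (at x within \<Omega>) (axis j 1) = gradient UNIV f x $ j"
    using gradient_inner[of f x UNIV "axis j 1"] x assms(1)
    by (simp add: at_within_open[OF x assms(1)] inner_axis)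
qed

lemma Ck_on_1_has_derivative:
  fixes f :: "real^'n \<Rightarrow> real"
  assumes "open \<Omega>" "Ck_on (Suc m) \<Omega> f" "x \<in> \<Omega>"
  shows "(f has_derivative (\<lambda>h. gradient UNIV f x \<bullet> h)) (at x)"
proof (rule gradient_has_derivative)
  have "f differentiable (at x within \<Omega>)" using assms(2,3) by (simp add: differentiable_on_def)
  then show "f differentiable (at x)" by (simp add: at_within_open[OF assms(3,1)])
qed

lemma Ck_on_2_hessian:
  fixes f :: "real^'n \<Rightarrow> real"
  assumes "open \<Omega>" "Ck_on (Suc (Suc m)) \<Omega> f" "x \<in> \<Omega>"
  shows "(gradient UNIV f has_derivative (\<lambda>h. hessian UNIV f x *v h)) (at x)"
    "transpose (hessian UNIV f x) = hessian UNIV f x"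
    "hessian UNIV f x $ j = gradient UNIV (\<lambda>y. gradient UNIV f y $ j) x"
proof -
  define H where "H = (\<chi> j. gradient UNIV (\<lambda>y. gradient UNIV f y $ j) x)"
  have comp: "((\<lambda>y. gradient UNIV f y $ j) has_derivative (\<lambda>h. (H *v h) $ j)) (at x)" for j
  proof -
    have "(H *v h) $ j = gradient UNIV (\<lambda>y. gradient UNIV f y $ j) x \<bullet> h" for h
      by (simp add: H_def matrix_vector_mult_def inner_vec_def)
    then show ?thesis
      using Ck_on_1_has_derivative[OF assms(1) Ck_on_gradient_component[OF assms(1,2)] assms(3)] by simp
  qed
  then have der: "(gradient UNIV f has_derivative (\<lambda>h. H *v h)) (at x)"
    by (rule has_derivative_vecI)
  then have H: "hessian UNIV f x = H"
    by (simp add: hessian_def flip: frechet_derivative_at)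
  show "(gradient UNIV f has_derivative (\<lambda>h. hessian UNIV f x *v h)) (at x)" using der H by simp
  show "hessian UNIV f x $ j = gradient UNIV (\<lambda>y. gradient UNIV f y $ j) x" by (simp add: H H_def)
  obtain r where "0 < r" "ball x r \<subseteq> \<Omega>" using assms(1,3) open_contains_ball by blast
  then have "(H *v b) \<bullet> a = (H *v a) \<bullet> b" for a b
    using Ck_on_1_has_derivative[OF assms(1,2)] der by (intro symmetric_second_derivative[of r x f]) auto
  from this[of "axis i 1" "axis j 1" for i j] have "H $ j $ i = H $ i $ j" for i j
    by (simp add: inner_axis matrix_vector_mul_component)
  then show "transpose (hessian UNIV f x) = hessian UNIV f x"
    by (simp add: H transpose_def vec_eq_iff)
qed

lemma continuous_on_hessian:
  fixes f :: "real^'n \<Rightarrow> real"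
  assumes "open \<Omega>" "Ck_on (Suc (Suc m)) \<Omega> f"
  shows "continuous_on \<Omega> (hessian UNIV f)" "continuous_on \<Omega> (gradient UNIV f)"
proof -
  have cont: "continuous_on \<Omega> h" if "Ck_on l \<Omega> h" for l and h :: "real^'n \<Rightarrow> real"
    using that by (cases l) (auto intro: differentiable_imp_continuous_on)
  have "continuous_on \<Omega> (\<lambda>x. hessian UNIV f x $ j $ i)" for i j
    using cont[OF Ck_on_gradient_component[OF assms(1) Ck_on_gradient_component[OF assms], of j i]]
    by (rule continuous_on_eq) (simp add: Ck_on_2_hessian(3)[OF assms])
  then have "continuous_on \<Omega> (\<lambda>x. \<chi> j i. hessian UNIV f x $ j $ i)"
    by (intro continuous_on_vec_lambda)
  then show "continuous_on \<Omega> (hessian UNIV f)" by simp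
  have "continuous_on \<Omega> (\<lambda>x. \<chi> j. gradient UNIV f x $ j)"
    by (intro continuous_intros cont[OF Ck_on_gradient_component[OF assms]])
  then show "continuous_on \<Omega> (gradient UNIV f)" by simp
qed

text \<open>The two symmetries have different sources: \<open>T h\<close> is symmetric because
  nearby Hessians are, and \<open>T a *v b = T b *v a\<close> because each row of the Hessian is the
  gradient of a component of the gradient, whose own Hessian \<open>K j\<close> is
  symmetric.\<close>

lemma Ck_on_3_third_derivative:
  fixes f :: "real^'n \<Rightarrow> real"
  assumes "open \<Omega>" "Ck_on (Suc (Suc (Suc m))) \<Omega> f" "x \<in> \<Omega>"
  obtains T where "(hessian UNIV f has_derivative T) (at x)"
    "\<And>h. transpose (T h) = T h" "\<And>a b. T a *v b = T b *v a"
proof -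
  define K where "K j = hessian UNIV (\<lambda>y. gradient UNIV f y $ j) x" for j
  define T where "T h = (\<chi> j. K j *v h)" for h
  note C = Ck_on_gradient_component[OF assms(1,2)]
  have Kj: "((\<lambda>y. hessian UNIV f y $ j) has_derivative (\<lambda>h. K j *v h)) (at x)" for j
    unfolding K_def using Ck_on_2_hessian(1)[OF assms(1) C assms(3)]
    by (rule has_derivative_transform_within_open[OF _ assms(1,3)])
      (simp add: Ck_on_2_hessian(3)[OF assms(1,2)])
  have T: "(hessian UNIV f has_derivative T) (at x)"
    by (rule has_derivative_vecI) (simp add: T_def Kj)
  have Tji: "((\<lambda>y. hessian UNIV f y $ j $ i) has_derivative (\<lambda>h. T h $ j $ i)) (at x)" for i j
    using bounded_linear.has_derivative[OF bounded_linear_vec_nth[of i]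
        bounded_linear.has_derivative[OF bounded_linear_vec_nth[of j] T]] .
  have sym: "T h $ j $ i = T h $ i $ j" for h i j
  proof -
    have "hessian UNIV f y $ j $ i = hessian UNIV f y $ i $ j" if "y \<in> \<Omega>" for y
      using arg_cong[OF Ck_on_2_hessian(2)[OF assms(1,2) that], of "\<lambda>A. A $ i $ j"] by (simp add: transpose_def)
    then have "((\<lambda>y. hessian UNIV f y $ j $ i) has_derivative (\<lambda>h. T h $ i $ j)) (at x)"
      by (intro has_derivative_transform_within_open[OF Tji assms(1,3)]) simp
    from has_derivative_unique[OF Tji this] show ?thesis by meson
  qed
  have K: "transpose (K j) = K j" for j
    unfolding K_def by (rule Ck_on_2_hessian(2)[OF assms(1) C assms(3)])
  have "T a *v b = T b *v a" for a b
  proof -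
    have "(K j *v a) \<bullet> b = (K j *v b) \<bullet> a" for j
      using K[of j] by (metis dot_lmul_matrix inner_commute vector_transpose_matrix)
    moreover have "(T a *v b) $ j = (K j *v a) \<bullet> b" for a b j
      by (simp add: T_def matrix_vector_mult_def inner_vec_def)
    ultimately show ?thesis by (simp add: vec_eq_iff)
  qed
  moreover have "transpose (T h) = T h" for h using sym by (simp add: transpose_def vec_eq_iff)
  ultimately show thesis using that T by blast
qed

text \<open>The derivative is factored as \<open>- E t * n t\<close> with positive \<open>E\<close>,
  so that at the critical point only \<open>n\<close> has to be differentiated. A positive slope of
  \<open>n\<close> would make \<open>m\<close> decrease just to the right of 0.\<close>

lemma second_derivative_test:
  fixes m E n :: "real \<Rightarrow> real"
  assumes "0 < r" "\<And>t. \<bar>t\<bar> < r \<Longrightarrow> (m has_real_derivative - E t * n t) (at t)"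
    and "\<And>t. 0 < E t" "\<And>t. \<bar>t\<bar> < r \<Longrightarrow> m 0 \<le> m t" "(n has_real_derivative D) (at 0)"
  shows "n 0 = 0" "D \<le> 0"
proof -
  have "- E 0 * n 0 = 0"
    using DERIV_local_min[OF assms(2)[of 0] assms(1)] assms(1,4) by auto
  then show n0: "n 0 = 0" using assms(3)[of 0] by auto
  show "D \<le> 0"
  proof (rule ccontr)
    assume "\<not> D \<le> 0"
    then obtain d where d: "d > 0" "\<And>h. 0 < h \<Longrightarrow> h < d \<Longrightarrow> n 0 < n (0 + h)"
      using DERIV_pos_inc_right[OF assms(5)] by auto
    define t where "t = min d r / 2"
    have t: "0 < t" "t < d" "t < r" using d(1) assms(1) by (auto simp: t_def)
    obtain z where z: "0 < z" "z < t" "m t - m 0 = (t - 0) * (- E z * n z)"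
      using MVT2[of 0 t m "\<lambda>t. - E t * n t"] t assms(2) by auto
    have "0 < n z" using d(2)[of z] z t n0 by simp
    then have "0 < t * (E z * n z)" using t assms(3)[of z] by simp
    then show False using z(3) assms(4)[of t] t by simp
  qed
qed

section \<open>The comparison principle\<close>

text \<open>Measures the change of \<open>\<sigma>\<close> when all gradients over a compact set are
  shifted by \<open>\<delta> e\<close>. A linear rate at 0 suffices; boundedness is included to make
  the class closed under products.\<close>

definition lipschitz_at_0 :: "'a set \<Rightarrow> real \<Rightarrow> ('a \<Rightarrow> real \<Rightarrow> real) \<Rightarrow> bool" where
  "lipschitz_at_0 K r f \<longleftrightarrow>
    (\<exists>C. \<forall>x\<in>K. \<forall>\<delta>\<in>{0..r}. \<bar>f x \<delta>\<bar> \<le> C \<and> \<bar>f x \<delta> - f x 0\<bar> \<le> C * \<delta>)"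

lemma lipschitz_at_0I:
  assumes "\<And>x \<delta>. x \<in> K \<Longrightarrow> 0 \<le> \<delta> \<Longrightarrow> \<delta> \<le> r \<Longrightarrow> \<bar>f x \<delta>\<bar> \<le> C \<and> \<bar>f x \<delta> - f x 0\<bar> \<le> C' * \<delta>"
  shows "lipschitz_at_0 K r f"
  unfolding lipschitz_at_0_def
proof (intro exI[of _ "max C C'"] ballI)
  fix x \<delta> assume "x \<in> K" "\<delta> \<in> {0..r}"
  then have "\<bar>f x \<delta>\<bar> \<le> C \<and> \<bar>f x \<delta> - f x 0\<bar> \<le> C' * \<delta>" "0 \<le> \<delta>" using assms by auto
  then show "\<bar>f x \<delta>\<bar> \<le> max C C' \<and> \<bar>f x \<delta> - f x 0\<bar> \<le> max C C' * \<delta>"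
    using mult_right_mono[of C' "max C C'" \<delta>] by auto
qed

lemma lipschitz_at_0E:
  assumes "lipschitz_at_0 K r f"
  obtains C where "0 < C" "\<And>x \<delta>. x \<in> K \<Longrightarrow> 0 \<le> \<delta> \<Longrightarrow> \<delta> \<le> r \<Longrightarrow> \<bar>f x \<delta>\<bar> \<le> C"
    "\<And>x \<delta>. x \<in> K \<Longrightarrow> 0 \<le> \<delta> \<Longrightarrow> \<delta> \<le> r \<Longrightarrow> \<bar>f x \<delta> - f x 0\<bar> \<le> C * \<delta>"
proof -
  obtain C where C: "\<forall>x\<in>K. \<forall>\<delta>\<in>{0..r}. \<bar>f x \<delta>\<bar> \<le> C \<and> \<bar>f x \<delta> - f x 0\<bar> \<le> C * \<delta>"
    using assms by (auto simp: lipschitz_at_0_def)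
  show thesis
  proof (rule that[of "\<bar>C\<bar> + 1"])
    fix x \<delta> assume a: "x \<in> K" "0 \<le> \<delta>" "\<delta> \<le> r"
    then have "\<bar>f x \<delta>\<bar> \<le> C" "\<bar>f x \<delta> - f x 0\<bar> \<le> C * \<delta>" using C by auto
    moreover have "C * \<delta> \<le> (\<bar>C\<bar> + 1) * \<delta>" using a by (intro mult_right_mono) auto
    ultimately show "\<bar>f x \<delta>\<bar> \<le> \<bar>C\<bar> + 1" "\<bar>f x \<delta> - f x 0\<bar> \<le> (\<bar>C\<bar> + 1) * \<delta>" by auto
  qed auto
qed

lemma lipschitz_at_0_const:
  assumes "compact K" "continuous_on K g"
  shows "lipschitz_at_0 K r (\<lambda>x \<delta>. g x)"
proof -
  have "bounded (g ` K)" using assms by (intro compact_imp_bounded compact_continuous_image)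
  then obtain C where "\<forall>x\<in>K. \<bar>g x\<bar> \<le> C" by (auto simp: bounded_iff)
  then show ?thesis by (intro lipschitz_at_0I[where C' = 0]) auto
qed

lemma lipschitz_at_0_id: "lipschitz_at_0 K r (\<lambda>x \<delta>. \<delta>)"
  by (intro lipschitz_at_0I[where C' = 1 and C = r]) auto

lemma lipschitz_at_0_constant: "lipschitz_at_0 K r (\<lambda>x \<delta>. c)"
  by (intro lipschitz_at_0I[where C' = 0 and C = "\<bar>c\<bar>"]) auto

lemma lipschitz_at_0_add:
  assumes "lipschitz_at_0 K r f" "lipschitz_at_0 K r g"
  shows "lipschitz_at_0 K r (\<lambda>x \<delta>. f x \<delta> + g x \<delta>)"
proof -
  obtain C where C: "\<And>x \<delta>. x \<in> K \<Longrightarrow> 0 \<le> \<delta> \<Longrightarrow> \<delta> \<le> r \<Longrightarrow> \<bar>f x \<delta>\<bar> \<le> C"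
    "\<And>x \<delta>. x \<in> K \<Longrightarrow> 0 \<le> \<delta> \<Longrightarrow> \<delta> \<le> r \<Longrightarrow> \<bar>f x \<delta> - f x 0\<bar> \<le> C * \<delta>"
    using lipschitz_at_0E[OF assms(1)] by metis
  obtain C' where C': "\<And>x \<delta>. x \<in> K \<Longrightarrow> 0 \<le> \<delta> \<Longrightarrow> \<delta> \<le> r \<Longrightarrow> \<bar>g x \<delta>\<bar> \<le> C'"
    "\<And>x \<delta>. x \<in> K \<Longrightarrow> 0 \<le> \<delta> \<Longrightarrow> \<delta> \<le> r \<Longrightarrow> \<bar>g x \<delta> - g x 0\<bar> \<le> C' * \<delta>"
    using lipschitz_at_0E[OF assms(2)] by metis
  show ?thesis
  proof (rule lipschitz_at_0I[where C = "C + C'" and C' = "C + C'"])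
    fix x \<delta> assume a: "x \<in> K" "0 \<le> \<delta>" "\<delta> \<le> r"
    show "\<bar>f x \<delta> + g x \<delta>\<bar> \<le> C + C' \<and>
        \<bar>f x \<delta> + g x \<delta> - (f x 0 + g x 0)\<bar> \<le> (C + C') * \<delta>"
      using C[OF a] C'[OF a] unfolding distrib_right by linarith
  qed
qed

lemma lipschitz_at_0_mult:
  assumes "lipschitz_at_0 K r f" "lipschitz_at_0 K r g"
  shows "lipschitz_at_0 K r (\<lambda>x \<delta>. f x \<delta> * g x \<delta>)"
proof -
  obtain C where C: "0 < C" "\<And>x \<delta>. x \<in> K \<Longrightarrow> 0 \<le> \<delta> \<Longrightarrow> \<delta> \<le> r \<Longrightarrow> \<bar>f x \<delta>\<bar> \<le> C"
    "\<And>x \<delta>. x \<in> K \<Longrightarrow> 0 \<le> \<delta> \<Longrightarrow> \<delta> \<le> r \<Longrightarrow> \<bar>f x \<delta> - f x 0\<bar> \<le> C * \<delta>"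
    using lipschitz_at_0E[OF assms(1)] by metis
  obtain C' where C': "0 < C'" "\<And>x \<delta>. x \<in> K \<Longrightarrow> 0 \<le> \<delta> \<Longrightarrow> \<delta> \<le> r \<Longrightarrow> \<bar>g x \<delta>\<bar> \<le> C'"
    "\<And>x \<delta>. x \<in> K \<Longrightarrow> 0 \<le> \<delta> \<Longrightarrow> \<delta> \<le> r \<Longrightarrow> \<bar>g x \<delta> - g x 0\<bar> \<le> C' * \<delta>"
    using lipschitz_at_0E[OF assms(2)] by metis
  show ?thesis
  proof (rule lipschitz_at_0I[where C = "C * C'" and C' = "2 * C * C'"], rule conjI)
    fix x \<delta> assume a: "x \<in> K" "0 \<le> \<delta>" "\<delta> \<le> r"
    show "\<bar>f x \<delta> * g x \<delta>\<bar> \<le> C * C'"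
      unfolding abs_mult using C(1) by (intro mult_mono C(2) C'(2) a) auto
    have r: "0 \<le> r" using a by simp
    have "\<bar>f x \<delta> * g x \<delta> - f x 0 * g x 0\<bar> = \<bar>f x \<delta> * (g x \<delta> - g x 0) + (f x \<delta> - f x 0) * g x 0\<bar>"
      by (simp add: algebra_simps)
    also have "\<dots> \<le> \<bar>f x \<delta>\<bar> * \<bar>g x \<delta> - g x 0\<bar> + \<bar>f x \<delta> - f x 0\<bar> * \<bar>g x 0\<bar>"
      unfolding abs_mult[symmetric] by (rule abs_triangle_ineq)
    also have "\<dots> \<le> C * (C' * \<delta>) + C * \<delta> * C'"
      using C(1) C'(1) a r by (intro add_mono mult_mono C(2,3) C'(2,3)) auto
    finally show "\<bar>f x \<delta> * g x \<delta> - f x 0 * g x 0\<bar> \<le> 2 * C * C' * \<delta>" by (simp add: algebra_simps)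
  qed
qed

lemma lipschitz_at_0_sum:
  assumes "\<And>i. i \<in> I \<Longrightarrow> lipschitz_at_0 K r (f i)"
  shows "lipschitz_at_0 K r (\<lambda>x \<delta>. \<Sum>i\<in>I. f i x \<delta>)"
  using assms
  by (induction I rule: infinite_finite_induct) (simp_all add: lipschitz_at_0_constant lipschitz_at_0_add)

lemma lipschitz_at_0_prod:
  assumes "\<And>i. i \<in> I \<Longrightarrow> lipschitz_at_0 K r (f i)"
  shows "lipschitz_at_0 K r (\<lambda>x \<delta>. \<Prod>i\<in>I. f i x \<delta>)"
  using assms
  by (induction I rule: infinite_finite_induct) (simp_all add: lipschitz_at_0_constant lipschitz_at_0_mult)

lemma lipschitz_at_0_diff:
  assumes "lipschitz_at_0 K r f" "lipschitz_at_0 K r g"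
  shows "lipschitz_at_0 K r (\<lambda>x \<delta>. f x \<delta> - g x \<delta>)"
  using lipschitz_at_0_add[OF assms(1) lipschitz_at_0_mult[OF lipschitz_at_0_constant[of K r "-1"] assms(2)]]
  by simp

lemma lipschitz_at_0_inverse_sqrt:
  assumes "lipschitz_at_0 K r f" "0 < \<eta>" "\<And>x \<delta>. x \<in> K \<Longrightarrow> 0 \<le> \<delta> \<Longrightarrow> \<delta> \<le> r \<Longrightarrow> \<eta> \<le> f x \<delta>"
  shows "lipschitz_at_0 K r (\<lambda>x \<delta>. 1 / sqrt (f x \<delta>))"
proof -
  obtain C where C: "0 < C"
    "\<And>x \<delta>. x \<in> K \<Longrightarrow> 0 \<le> \<delta> \<Longrightarrow> \<delta> \<le> r \<Longrightarrow> \<bar>f x \<delta> - f x 0\<bar> \<le> C * \<delta>"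
    using lipschitz_at_0E[OF assms(1)] by metis
  define s where "s = sqrt \<eta>"
  have s: "0 < s" using assms(2) by (simp add: s_def)
  show ?thesis
  proof (rule lipschitz_at_0I[where C = "1 / s" and C' = "C / (s * s * s)"], rule conjI)
    fix x \<delta> assume a: "x \<in> K" "0 \<le> \<delta>" "\<delta> \<le> r"
    define y z where "y = sqrt (f x \<delta>)" and "z = sqrt (f x 0)"
    have f: "\<eta> \<le> f x \<delta>" "\<eta> \<le> f x 0" using assms(3)[OF a] assms(3)[of x 0] a by auto
    then have yz: "s \<le> y" "s \<le> z" by (auto simp: s_def y_def z_def)
    then have pos: "0 < y" "0 < z" using s by auto
    show "\<bar>1 / sqrt (f x \<delta>)\<bar> \<le> 1 / s"
      using yz pos s by (simp add: frac_le flip: y_def)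
    have sq: "f x \<delta> = y * y" "f x 0 = z * z" using f assms(2) by (auto simp: y_def z_def)
    have "s * \<bar>y - z\<bar> \<le> (y + z) * \<bar>y - z\<bar>" using yz s by (intro mult_right_mono) auto
    also have "\<dots> = \<bar>f x \<delta> - f x 0\<bar>"
      using pos unfolding sq square_diff_square_factored abs_mult by simp
    also have "\<dots> \<le> C * \<delta>" by (rule C(2)[OF a])
    finally have "\<bar>y - z\<bar> \<le> C * \<delta> / s" using s by (simp add: field_simps)
    have "\<bar>1 / y - 1 / z\<bar> = \<bar>y - z\<bar> / (y * z)"
      using pos by (simp add: diff_frac_eq abs_mult abs_minus_commute)
    also have "\<dots> \<le> (C * \<delta> / s) / (s * s)"
      using \<open>\<bar>y - z\<bar> \<le> C * \<delta> / s\<close> s yz by (intro frac_le mult_mono) auto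
    also have "\<dots> = C / (s * s * s) * \<delta>" by simp
    finally show "\<bar>1 / sqrt (f x \<delta>) - 1 / sqrt (f x 0)\<bar> \<le> C / (s * s * s) * \<delta>"
      by (simp add: y_def z_def)
  qed
qed

lemma lipschitz_at_0_eventually:
  assumes "lipschitz_at_0 K r f" "0 < r" "\<And>x. x \<in> K \<Longrightarrow> c \<le> f x 0" "c' < c"
  shows "\<forall>\<^sub>F \<delta> in at_right 0. \<forall>x\<in>K. c' < f x \<delta>"
proof -
  obtain C where C: "0 < C"
    "\<And>x \<delta>. x \<in> K \<Longrightarrow> 0 \<le> \<delta> \<Longrightarrow> \<delta> \<le> r \<Longrightarrow> \<bar>f x \<delta> - f x 0\<bar> \<le> C * \<delta>"
    using lipschitz_at_0E[OF assms(1)] by metis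
  define d where "d = min r ((c - c') / C)"
  have "0 < d" using assms C by (simp add: d_def)
  moreover have "\<forall>x\<in>K. c' < f x \<delta>" if "0 < \<delta>" "\<delta> < d" for \<delta>
  proof
    fix x assume "x \<in> K"
    then have "\<bar>f x \<delta> - f x 0\<bar> \<le> C * \<delta>" "c \<le> f x 0" using C(2) assms(3) that by (auto simp: d_def)
    moreover have "C * \<delta> < c - c'" using that C(1) by (simp add: d_def field_simps)
    ultimately show "c' < f x \<delta>" by linarith
  qed
  ultimately show ?thesis unfolding eventually_at_right_field by blast
qed

text \<open>Entries as sums and products of \<open>1 / w\<close>, \<open>p\<close> and
  \<open>H\<close>, the shape to which closure rules and polynomial algebra apply.\<close>

lemma graph_matrix_component:
  fixes p :: "real^'n"
  shows "graph_matrix p H $ i $ j =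
    1 / sqrt (1 - (norm p)\<^sup>2) * (H $ i $ j + 1 / sqrt (1 - (norm p)\<^sup>2) * (1 / sqrt (1 - (norm p)\<^sup>2)) *
      (p $ i * (\<Sum>l\<in>UNIV. p $ l * H $ l $ j)))"
proof -
  have "(outer p ** H) $ i $ j = p $ i * (\<Sum>l\<in>UNIV. p $ l * H $ l $ j)"
    by (simp add: matrix_matrix_mult_def outer_def sum_distrib_left mult.assoc)
  then show ?thesis
    by (simp add: graph_matrix_def matrix_add_rdistrib power2_eq_square flip: scalar_matrix_assoc)
qed

lemma norm_vec_squared: "(norm p)\<^sup>2 = (\<Sum>i\<in>UNIV. p $ i * p $ i)" for p :: "real^'n"
  unfolding power2_norm_eq_inner by (simp add: inner_vec_def)

text \<open>The bound \<open>\<rho>\<close> keeps the shifted gradients uniformly inside the unit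
  ball, so that \<open>1 / w\<close> belongs to the class; the rest of \<open>\<sigma>\<close> is
  polynomial in it, \<open>p\<close> and \<open>H\<close>.\<close>

lemma lipschitz_at_0_\<sigma>:
  fixes p :: "'a::topological_space \<Rightarrow> real^'n"
  assumes "compact K" "continuous_on K p" "continuous_on K H"
    and "\<rho> < 1" "\<And>x \<delta>. x \<in> K \<Longrightarrow> 0 \<le> \<delta> \<Longrightarrow> \<delta> \<le> r \<Longrightarrow> norm (p x + \<delta> *\<^sub>R e) \<le> \<rho>"
  shows "lipschitz_at_0 K r (\<lambda>x \<delta>. \<sigma> k (p x + \<delta> *\<^sub>R e) (H x))"
proof (cases "K = {} \<or> r < 0")
  case True
  then show ?thesis by (intro lipschitz_at_0I) auto
next
  case False
  then obtain x0 where "x0 \<in> K" "0 \<le> r" by auto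
  then have \<rho>: "0 \<le> \<rho>" using order_trans[OF norm_ge_zero assms(5)[of x0 0]] by simp
  note intros = lipschitz_at_0_add lipschitz_at_0_diff lipschitz_at_0_mult lipschitz_at_0_sum lipschitz_at_0_prod
    lipschitz_at_0_constant lipschitz_at_0_id
  have q: "lipschitz_at_0 K r (\<lambda>x \<delta>. (p x + \<delta> *\<^sub>R e) $ i)" for i
    by (simp, intro intros lipschitz_at_0_const assms(1) continuous_intros assms(2))
  have Hij: "lipschitz_at_0 K r (\<lambda>x \<delta>. H x $ i $ j)" for i j
    by (intro lipschitz_at_0_const assms(1) continuous_intros assms(3))
  have inv: "lipschitz_at_0 K r (\<lambda>x \<delta>. 1 / sqrt (1 - (norm (p x + \<delta> *\<^sub>R e))\<^sup>2))"
  proof (rule lipschitz_at_0_inverse_sqrt)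
    show "lipschitz_at_0 K r (\<lambda>x \<delta>. 1 - (norm (p x + \<delta> *\<^sub>R e))\<^sup>2)"
      unfolding norm_vec_squared by (intro intros q)
    show "0 < 1 - \<rho>\<^sup>2" using assms(4) \<rho> by (simp add: power_less_one_iff)
    show "1 - \<rho>\<^sup>2 \<le> 1 - (norm (p x + \<delta> *\<^sub>R e))\<^sup>2" if "x \<in> K" "0 \<le> \<delta>" "\<delta> \<le> r" for x \<delta>
      using assms(5)[OF that] by (simp add: power_mono)
  qed
  have entry: "lipschitz_at_0 K r (\<lambda>x \<delta>. graph_matrix (p x + \<delta> *\<^sub>R e) (H x) $ i $ j)" for i j
    unfolding graph_matrix_component by (intro intros inv q Hij)
  have "lipschitz_at_0 K r (\<lambda>x \<delta>. if i \<in> I then graph_matrix (p x + \<delta> *\<^sub>R e) (H x) $ i $ s i else axis i 1 $ s i)" for i s I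
    using entry by (cases "i \<in> I") (simp_all add: lipschitz_at_0_constant)
  then show ?thesis unfolding \<sigma>_def minor_sum_expand by (intro intros)
qed

lemma continuous_on_\<sigma>:
  fixes p :: "'a::topological_space \<Rightarrow> real^'n"
  assumes "continuous_on K p" "continuous_on K H" "\<And>x. x \<in> K \<Longrightarrow> norm (p x) < 1"
  shows "continuous_on K (\<lambda>x. \<sigma> k (p x) (H x))"
  unfolding \<sigma>_def
proof (rule continuous_on_minor_sum)
  have "sqrt (1 - (norm (p x))\<^sup>2) \<noteq> 0" if "x \<in> K" for x
    using assms(3)[OF that] power_less_one_iff[of "norm (p x)" 2] by simp
  then show "continuous_on K (\<lambda>x. graph_matrix (p x) (H x) $ i $ j)" for i j
    unfolding graph_matrix_component by (intro continuous_intros assms(1,2)) auto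
qed

lemma psd_if_psd_on_sphere:
  fixes M :: "real^'n^'n"
  assumes "\<And>v. norm v = 1 \<Longrightarrow> 0 \<le> v \<bullet> (M *v v)"
  shows "0 \<le> v \<bullet> (M *v v)"
proof (cases "v = 0")
  case False
  have "v \<bullet> (M *v v) = (norm v)\<^sup>2 * (sgn v \<bullet> (M *v sgn v))"
    using False by (simp add: sgn_div_norm matrix_vector_mult_scaleR power2_eq_square field_simps)
  then show ?thesis using assms[of "sgn v"] False by (simp add: norm_sgn)
qed simp

lemma matrix_vector_mult_minus: "(- A) *v v = - (A *v v)" for A :: "real^'n^'m"
  by (simp add: vec_eq_iff matrix_vector_mult_def sum_negf)

lemma zero_if_orthogonal_to_sphere:
  assumes "\<And>v. norm v = 1 \<Longrightarrow> y \<bullet> v = 0"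
  shows "y = (0::'a::euclidean_space)"
  using assms by (metis euclidean_all_zero_iff norm_Basis)

lemma inner_outer: "v \<bullet> (outer e *v v) = (v \<bullet> e)\<^sup>2" for v :: "real^'n"
proof -
  have "outer e *v v = (v \<bullet> e) *\<^sub>R e"
    by (simp add: vec_eq_iff matrix_vector_mult_def outer_def inner_vec_def sum_distrib_right sum_distrib_left ac_simps)
  then show ?thesis by (simp add: power2_eq_square inner_commute)
qed

lemma compact_positive_lower_bound:
  fixes f :: "'a::topological_space \<Rightarrow> real"
  assumes "compact K" "continuous_on K f" "\<And>x. x \<in> K \<Longrightarrow> 0 < f x"
  obtains c where "0 < c" "\<And>x. x \<in> K \<Longrightarrow> c \<le> f x"
proof (cases "K = {}")
  case False
  then obtain x where "x \<in> K" "\<forall>y\<in>K. f x \<le> f y"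
    using continuous_attains_inf[OF assms(1) _ assms(2)] by blast
  then show ?thesis using assms(3) that by blast
qed (use that[of 1] in auto)

text \<open>A perturbation by \<open>\<epsilon> exp (A x \<bullet> e)\<close> with large \<open>A\<close> makes the subsolution strict: its second
  derivatives exceed its first ones by the factor \<open>A\<close>.\<close>

theorem comparison_principle:
  fixes v1 v2 :: "real^'n \<Rightarrow> real"
  assumes "open \<Omega>" "bounded \<Omega>" "1 \<le> k"
    and "continuous_on (closure \<Omega>) v1" "continuous_on (closure \<Omega>) v2"
    and C2: "Ck_on (Suc (Suc 0)) \<Omega> v1" "Ck_on (Suc (Suc 0)) \<Omega> v2"
    and adm: "\<And>x. x \<in> \<Omega> \<Longrightarrow> \<sigma>_admissible k (gradient UNIV v1 x) (hessian UNIV v1 x)"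
    and sub: "\<And>x. x \<in> \<Omega> \<Longrightarrow> f x (v1 x) \<le> \<sigma> k (gradient UNIV v1 x) (hessian UNIV v1 x)"
    and super: "\<And>x. x \<in> \<Omega> \<Longrightarrow> \<sigma> k (gradient UNIV v2 x) (hessian UNIV v2 x) \<le> f x (v2 x)"
    and mono: "\<And>x a b. x \<in> \<Omega> \<Longrightarrow> a \<le> b \<Longrightarrow> f x a \<le> f x b"
    and bd: "\<And>x. x \<in> frontier \<Omega> \<Longrightarrow> v1 x \<le> v2 x"
    and "x \<in> closure \<Omega>"
  shows "v1 x \<le> v2 x"
proof (rule ccontr)
  assume neg: "\<not> v1 x \<le> v2 x"
  define g1 H1 where "g1 = gradient UNIV v1" and "H1 = hessian UNIV v1"
  define g2 H2 where "g2 = gradient UNIV v2" and "H2 = hessian UNIV v2"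
  have cl: "compact (closure \<Omega>)" using assms(2) by simp
  have ne: "closure \<Omega> \<noteq> {}" using assms(13) by auto
  obtain xm where xm: "xm \<in> closure \<Omega>" "\<And>y. y \<in> closure \<Omega> \<Longrightarrow> v1 y - v2 y \<le> v1 xm - v2 xm"
    using continuous_attains_sup[OF cl ne continuous_on_diff[OF assms(4,5)]] by auto
  define m where "m = v1 xm - v2 xm"
  have m: "0 < m" using xm(2)[OF assms(13)] neg by (simp add: m_def)
  \<comment> \<open>This superlevel set is compact and misses the frontier, where
    \<open>v1 \<le> v2\<close>. Uniform constants are sought on \<open>K\<close>, since second
    derivatives are not controlled near the boundary.\<close>
  define K where "K = closure \<Omega> \<inter> (\<lambda>x. v1 x - v2 x) -` {m / 2..}"
  have "closed K"
    unfolding K_def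
    by (intro continuous_closed_preimage continuous_on_diff assms(4,5) closed_closure closed_atLeast)
  then have K: "compact K" using cl using compact_Int_closed[OF cl, of K] by (simp add: K_def Int_absorb1)
  have K\<Omega>: "K \<subseteq> \<Omega>"
  proof
    fix y assume y: "y \<in> K"
    then have "y \<notin> frontier \<Omega>" using bd[of y] m by (auto simp: K_def)
    then show "y \<in> \<Omega>" using y interior_open[OF assms(1)] by (simp add: K_def frontier_def)
  qed
  have xmK: "xm \<in> K" using xm m by (simp add: K_def m_def)
  \<comment> \<open>An arbitrary unit vector; \<open>undefined\<close> merely names some
    index.\<close>
  define e :: "real^'n" where "e = axis undefined 1"
  have e: "norm e = 1" "e \<noteq> 0" by (auto simp: e_def)
  have cont: "continuous_on K g1" "continuous_on K H1"
    using continuous_on_hessian[OF assms(1) C2(1)] K\<Omega> by (auto simp: g1_def H1_def intro: continuous_on_subset)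
  have g1: "norm (g1 y) < 1" if "y \<in> K" for y
    using adm K\<Omega> that by (auto simp: \<sigma>_admissible_def g1_def)
  have "continuous_on K (\<lambda>y. 1 - norm (g1 y))" by (intro continuous_intros cont)
  then obtain \<gamma> where \<gamma>: "0 < \<gamma>" "\<And>y. y \<in> K \<Longrightarrow> \<gamma> \<le> 1 - norm (g1 y)"
    using compact_positive_lower_bound[OF K] g1 by (metis diff_gt_0_iff_gt)
  define r where "r = \<gamma> / 2"
  have r: "0 < r" using \<gamma> by (simp add: r_def)
  have small: "norm (g1 y + \<delta> *\<^sub>R e) \<le> 1 - r" if "y \<in> K" "0 \<le> \<delta>" "\<delta> \<le> r" for y \<delta>
    using norm_triangle_ineq[of "g1 y" "\<delta> *\<^sub>R e"] \<gamma>(2)[OF that(1)] e that by (simp add: r_def)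
  have lip: "lipschitz_at_0 K r (\<lambda>y \<delta>. \<sigma> j (g1 y + \<delta> *\<^sub>R e) (H y))" if "continuous_on K H" for j H
    using r small that by (intro lipschitz_at_0_\<sigma>[OF K cont(1) _, of _ "1 - r"]) auto
  have sym1: "transpose (H1 y) = H1 y" if "y \<in> \<Omega>" for y
    unfolding H1_def using Ck_on_2_hessian(2)[OF assms(1) C2(1) that] .
  have sym2: "transpose (H2 y) = H2 y" if "y \<in> \<Omega>" for y
    unfolding H2_def using Ck_on_2_hessian(2)[OF assms(1) C2(2) that] .
  have ev1: "\<forall>\<^sub>F \<delta> in at_right 0. \<forall>y\<in>K. 0 < \<sigma> j (g1 y + \<delta> *\<^sub>R e) (H1 y)" if j: "j \<in> {1..k}" for j
  proof -
    have "0 < \<sigma> j (g1 y) (H1 y)" if "y \<in> K" for y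
      using adm K\<Omega> that j by (auto simp: \<sigma>_admissible_def g1_def H1_def)
    then obtain c where "0 < c" "\<And>y. y \<in> K \<Longrightarrow> c \<le> \<sigma> j (g1 y) (H1 y)"
      using compact_positive_lower_bound[OF K continuous_on_\<sigma>[OF cont g1]] by metis
    then show ?thesis
      by (intro lipschitz_at_0_eventually[OF lip[OF cont(2)] r, where c = c]) auto
  qed
  define slope where "slope q H = \<sigma> k q (H + outer e) - \<sigma> k q H" for q H
  have cont': "continuous_on K (\<lambda>y. H1 y + outer e)" by (intro continuous_intros cont)
  have cs: "continuous_on K (\<lambda>y. slope (g1 y) (H1 y))"
    unfolding slope_def by (intro continuous_on_diff continuous_on_\<sigma> cont cont' g1)
  have ps: "0 < slope (g1 y) (H1 y)" if "y \<in> K" for y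
  proof -
    have y: "y \<in> \<Omega>" using K\<Omega> that by auto
    show ?thesis
      unfolding slope_def using adm[OF y]
      by (intro \<sigma>_rank_one(2) g1 sym1 assms(3) e(2) that y) (simp add: g1_def H1_def)
  qed
  obtain c where c: "0 < c" "\<And>y. y \<in> K \<Longrightarrow> c \<le> slope (g1 y) (H1 y)"
    using compact_positive_lower_bound[OF K cs ps] by auto
  have "\<forall>\<^sub>F \<delta> in at_right 0. \<forall>y\<in>K. c / 2 < slope (g1 y + \<delta> *\<^sub>R e) (H1 y)"
    by (rule lipschitz_at_0_eventually[where c = c and r = r])
      (use c r in \<open>auto simp: slope_def intro!: lipschitz_at_0_diff lip cont cont'\<close>)
  moreover have "\<forall>\<^sub>F \<delta> in at_right 0. \<forall>j\<in>{1..k}. \<forall>y\<in>K. 0 < \<sigma> j (g1 y + \<delta> *\<^sub>R e) (H1 y)"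
    using ev1 by (intro eventually_ball_finite) auto
  moreover have "\<forall>\<^sub>F \<delta> in at_right 0. \<delta> < r" unfolding eventually_at_right_field using r by blast
  ultimately have "\<forall>\<^sub>F \<delta> in at_right 0. \<delta> < r \<and> (\<forall>y\<in>K. c / 2 < slope (g1 y + \<delta> *\<^sub>R e) (H1 y)) \<and>
      (\<forall>j\<in>{1..k}. \<forall>y\<in>K. 0 < \<sigma> j (g1 y + \<delta> *\<^sub>R e) (H1 y))"
    by eventually_elim auto
  then obtain d where d: "0 < d" "\<And>\<delta>. 0 < \<delta> \<Longrightarrow> \<delta> < d \<Longrightarrow> \<delta> < r \<and> (\<forall>y\<in>K. c / 2 < slope (g1 y + \<delta> *\<^sub>R e) (H1 y)) \<and>
      (\<forall>j\<in>{1..k}. \<forall>y\<in>K. 0 < \<sigma> j (g1 y + \<delta> *\<^sub>R e) (H1 y))"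
    unfolding eventually_at_right_field by auto
  obtain C where C: "0 < C" "\<And>y \<delta>. y \<in> K \<Longrightarrow> 0 \<le> \<delta> \<Longrightarrow> \<delta> \<le> r \<Longrightarrow>
      \<bar>\<sigma> k (g1 y + \<delta> *\<^sub>R e) (H1 y) - \<sigma> k (g1 y + 0 *\<^sub>R e) (H1 y)\<bar> \<le> C * \<delta>"
    using lipschitz_at_0E[OF lip[OF cont(2), of k]] by metis
  \<comment> \<open>The exponential gains at least \<open>\<delta> A c / 2\<close> through its
    Hessian and loses at most \<open>C \<delta>\<close> through the shifted gradient; this
    \<open>A\<close> makes the gain win.\<close>
  define A where "A = 2 * C / c + 1"
  have A: "0 < A" "C < A * (c / 2)" using C(1) c(1) by (auto simp: A_def field_simps add_pos_pos)
  obtain R where R: "\<And>y. y \<in> closure \<Omega> \<Longrightarrow> norm y \<le> R"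
    using compact_imp_bounded[OF cl] by (auto simp: bounded_iff)
  define h where "h y = exp (A * (y \<bullet> e))" for y
  have hpos: "0 < h y" for y by (simp add: h_def)
  define E where "E = exp (A * R)"
  have hE: "h y \<le> E" if "y \<in> closure \<Omega>" for y
  proof -
    have "y \<bullet> e \<le> R" using norm_cauchy_schwarz[of y e] e R[OF that] by simp
    then show ?thesis using A by (simp add: h_def E_def)
  qed
  have E: "0 < E" by (simp add: E_def)
  \<comment> \<open>The first bound keeps the gradient shift below \<open>d\<close>; the second
    keeps the perturbation at most \<open>m / 8\<close>, so that the perturbed maximum stays in
    \<open>K\<close>.\<close>
  define \<epsilon> where "\<epsilon> = min (d / (2 * A * E)) (m / (8 * E))"
  have \<epsilon>: "0 < \<epsilon>" using d m A E by (simp add: \<epsilon>_def)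
  have "\<epsilon> \<le> d / (2 * A * E)" "\<epsilon> \<le> m / (8 * E)" by (auto simp: \<epsilon>_def)
  then have \<epsilon>1: "\<epsilon> * A * E \<le> d / 2" "\<epsilon> * E \<le> m / 8"
    using A E by (simp_all add: field_simps)
  define z where "z y = v1 y + \<epsilon> * h y - v2 y" for y
  have "continuous_on (closure \<Omega>) z"
    unfolding z_def h_def by (intro continuous_intros assms(4,5))
  then obtain xs where xs: "xs \<in> closure \<Omega>" "\<And>y. y \<in> closure \<Omega> \<Longrightarrow> z y \<le> z xs"
    using continuous_attains_sup[OF cl ne, of z] by auto
  have "\<epsilon> * h xs \<le> m / 8" using hE[OF xs(1)] \<epsilon> \<epsilon>1 by (meson less_imp_le mult_left_mono order_trans)
  moreover have "m < z xm" using mult_pos_pos[OF \<epsilon> hpos[of xm]] by (simp add: z_def m_def)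
  ultimately have vxs: "m / 2 < v1 xs - v2 xs" using xs(2)[OF xm(1)] m by (simp add: z_def)
  then have xsK: "xs \<in> K" using xs(1) by (simp add: K_def)
  then have xs\<Omega>: "xs \<in> \<Omega>" using K\<Omega> by auto
  \<comment> \<open>At \<open>xs\<close> the perturbation has gradient \<open>\<delta> e\<close> and
    Hessian \<open>\<delta> A\<close> times \<open>outer e\<close>.\<close>
  define \<delta> where "\<delta> = \<epsilon> * A * h xs"
  have \<delta>: "0 < \<delta>" using \<epsilon> A hpos by (simp add: \<delta>_def)
  have "\<delta> \<le> \<epsilon> * A * E" unfolding \<delta>_def using hE[OF xs(1)] \<epsilon> A by (intro mult_left_mono) auto
  then have \<delta>d: "\<delta> < d" using \<epsilon>1 d(1) by linarith
  obtain \<rho> where \<rho>: "0 < \<rho>" "ball xs \<rho> \<subseteq> \<Omega>" using assms(1) xs\<Omega> open_contains_ball by blast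
  have crit: "(g1 xs + \<delta> *\<^sub>R e - g2 xs) \<bullet> v = 0"
    "v \<bullet> (H1 xs *v v) + \<delta> * A * (v \<bullet> e)\<^sup>2 - v \<bullet> (H2 xs *v v) \<le> 0" if v: "norm v = 1" for v
  proof -
    define n where "n t = (g1 (xs + t *\<^sub>R v) + (\<epsilon> * A * h (xs + t *\<^sub>R v)) *\<^sub>R e - g2 (xs + t *\<^sub>R v)) \<bullet> v" for t
    have line: "xs + t *\<^sub>R v \<in> \<Omega>" if "\<bar>t\<bar> < \<rho>" for t
      using \<rho>(2) that v by (auto simp: dist_norm)
    have lineder: "((\<lambda>t. xs + t *\<^sub>R v) has_derivative (\<lambda>t. t *\<^sub>R v)) (at t)" for t
      by (auto intro!: derivative_eq_intros)
    have dh: "((\<lambda>t. h (xs + t *\<^sub>R v)) has_real_derivative A * (v \<bullet> e) * h (xs + t *\<^sub>R v)) (at t)" for t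
      unfolding h_def by (auto intro!: derivative_eq_intros simp: inner_add_left)
    have d1: "((\<lambda>t. - z (xs + t *\<^sub>R v)) has_real_derivative - 1 * n t) (at t)" if "\<bar>t\<bar> < \<rho>" for t
    proof -
      have "((\<lambda>t. v1 (xs + t *\<^sub>R v)) has_derivative (\<lambda>s. g1 (xs + t *\<^sub>R v) \<bullet> (s *\<^sub>R v))) (at t)"
        unfolding g1_def
        by (rule has_derivative_compose[OF lineder Ck_on_1_has_derivative[OF assms(1) C2(1) line[OF that]]])
      moreover have "((\<lambda>t. v2 (xs + t *\<^sub>R v)) has_derivative (\<lambda>s. g2 (xs + t *\<^sub>R v) \<bullet> (s *\<^sub>R v))) (at t)"
        unfolding g2_def
        by (rule has_derivative_compose[OF lineder Ck_on_1_has_derivative[OF assms(1) C2(2) line[OF that]]])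
      ultimately have "((\<lambda>t. - z (xs + t *\<^sub>R v)) has_derivative
          (\<lambda>s. - (g1 (xs + t *\<^sub>R v) \<bullet> (s *\<^sub>R v) + \<epsilon> * (A * (v \<bullet> e) * h (xs + t *\<^sub>R v) * s) - g2 (xs + t *\<^sub>R v) \<bullet> (s *\<^sub>R v)))) (at t)"
        unfolding z_def
        by (intro has_derivative_minus has_derivative_diff has_derivative_add has_derivative_mult_right
            dh[THEN has_field_derivative_imp_has_derivative])
      then show ?thesis unfolding has_field_derivative_def
        by (rule has_derivative_eq_rhs) (auto simp: n_def inner_add_left inner_diff_left inner_commute algebra_simps)
    qed
    have d2: "(n has_real_derivative v \<bullet> (H1 xs *v v) + \<delta> * A * (v \<bullet> e)\<^sup>2 - v \<bullet> (H2 xs *v v)) (at 0)"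
    proof -
      have 0: "xs + 0 *\<^sub>R v \<in> \<Omega>" using xs\<Omega> by simp
      have "((\<lambda>t. g1 (xs + t *\<^sub>R v)) has_derivative (\<lambda>s. H1 (xs + 0 *\<^sub>R v) *v (s *\<^sub>R v))) (at 0)"
        unfolding g1_def H1_def
        by (rule has_derivative_compose[OF lineder Ck_on_2_hessian(1)[OF assms(1) C2(1) 0]])
      moreover have "((\<lambda>t. g2 (xs + t *\<^sub>R v)) has_derivative (\<lambda>s. H2 (xs + 0 *\<^sub>R v) *v (s *\<^sub>R v))) (at 0)"
        unfolding g2_def H2_def
        by (rule has_derivative_compose[OF lineder Ck_on_2_hessian(1)[OF assms(1) C2(2) 0]])
      ultimately have "(n has_derivative (\<lambda>s. (H1 (xs + 0 *\<^sub>R v) *v (s *\<^sub>R v) +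
         (\<epsilon> * A * (A * (v \<bullet> e) * h (xs + 0 *\<^sub>R v) * s)) *\<^sub>R e - H2 (xs + 0 *\<^sub>R v) *v (s *\<^sub>R v)) \<bullet> v)) (at 0)"
        unfolding n_def
        by (intro has_derivative_inner_left has_derivative_diff has_derivative_add has_derivative_scaleR_left
            has_derivative_mult_right dh[THEN has_field_derivative_imp_has_derivative])
      then show ?thesis unfolding has_field_derivative_def
        by (rule has_derivative_eq_rhs)
          (auto simp: \<delta>_def inner_add_left inner_diff_left inner_commute matrix_vector_mult_scaleR power2_eq_square algebra_simps)
    qed
    have "- z (xs + 0 *\<^sub>R v) \<le> - z (xs + t *\<^sub>R v)" if "\<bar>t\<bar> < \<rho>" for t
      using xs(2)[of "xs + t *\<^sub>R v"] line[OF that] closure_subset[of \<Omega>] by auto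
    from second_derivative_test[OF \<rho>(1) d1 _ this d2]
    show "(g1 xs + \<delta> *\<^sub>R e - g2 xs) \<bullet> v = 0"
      "v \<bullet> (H1 xs *v v) + \<delta> * A * (v \<bullet> e)\<^sup>2 - v \<bullet> (H2 xs *v v) \<le> 0"
      by (auto simp: n_def \<delta>_def)
  qed
  define q where "q = g1 xs + \<delta> *\<^sub>R e"
  have "q - g2 xs = 0" by (rule zero_if_orthogonal_to_sphere) (simp add: q_def crit(1))
  then have "q = g2 xs" by simp
  define H where "H = H1 xs + (\<delta> * A) *\<^sub>R outer e"
  have symH: "transpose H = H" using sym1[OF xs\<Omega>]
    by (simp add: H_def transpose_def vec_eq_iff outer_def mult.commute)
  have "\<sigma>_admissible k q (H1 xs)"
    using d(2)[OF \<delta> \<delta>d] small[OF xsK, of \<delta>] \<delta> r sym1[OF xs\<Omega>] xsK by (auto simp: \<sigma>_admissible_def q_def)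
  note adm1 = this
  have psd: "0 \<le> v \<bullet> (((\<delta> * A) *\<^sub>R outer e) *v v)" for v
    using \<delta> A by (simp add: inner_outer scaleR_matrix_vector_assoc[symmetric])
  have "\<sigma>_admissible k q H"
    unfolding \<sigma>_admissible_def
  proof (intro conjI ballI symH)
    show "norm q < 1" using adm1 by (simp add: \<sigma>_admissible_def)
    fix j assume j: "j \<in> {1..k}"
    have "\<sigma> j q (H1 xs) \<le> \<sigma> j q H"
      unfolding H_def using j by (intro \<sigma>_mono[OF adm1 _ psd]) (simp_all add: transpose_scalar)
    moreover have "0 < \<sigma> j q (H1 xs)" using adm1 j by (simp add: \<sigma>_admissible_def)
    ultimately show "0 < \<sigma> j q H" by linarith
  qed
  moreover have "transpose (H2 xs - H) = H2 xs - H"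
    using symH sym2[OF xs\<Omega>] by (simp add: transpose_def vec_eq_iff)
  moreover have "0 \<le> v \<bullet> ((H2 xs - H) *v v)" for v
  proof (rule psd_if_psd_on_sphere)
    fix y :: "real^'n" assume "norm y = 1"
    from crit(2)[OF this] show "0 \<le> y \<bullet> ((H2 xs - H) *v y)"
      by (simp add: H_def matrix_vector_mult_diff_rdistrib matrix_vector_mult_add_rdistrib inner_diff_right
          inner_add_right inner_outer scaleR_matrix_vector_assoc[symmetric])
  qed
  \<comment> \<open>The perturbed \<open>v1\<close> and \<open>v2\<close> share the gradient
    \<open>q\<close> at \<open>xs\<close> and their Hessians are ordered, so monotonicity at a fixed
    gradient applies.\<close>
  ultimately have "\<sigma> k q H \<le> \<sigma> k q (H + (H2 xs - H))"
    using assms(3) by (intro \<sigma>_mono) auto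
  moreover have "\<sigma> k q H = \<sigma> k q (H1 xs) + \<delta> * A * slope q (H1 xs)"
    unfolding H_def slope_def using adm1 by (intro \<sigma>_rank_one(1) assms(3) sym1 xs\<Omega>) (simp add: \<sigma>_admissible_def)
  moreover have "\<delta> * C < \<delta> * A * slope q (H1 xs)"
  proof -
    have "c / 2 < slope q (H1 xs)" using d(2)[OF \<delta> \<delta>d] xsK by (auto simp: q_def)
    then have "A * (c / 2) < A * slope q (H1 xs)" using A by simp
    then have "C < A * slope q (H1 xs)" using A by linarith
    then show ?thesis using \<delta> by simp
  qed
  moreover have "\<bar>\<sigma> k q (H1 xs) - \<sigma> k (g1 xs) (H1 xs)\<bar> \<le> C * \<delta>"
    using C(2)[OF xsK, of \<delta>] d(2)[OF \<delta> \<delta>d] \<delta> by (simp add: q_def)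
  ultimately have "\<sigma> k (g1 xs) (H1 xs) < \<sigma> k (g2 xs) (H2 xs)"
    using \<open>q = g2 xs\<close> by (simp add: mult.commute)
  moreover have "f xs (v2 xs) \<le> f xs (v1 xs)" using mono[OF xs\<Omega>] vxs m by simp
  ultimately show False using sub[OF xs\<Omega>] super[OF xs\<Omega>] by (simp add: g1_def g2_def H1_def H2_def)
qed

section \<open>The gradient at an interior maximum\<close>

lemma inner_matrix_symmetric:
  "transpose A = A \<Longrightarrow> x \<bullet> (A *v y) = (A *v x) \<bullet> y" for A :: "real^'n^'n"
  by (metis dot_lmul_matrix vector_transpose_matrix)

text \<open>At a maximum of \<open>log (1 / w) + B u\<close>; only the component \<open>p \<bullet> Du\<close> of the gradient enters,
  since \<open>\<bar>p \<bullet> Du\<bar> \<le> \<bar>p\<bar> \<bar>Du\<bar>\<close> with equality at the maximum point.\<close>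

lemma tilt_max_second_order:
  fixes u :: "real^'n \<Rightarrow> real"
  assumes "open \<Omega>" "Ck_on (Suc (Suc (Suc 0))) \<Omega> u" "x0 \<in> \<Omega>"
    and p: "p = gradient UNIV u x0" "p \<noteq> 0"
    and H: "H = hessian UNIV u x0"
    and T: "(hessian UNIV u has_derivative T) (at x0)" "\<And>h. transpose (T h) = T h" "\<And>a b. T a *v b = T b *v a"
    and max: "\<And>x. x \<in> \<Omega> \<Longrightarrow> (1 - (norm p)\<^sup>2) * exp (- 2 * B * u x0) \<le>
      (1 - (norm (gradient UNIV u x))\<^sup>2) * exp (- 2 * B * u x)"
    and W: "W = 1 - (norm p)\<^sup>2"
  shows "H *v p = - (B * W) *\<^sub>R p"
    "v \<bullet> (T p *v v) + 2 * B\<^sup>2 * W * (p \<bullet> v)\<^sup>2 + B * W * (v \<bullet> (H *v v)) \<le> 0"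
proof -
  define q where "q = (norm p)\<^sup>2"
  have q: "0 < q" "p \<bullet> p = q" using p(2) by (auto simp: q_def power2_norm_eq_inner)
  have Hs: "transpose H = H" unfolding H using Ck_on_2_hessian(2)[OF assms(1-3)] .
  obtain \<rho> where \<rho>: "0 < \<rho>" "ball x0 \<rho> \<subseteq> \<Omega>" using assms(1,3) open_contains_ball by blast
  have crit: "p \<bullet> (H *v e) = - (B * W) * (p \<bullet> e)"
    "e \<bullet> (T p *v e) + 2 * B\<^sup>2 * W * (p \<bullet> e)\<^sup>2 + B * W * (e \<bullet> (H *v e)) \<le> 0"
    if e: "norm e = 1" for e
  proof -
    define y y' u' where "y t = p \<bullet> gradient UNIV u (x0 + t *\<^sub>R e)"
      and "y' t = p \<bullet> (hessian UNIV u (x0 + t *\<^sub>R e) *v e)"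
      and "u' t = gradient UNIV u (x0 + t *\<^sub>R e) \<bullet> e" for t
    \<comment> \<open>The quotient of \<open>(y t)^2\<close> by \<open>q\<close> is at most
      \<open>|Du|^2\<close>, with equality at 0; multiplying by \<open>q\<close> clears the
      denominator. The minimality expressed by \<open>max\<close> therefore carries over to
      \<open>m\<close>.\<close>
    define m where "m t = (q - (y t)\<^sup>2) * exp (- 2 * B * u (x0 + t *\<^sub>R e))" for t
    define n where "n t = y t * y' t + B * u' t * (q - (y t)\<^sup>2)" for t
    have line: "x0 + t *\<^sub>R e \<in> \<Omega>" if "\<bar>t\<bar> < \<rho>" for t
      using \<rho>(2) that e by (auto simp: dist_norm)
    have lineder: "((\<lambda>t. x0 + t *\<^sub>R e) has_derivative (\<lambda>t. t *\<^sub>R e)) (at t)" for t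
      by (auto intro!: derivative_eq_intros)
    have dg: "((\<lambda>t. gradient UNIV u (x0 + t *\<^sub>R e)) has_derivative
        (\<lambda>s. hessian UNIV u (x0 + t *\<^sub>R e) *v (s *\<^sub>R e))) (at t)" if "\<bar>t\<bar> < \<rho>" for t
      by (rule has_derivative_compose[OF lineder Ck_on_2_hessian(1)[OF assms(1,2) line[OF that]]])
    have dy: "(y has_real_derivative y' t) (at t)" if "\<bar>t\<bar> < \<rho>" for t
      using has_derivative_inner_right[OF dg[OF that], of p]
      unfolding has_field_derivative_def y_def[abs_def]
      by (rule has_derivative_eq_rhs) (auto simp: y'_def matrix_vector_mult_scaleR)
    have du: "((\<lambda>t. u (x0 + t *\<^sub>R e)) has_real_derivative u' t) (at t)" if "\<bar>t\<bar> < \<rho>" for t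
      using has_derivative_compose[OF lineder Ck_on_1_has_derivative[OF assms(1,2) line[OF that]]]
      unfolding has_field_derivative_def by (rule has_derivative_eq_rhs) (auto simp: u'_def)
    have du': "(u' has_real_derivative (H *v e) \<bullet> e) (at 0)"
      using has_derivative_inner_left[OF dg[of 0], of e] \<rho>(1)
      unfolding has_field_derivative_def u'_def[abs_def]
      by (auto simp: H matrix_vector_mult_scaleR mult.commute[of _ "_ \<bullet> e"] elim!: has_derivative_eq_rhs)
    have "((\<lambda>t. hessian UNIV u (x0 + t *\<^sub>R e)) has_derivative (\<lambda>s. T (s *\<^sub>R e))) (at 0)"
      by (rule has_derivative_compose[OF lineder]) (simp add: T(1))
    moreover have bl: "bounded_linear (\<lambda>A::real^'n^'n. p \<bullet> (A *v e))"
      by (intro linear_conv_bounded_linear[THEN iffD1] linearI)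
        (auto simp: matrix_vector_mult_add_rdistrib inner_add_right scaleR_matrix_vector_assoc[symmetric])
    ultimately have "(y' has_derivative (\<lambda>s. p \<bullet> (T (s *\<^sub>R e) *v e))) (at 0)"
      unfolding y'_def[abs_def] by (rule bounded_linear.has_derivative[rotated])
    moreover have "T (s *\<^sub>R e) = s *\<^sub>R T e" for s
      using has_derivative_bounded_linear[OF T(1)] by (simp add: bounded_linear.linear linear_cmul)
    ultimately have dy': "(y' has_real_derivative p \<bullet> (T e *v e)) (at 0)"
      by (simp add: has_field_derivative_def scaleR_matrix_vector_assoc[symmetric] mult.commute[of _ "p \<bullet> _"])
    have dm: "(m has_real_derivative - (2 * exp (- 2 * B * u (x0 + t *\<^sub>R e))) * n t) (at t)" if "\<bar>t\<bar> < \<rho>" for t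
      unfolding m_def
      by (rule derivative_eq_intros dy[OF that] du[OF that] refl | simp)+
        (simp add: n_def algebra_simps power2_eq_square)
    have dn: "(n has_real_derivative y' 0 * y' 0 + y 0 * (p \<bullet> (T e *v e)) +
        (B * ((H *v e) \<bullet> e) * (q - (y 0)\<^sup>2) - B * u' 0 * (2 * y 0 * y' 0))) (at 0)"
      unfolding n_def
      by (rule derivative_eq_intros dy dy' du' refl | simp add: \<rho>(1))+
    have y0: "y 0 = q" by (simp add: y_def q p(1)[symmetric])
    have mmin: "m 0 \<le> m t" if "\<bar>t\<bar> < \<rho>" for t
    proof -
      have "q * ((1 - (norm p)\<^sup>2) * exp (- 2 * B * u x0)) \<le>
         q * ((1 - (norm (gradient UNIV u (x0 + t *\<^sub>R e)))\<^sup>2) * exp (- 2 * B * u (x0 + t *\<^sub>R e)))"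
        using q(1) by (intro mult_left_mono max line that) auto
      moreover have "(y t)\<^sup>2 \<le> q * (norm (gradient UNIV u (x0 + t *\<^sub>R e)))\<^sup>2"
      proof -
        have "\<bar>y t\<bar> \<le> norm p * norm (gradient UNIV u (x0 + t *\<^sub>R e))"
          unfolding y_def by (rule Cauchy_Schwarz_ineq2)
        then have "\<bar>y t\<bar>\<^sup>2 \<le> (norm p * norm (gradient UNIV u (x0 + t *\<^sub>R e)))\<^sup>2" by (rule power_mono) simp
        then show ?thesis by (simp add: q_def power_mult_distrib)
      qed
      then have "q * (1 - (norm (gradient UNIV u (x0 + t *\<^sub>R e)))\<^sup>2) * exp (- 2 * B * u (x0 + t *\<^sub>R e)) \<le> m t"
        unfolding m_def by (intro mult_right_mono) (auto simp: algebra_simps)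
      moreover have "m 0 = q * ((1 - (norm p)\<^sup>2) * exp (- 2 * B * u x0))"
        by (simp add: m_def y0 q_def[symmetric]) (simp add: power2_eq_square algebra_simps)
      ultimately show ?thesis by (simp add: mult.assoc)
    qed
    have n0: "n 0 = 0" and D: "y' 0 * y' 0 + y 0 * (p \<bullet> (T e *v e)) +
        (B * ((H *v e) \<bullet> e) * (q - (y 0)\<^sup>2) - B * u' 0 * (2 * y 0 * y' 0)) \<le> 0"
      using second_derivative_test[OF \<rho>(1) dm _ mmin dn] by auto
    have u'0: "u' 0 = p \<bullet> e" by (simp add: u'_def p(1))
    have "q * (y' 0 + B * W * (p \<bullet> e)) = n 0"
      by (simp add: n_def y0 u'0 W q_def power2_eq_square algebra_simps)
    then have y'0: "y' 0 = - (B * W) * (p \<bullet> e)" using n0 q(1) by simp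
    then show "p \<bullet> (H *v e) = - (B * W) * (p \<bullet> e)" by (simp add: y'_def H)
    \<comment> \<open>Symmetry of third derivatives turns the variation in direction
      \<open>e\<close> into the derivative of the Hessian along \<open>p\<close>, the one that the
      differentiated equation contains.\<close>
    have Te: "p \<bullet> (T e *v e) = e \<bullet> (T p *v e)"
      using inner_matrix_symmetric[OF T(2), of p e e] T(3)[of e p] by (simp add: inner_commute)
    have "q * (e \<bullet> (T p *v e) + 2 * B\<^sup>2 * W * (p \<bullet> e)\<^sup>2 + B * W * (e \<bullet> (H *v e))) + (y' 0)\<^sup>2 \<le> 0"
    proof -
      have qW: "q - (y 0)\<^sup>2 = q * W" by (simp add: y0 W q_def[symmetric]) (simp add: power2_eq_square algebra_simps)
      show ?thesis
        using D unfolding qW unfolding y0 u'0 Te y'0 inner_commute[of "H *v e" e]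
        by (simp add: power2_eq_square algebra_simps)
    qed
    moreover have "0 \<le> (y' 0)\<^sup>2" by simp
    ultimately have "q * (e \<bullet> (T p *v e) + 2 * B\<^sup>2 * W * (p \<bullet> e)\<^sup>2 + B * W * (e \<bullet> (H *v e))) \<le> 0" by linarith
    then show "e \<bullet> (T p *v e) + 2 * B\<^sup>2 * W * (p \<bullet> e)\<^sup>2 + B * W * (e \<bullet> (H *v e)) \<le> 0"
      using q(1) by (simp add: mult_le_0_iff)
  qed
  have "H *v p + (B * W) *\<^sub>R p = 0"
  proof (rule zero_if_orthogonal_to_sphere)
    fix e :: "real^'n" assume "norm e = 1"
    from crit(1)[OF this] show "(H *v p + (B * W) *\<^sub>R p) \<bullet> e = 0"
      using inner_matrix_symmetric[OF Hs, of p e] by (simp add: inner_add_left)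
  qed
  then show "H *v p = - (B * W) *\<^sub>R p" by (simp add: eq_neg_iff_add_eq_0)
  have "0 \<le> v \<bullet> ((- (T p + (2 * B\<^sup>2 * W) *\<^sub>R outer p + (B * W) *\<^sub>R H)) *v v)"
  proof (rule psd_if_psd_on_sphere)
    fix e :: "real^'n" assume "norm e = 1"
    from crit(2)[OF this] show "0 \<le> e \<bullet> ((- (T p + (2 * B\<^sup>2 * W) *\<^sub>R outer p + (B * W) *\<^sub>R H)) *v e)"
      by (simp add: matrix_vector_mult_add_rdistrib matrix_vector_mult_diff_rdistrib matrix_vector_mult_minus inner_add_right inner_diff_right
          inner_outer scaleR_matrix_vector_assoc[symmetric] inner_commute[of e p])
  qed
  then show "v \<bullet> (T p *v v) + 2 * B\<^sup>2 * W * (p \<bullet> v)\<^sup>2 + B * W * (v \<bullet> (H *v v)) \<le> 0"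
    by (simp add: matrix_vector_mult_add_rdistrib matrix_vector_mult_diff_rdistrib matrix_vector_mult_minus inner_add_right inner_diff_right
          inner_outer scaleR_matrix_vector_assoc[symmetric] inner_commute[of v p])
qed

text \<open>As \<open>p\<close> is an eigenvector of \<open>H\<close>, moving along \<open>p\<close>
  alters the gradient, to first order, only in length. The resulting terms assemble into
  \<open>- B\<close> times the curvature matrix, and the remainder is governed by \<open>N\<close>,
  whose sign the second-order condition provides.\<close>

lemma graph_matrix_curve_derivative:
  fixes g :: "real \<Rightarrow> real^'n" and K :: "real \<Rightarrow> real^'n^'n"
  assumes p: "g 0 = p" "norm p < 1" and H: "K 0 = H" "transpose H = H"
    and dg: "(g has_derivative (\<lambda>s. s *\<^sub>R (- (B * W)) *\<^sub>R p)) (at 0)"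
    and dK: "(K has_derivative (\<lambda>s. s *\<^sub>R T)) (at 0)"
    and Hp: "H *v p = - (B * W) *\<^sub>R p" and W: "W = 1 - (norm p)\<^sup>2"
    and N: "N = - (T + (2 * B\<^sup>2 * W) *\<^sub>R outer p + (B * W) *\<^sub>R H)"
  shows "((\<lambda>t. graph_matrix (g t) (K t)) has_derivative
    (\<lambda>s. s *\<^sub>R (- B *\<^sub>R graph_matrix p H - graph_matrix p N))) (at 0)"
proof (intro has_derivative_vecI)
  fix i j
  define q where "q = p \<bullet> p"
  have W': "W = 1 - q" by (simp add: W q_def power2_norm_eq_inner)
  have Wpos: "0 < W" using p(2) by (simp add: W power_less_one_iff)
  define r where "r = 1 / sqrt W"
  have r: "0 < r" "r * r * W = 1" using Wpos by (auto simp: r_def)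
  have dgi: "((\<lambda>t. g t $ l) has_real_derivative - (B * W) * p $ l) (at 0)" for l
    using bounded_linear.has_derivative[OF bounded_linear_vec_nth[of l] dg]
    unfolding has_field_derivative_def by (rule has_derivative_eq_rhs) (auto simp: algebra_simps)
  have dKij: "((\<lambda>t. K t $ l $ j) has_real_derivative T $ l $ j) (at 0)" for l j
    using bounded_linear.has_derivative[OF bounded_linear_vec_nth[of j]
        bounded_linear.has_derivative[OF bounded_linear_vec_nth[of l] dK]]
    unfolding has_field_derivative_def by (rule has_derivative_eq_rhs) (auto simp: algebra_simps)
  define s where "s t = 1 - (norm (g t))\<^sup>2" for t
  have s0: "s 0 = W" by (simp add: s_def W p)
  have "s = (\<lambda>t. 1 - (\<Sum>l\<in>UNIV. g t $ l * g t $ l))"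
    unfolding s_def norm_vec_squared ..
  moreover have "((\<lambda>t. 1 - (\<Sum>l\<in>UNIV. g t $ l * g t $ l)) has_real_derivative
      0 - (\<Sum>l\<in>UNIV. - (B * W) * p $ l * g 0 $ l + - (B * W) * p $ l * g 0 $ l)) (at 0)"
    by (intro derivative_intros DERIV_mult dgi)
  moreover have "0 - (\<Sum>l\<in>UNIV. - (B * W) * p $ l * g 0 $ l + - (B * W) * p $ l * g 0 $ l) = 2 * B * W * q"
    by (simp add: p q_def inner_vec_def sum_distrib_left sum.distrib sum_negf algebra_simps)
  ultimately have ds: "(s has_real_derivative 2 * B * W * q) (at 0)" by simp
  have dr: "((\<lambda>t. 1 / sqrt (s t)) has_real_derivative - B * q * r) (at 0)"
  proof -
    have "((\<lambda>t. sqrt (s t)) has_real_derivative inverse (sqrt W) / 2 * (2 * B * W * q)) (at 0)"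
      using DERIV_chain2[OF DERIV_real_sqrt ds] s0 Wpos by simp
    then have "((\<lambda>t. inverse (sqrt (s t))) has_real_derivative
        - (inverse (sqrt W) / 2 * (2 * B * W * q) * inverse ((sqrt W)\<^sup>2))) (at 0)"
      using DERIV_inverse_fun[of "\<lambda>t. sqrt (s t)" _ 0 UNIV] s0 Wpos by (simp add: numeral_2_eq_2)
    moreover have "- (inverse (sqrt W) / 2 * (2 * B * W * q) * inverse ((sqrt W)\<^sup>2)) = - B * q * r"
      using Wpos by (simp add: r_def inverse_eq_divide)
    ultimately show ?thesis by (simp add: inverse_eq_divide)
  qed
  define k where "k t = (\<Sum>l\<in>UNIV. g t $ l * K t $ l $ j)" for t
  define \<tau> where "\<tau> = (\<Sum>l\<in>UNIV. p $ l * T $ l $ j)"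
  have sumH: "(\<Sum>l\<in>UNIV. p $ l * H $ l $ j) = - (B * W) * p $ j"
  proof -
    have "H $ l $ j = H $ j $ l" for l
      using arg_cong[OF H(2), of "\<lambda>A. A $ j $ l"] by (simp add: transpose_def)
    then have "(\<Sum>l\<in>UNIV. p $ l * H $ l $ j) = (H *v p) $ j"
      by (simp add: matrix_vector_mult_def mult.commute)
    then show ?thesis by (simp add: Hp)
  qed
  have k0: "k 0 = - (B * W) * p $ j" by (simp add: k_def p H(1) sumH)
  have dk: "(k has_real_derivative \<tau> + (B * W) * (B * W) * p $ j) (at 0)"
  proof -
    have "(k has_real_derivative (\<Sum>l\<in>UNIV. - (B * W) * p $ l * K 0 $ l $ j + T $ l $ j * g 0 $ l)) (at 0)"
      unfolding k_def by (intro derivative_intros DERIV_mult dgi dKij)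
    moreover have "(\<Sum>l\<in>UNIV. - (B * W) * p $ l * K 0 $ l $ j + T $ l $ j * g 0 $ l) =
       - (B * W) * (\<Sum>l\<in>UNIV. p $ l * H $ l $ j) + \<tau>"
      by (simp add: p H(1) \<tau>_def sum.distrib sum_subtractf sum_distrib_left mult.assoc mult.commute[of "T $ _ $ _"] sum_negf)
    ultimately show ?thesis by (simp add: sumH add.commute mult.assoc)
  qed
  have Nij: "N $ i $ j = - (T $ i $ j + 2 * B\<^sup>2 * W * (p $ i * p $ j) + B * W * H $ i $ j)"
    by (simp add: N outer_def)
  have Nsum: "(\<Sum>l\<in>UNIV. p $ l * N $ l $ j) = - (\<tau> + 2 * B\<^sup>2 * W * q * p $ j - (B * W) * (B * W) * p $ j)"
  proof -
    have "(\<Sum>l\<in>UNIV. p $ l * N $ l $ j) = - (\<tau> + 2 * B\<^sup>2 * W * (\<Sum>l\<in>UNIV. p $ l * p $ l) * p $ j +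
       B * W * (\<Sum>l\<in>UNIV. p $ l * H $ l $ j))"
      by (simp add: N outer_def \<tau>_def sum.distrib sum_subtractf sum_distrib_left sum_distrib_right sum_negf algebra_simps)
    then show ?thesis by (simp add: sumH q_def inner_vec_def)
  qed
  have r': "1 / sqrt (1 - (norm p)\<^sup>2) = r" by (simp add: r_def W)
  have "((\<lambda>t. 1 / sqrt (s t) * (K t $ i $ j + 1 / sqrt (s t) * (1 / sqrt (s t)) * (g t $ i * k t))) has_real_derivative
      - B * q * r * (H $ i $ j + r * r * (p $ i * k 0)) +
      (T $ i $ j + ((- B * q * r * r + - B * q * r * r) * (p $ i * k 0) +
        (- (B * W) * p $ i * k 0 + (\<tau> + (B * W) * (B * W) * p $ j) * p $ i) * (r * r))) * r) (at 0)"
    using DERIV_mult[OF dr DERIV_add[OF dKij[of i j] DERIV_mult[OF DERIV_mult[OF dr dr] DERIV_mult[OF dgi[of i] dk]]]]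
    by (simp add: s0 p H(1) flip: r_def)
  moreover have "- B * q * r * (H $ i $ j + r * r * (p $ i * k 0)) +
      (T $ i $ j + ((- B * q * r * r + - B * q * r * r) * (p $ i * k 0) +
        (- (B * W) * p $ i * k 0 + (\<tau> + (B * W) * (B * W) * p $ j) * p $ i) * (r * r))) * r =
      (- B *\<^sub>R graph_matrix p H - graph_matrix p N) $ i $ j"
  proof -
    \<comment> \<open>What remains is a polynomial identity modulo \<open>r * r * W = 1\<close> and
      this relation.\<close>
    have "q = 1 - W" using W' by simp
    then show ?thesis
      using r(2) unfolding k0 vector_minus_component vector_scaleR_component graph_matrix_component r' sumH Nsum Nij
        real_scaleR_def
      by algebra
  qed
  ultimately have "((\<lambda>t. graph_matrix (g t) (K t) $ i $ j) has_real_derivative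
      (- B *\<^sub>R graph_matrix p H - graph_matrix p N) $ i $ j) (at 0)"
    unfolding graph_matrix_component s_def k_def by simp
  then show "((\<lambda>t. graph_matrix (g t) (K t) $ i $ j) has_derivative
      (\<lambda>s. (s *\<^sub>R (- B *\<^sub>R graph_matrix p H - graph_matrix p N)) $ i $ j)) (at 0)"
    unfolding has_field_derivative_def by (rule has_derivative_eq_rhs) (auto simp: algebra_simps)
qed

text \<open>Both sides of the equation are differentiated along the line through \<open>x0\<close>
  in direction \<open>p\<close>. The left side gives \<open>- B k \<psi>\<close> minus a nonnegative
  term. On the right, the part from the \<open>z\<close>-derivative of \<open>\<psi>\<close> is
  nonnegative and the other part is at least \<open>- L\<close> because
  \<open>norm p < 1\<close>.\<close>

theorem interior_tilt_maximum:
  fixes u :: "real^'n \<Rightarrow> real" and \<psi> :: "(real^'n) \<times> real \<Rightarrow> real"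
  assumes "open \<Omega>" "Ck_on (Suc (Suc (Suc 0))) \<Omega> u" "x0 \<in> \<Omega>" "1 \<le> k"
    and adm: "\<sigma>_admissible k (gradient UNIV u x0) (hessian UNIV u x0)"
    and eq: "\<And>x. x \<in> \<Omega> \<Longrightarrow> \<sigma> k (gradient UNIV u x) (hessian UNIV u x) = \<psi> (x, u x)"
    and \<psi>: "(\<psi> has_derivative (\<lambda>h. \<gamma> \<bullet> h)) (at (x0, u x0))" "0 \<le> \<gamma> \<bullet> (0, 1)" "norm \<gamma> \<le> L"
    and p0: "gradient UNIV u x0 \<noteq> 0"
    and max: "\<And>x. x \<in> \<Omega> \<Longrightarrow> (1 - (norm (gradient UNIV u x0))\<^sup>2) * exp (- 2 * B * u x0) \<le>
      (1 - (norm (gradient UNIV u x))\<^sup>2) * exp (- 2 * B * u x)"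
  shows "B * (real k * \<psi> (x0, u x0)) \<le> L"
proof -
  define p H where "p = gradient UNIV u x0" and "H = hessian UNIV u x0"
  define W where "W = 1 - (norm p)\<^sup>2"
  have p: "norm p < 1" and Hs: "transpose H = H" using adm by (auto simp: \<sigma>_admissible_def p_def H_def)
  obtain T where T: "(hessian UNIV u has_derivative T) (at x0)"
    "\<And>h. transpose (T h) = T h" "\<And>a b. T a *v b = T b *v a"
    using Ck_on_3_third_derivative[OF assms(1-3)] by metis
  note so = tilt_max_second_order[OF assms(1-3) p_def p0[folded p_def] H_def T max[folded p_def] W_def]
  define N where "N = - (T p + (2 * B\<^sup>2 * W) *\<^sub>R outer p + (B * W) *\<^sub>R H)"
  have Ns: "transpose N = N"
  proof -
    have "T p $ i $ j = T p $ j $ i" "H $ i $ j = H $ j $ i" for i j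
      using arg_cong[OF T(2), of "\<lambda>A. A $ i $ j"] arg_cong[OF Hs, of "\<lambda>A. A $ i $ j"]
      by (simp_all add: transpose_def)
    then show ?thesis by (simp add: N_def transpose_def vec_eq_iff outer_def mult.commute)
  qed
  have Np: "0 \<le> v \<bullet> (N *v v)" for v
    using so(2)[of v]
    by (simp add: N_def matrix_vector_mult_add_rdistrib matrix_vector_mult_diff_rdistrib matrix_vector_mult_minus inner_add_right inner_diff_right
          inner_outer scaleR_matrix_vector_assoc[symmetric] inner_commute[of v p])
  obtain \<L> where L: "(minor_sum k has_derivative \<L>) (at (graph_matrix p H))"
    "\<L> (graph_matrix p H) = real k * \<sigma> k p H"
    "\<And>N. transpose N = N \<Longrightarrow> (\<And>v. 0 \<le> v \<bullet> (N *v v)) \<Longrightarrow> 0 \<le> \<L> (graph_matrix p N)"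
    using minor_sum_derivative[OF adm assms(4)] unfolding p_def H_def by metis
  interpret L: bounded_linear \<L> using L(1) by (rule has_derivative_bounded_linear)
  define X where "X t = x0 + t *\<^sub>R p" for t
  have dX: "(X has_derivative (\<lambda>s. s *\<^sub>R p)) (at 0)"
    unfolding X_def[abs_def] by (auto intro!: derivative_eq_intros)
  have X0: "X 0 = x0" by (simp add: X_def)
  have dg: "((\<lambda>t. gradient UNIV u (X t)) has_derivative (\<lambda>s. s *\<^sub>R (- (B * W)) *\<^sub>R p)) (at 0)"
  proof -
    have "((\<lambda>t. gradient UNIV u (X t)) has_derivative (\<lambda>s. H *v (s *\<^sub>R p))) (at 0)"
      using has_derivative_compose[OF dX, of "gradient UNIV u" "(*v) H"] Ck_on_2_hessian(1)[OF assms(1-3)]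
      by (simp add: X0 H_def)
    then show ?thesis by (simp add: matrix_vector_mult_scaleR so(1))
  qed
  have dK: "((\<lambda>t. hessian UNIV u (X t)) has_derivative (\<lambda>s. s *\<^sub>R T p)) (at 0)"
  proof -
    have "((\<lambda>t. hessian UNIV u (X t)) has_derivative (\<lambda>s. T (s *\<^sub>R p))) (at 0)"
      using has_derivative_compose[OF dX, of "hessian UNIV u" T] T(1) by (simp add: X0)
    moreover have "T (s *\<^sub>R p) = s *\<^sub>R T p" for s
      using has_derivative_bounded_linear[OF T(1)] by (simp add: bounded_linear.linear linear_cmul)
    ultimately show ?thesis by simp
  qed
  define D where "D = - B *\<^sub>R graph_matrix p H - graph_matrix p N"
  have dA: "((\<lambda>t. graph_matrix (gradient UNIV u (X t)) (hessian UNIV u (X t))) has_derivative (\<lambda>s. s *\<^sub>R D)) (at 0)"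
    unfolding D_def by (rule graph_matrix_curve_derivative[OF _ p _ Hs dg dK so(1) W_def N_def])
      (simp_all add: X0 p_def H_def)
  have d\<sigma>: "((\<lambda>t. \<sigma> k (gradient UNIV u (X t)) (hessian UNIV u (X t))) has_derivative (\<lambda>s. \<L> (s *\<^sub>R D))) (at 0)"
    unfolding \<sigma>_def
    by (rule has_derivative_compose[OF dA]) (simp add: X0 L(1) flip: p_def H_def)
  have "((\<lambda>t. u (X t)) has_derivative (\<lambda>s. p \<bullet> (s *\<^sub>R p))) (at 0)"
    using has_derivative_compose[OF dX, of u "(\<bullet>) p"] Ck_on_1_has_derivative[OF assms(1-3)] by (simp add: X0 p_def)
  then have "((\<lambda>t. (X t, u (X t))) has_derivative (\<lambda>s. (s *\<^sub>R p, p \<bullet> (s *\<^sub>R p)))) (at 0)"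
    by (intro has_derivative_Pair dX)
  then have d\<psi>: "((\<lambda>t. \<psi> (X t, u (X t))) has_derivative (\<lambda>s. \<gamma> \<bullet> (s *\<^sub>R p, p \<bullet> (s *\<^sub>R p)))) (at 0)"
    by (rule has_derivative_compose) (simp add: X0 \<psi>(1))
  have "open (X -` \<Omega>)" unfolding X_def[abs_def]
    by (intro open_vimage assms(1) continuous_intros)
  then have "((\<lambda>t. \<sigma> k (gradient UNIV u (X t)) (hessian UNIV u (X t))) has_derivative
      (\<lambda>s. \<gamma> \<bullet> (s *\<^sub>R p, p \<bullet> (s *\<^sub>R p)))) (at 0)"
    by (rule has_derivative_transform_within_open[OF d\<psi>]) (auto simp: X0 assms(3) eq)
  from has_derivative_unique[OF d\<sigma> this] have "\<L> (1 *\<^sub>R D) = \<gamma> \<bullet> (1 *\<^sub>R p, p \<bullet> (1 *\<^sub>R p))" by meson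
  then have "- B * (real k * \<sigma> k p H) - \<L> (graph_matrix p N) = \<gamma> \<bullet> (p, 0) + (p \<bullet> p) * (\<gamma> \<bullet> (0, 1))"
    by (simp add: D_def L.diff L.scaleR L(2) L.neg inner_prod_def)
  moreover have "0 \<le> \<L> (graph_matrix p N)" by (rule L(3)[OF Ns Np])
  moreover have "0 \<le> (p \<bullet> p) * (\<gamma> \<bullet> (0, 1))" using \<psi>(2) by simp
  moreover have "- L \<le> \<gamma> \<bullet> (p, 0)"
  proof -
    have "\<bar>\<gamma> \<bullet> (p, 0)\<bar> \<le> norm \<gamma> * norm (p, 0::real)" by (rule Cauchy_Schwarz_ineq2)
    also have "\<dots> \<le> norm \<gamma> * 1" using p by (intro mult_left_mono) (auto simp: norm_Pair)
    finally show ?thesis using \<psi>(3) by linarith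
  qed
  ultimately have "B * (real k * \<sigma> k p H) \<le> L" by linarith
  then show ?thesis using eq[OF assms(3)] by (simp add: p_def H_def)
qed

section \<open>The gradient on the boundary\<close>

text \<open>\<open>local_defining_function\<close> describes \<open>\<Omega>\<close> by
  \<open>\<rho> > 0\<close> alone. A negative value at \<open>x\<close> would persist nearby and
  separate \<open>x\<close> from \<open>\<Omega>\<close>, although \<open>x\<close> is in the
  closure.\<close>

lemma local_defining_function_boundary:
  fixes \<Omega> :: "(real^'n) set"
  assumes "open \<Omega>" "local_defining_function \<Omega> x U \<rho>" "x \<in> frontier \<Omega>"
  shows "(\<rho> has_derivative (\<lambda>h. gradient UNIV \<rho> x \<bullet> h)) (at x)" "\<rho> x = 0"
proof -
  have U: "open U" "x \<in> U" "smooth_on U \<rho>" "\<Omega> \<inter> U = {x \<in> U. 0 < \<rho> x}"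
    using assms(2) by (auto simp: local_defining_function_def)
  have "Ck_on (Suc 0) U \<rho>" using U(3) by (simp only: smooth_on_def)
  then show der: "(\<rho> has_derivative (\<lambda>h. gradient UNIV \<rho> x \<bullet> h)) (at x)"
    using Ck_on_1_has_derivative[OF U(1) _ U(2)] by blast
  have "x \<notin> \<Omega>" "x \<in> closure \<Omega>"
    using assms(1,3) by (auto simp: frontier_def interior_open)
  then have "\<rho> x \<le> 0" using U by force
  moreover have "0 \<le> \<rho> x"
  proof (rule ccontr)
    assume neg: "\<not> 0 \<le> \<rho> x"
    have "\<forall>\<^sub>F y in at x. \<rho> y < 0"
      using has_derivative_continuous[OF der] neg by (auto simp: isCont_def intro: order_tendstoD(2))
    moreover have "\<forall>\<^sub>F y in at x. y \<in> U" using U by (intro eventually_at_in_open')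
    ultimately have "\<forall>\<^sub>F y in at x. y \<notin> \<Omega>" by eventually_elim (use U(4) in force)
    moreover have "x islimpt \<Omega>" using \<open>x \<in> closure \<Omega>\<close> \<open>x \<notin> \<Omega>\<close> by (auto simp: closure_def)
    ultimately show False by (auto simp: islimpt_iff_eventually)
  qed
  ultimately show "\<rho> x = 0" by simp
qed

lemma local_defining_function_sides:
  fixes \<Omega> :: "(real^'n) set"
  assumes "open \<Omega>" "local_defining_function \<Omega> x U \<rho>" "x \<in> frontier \<Omega>"
  shows "0 < gradient UNIV \<rho> x \<bullet> v \<Longrightarrow> \<exists>d>0. \<forall>t. 0 < t \<and> t < d \<longrightarrow> x + t *\<^sub>R v \<in> \<Omega>"
    "gradient UNIV \<rho> x \<bullet> v < 0 \<Longrightarrow> \<exists>d>0. \<forall>t. 0 < t \<and> t < d \<longrightarrow> x + t *\<^sub>R v \<notin> \<Omega>"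
proof -
  have U: "open U" "x \<in> U" "\<Omega> \<inter> U = {x \<in> U. 0 < \<rho> x}"
    using assms(2) by (auto simp: local_defining_function_def)
  note \<rho> = local_defining_function_boundary[OF assms]
  have "((\<lambda>t. x + t *\<^sub>R v) has_derivative (\<lambda>t. t *\<^sub>R v)) (at 0)"
    by (auto intro!: derivative_eq_intros)
  then have "((\<lambda>t. \<rho> (x + t *\<^sub>R v)) has_derivative (\<lambda>t. gradient UNIV \<rho> x \<bullet> (t *\<^sub>R v))) (at 0)"
    by (rule has_derivative_compose) (simp add: \<rho>(1))
  then have der: "((\<lambda>t. \<rho> (x + t *\<^sub>R v)) has_real_derivative gradient UNIV \<rho> x \<bullet> v) (at 0)"
    unfolding has_field_derivative_def by (rule has_derivative_eq_rhs) auto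
  have "open ((\<lambda>t. x + t *\<^sub>R v) -` U)" by (intro open_vimage U continuous_intros)
  then obtain e where "0 < e" "\<forall>t. dist t 0 < e \<longrightarrow> t \<in> (\<lambda>t. x + t *\<^sub>R v) -` U"
    unfolding open_dist using U by (auto dest!: bspec[of _ _ 0])
  then have e: "0 < e" "\<And>t. \<bar>t\<bar> < e \<Longrightarrow> x + t *\<^sub>R v \<in> U" by auto
  show "\<exists>d>0. \<forall>t. 0 < t \<and> t < d \<longrightarrow> x + t *\<^sub>R v \<in> \<Omega>" if pos: "0 < gradient UNIV \<rho> x \<bullet> v"
  proof -
    obtain d where "d > 0" "\<And>h. 0 < h \<Longrightarrow> h < d \<Longrightarrow> \<rho> (x + 0 *\<^sub>R v) < \<rho> (x + (0 + h) *\<^sub>R v)"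
      using DERIV_pos_inc_right[OF der pos] by auto
    then show ?thesis using e U(3) \<rho>(2) by (intro exI[of _ "min d e"]) auto
  qed
  show "\<exists>d>0. \<forall>t. 0 < t \<and> t < d \<longrightarrow> x + t *\<^sub>R v \<notin> \<Omega>" if neg: "gradient UNIV \<rho> x \<bullet> v < 0"
  proof -
    obtain d where d: "d > 0" "\<And>h. 0 < h \<Longrightarrow> h < d \<Longrightarrow> \<rho> (x + (0 + h) *\<^sub>R v) < \<rho> (x + 0 *\<^sub>R v)"
      using DERIV_neg_dec_right[OF der neg] by auto
    have "x + t *\<^sub>R v \<notin> \<Omega>" if "0 < t" "t < min d e" for t
    proof
      assume "x + t *\<^sub>R v \<in> \<Omega>"
      then have "x + t *\<^sub>R v \<in> \<Omega> \<inter> U" using e(2)[of t] that by simp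
      then show False using d(2)[of t] U(3) \<rho>(2) that by simp
    qed
    then show ?thesis using d(1) e(1) by (intro exI[of _ "min d e"]) auto
  qed
qed

text \<open>Tangential derivatives vanish: near \<open>x + t \<tau>\<close> there are points inside and outside of the
  domain at distance \<open>o(t)\<close>, hence boundary points.\<close>

lemma boundary_derivative_normal:
  fixes \<Omega> :: "(real^'n) set"
  assumes "open \<Omega>" "local_defining_function \<Omega> x U \<rho>" "x \<in> frontier \<Omega>"
    and "(f has_derivative (\<lambda>h. \<gamma> \<bullet> h)) (at x within closure \<Omega>)"
    and "\<And>y. y \<in> frontier \<Omega> \<Longrightarrow> f y = 0" "\<And>y. y \<in> \<Omega> \<Longrightarrow> 0 \<le> f y"
  obtains a where "0 \<le> a" "\<gamma> = a *\<^sub>R gradient UNIV \<rho> x"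
proof -
  define \<nu> where "\<nu> = gradient UNIV \<rho> x"
  have \<nu>: "0 < \<nu> \<bullet> \<nu>" using assms(2) by (auto simp: local_defining_function_def \<nu>_def)
  have fx: "f x = 0" using assms(3,5) by simp
  have approx: "\<exists>d>0. \<forall>y\<in>closure \<Omega>. norm (y - x) < d \<longrightarrow> \<bar>f y - \<gamma> \<bullet> (y - x)\<bar> \<le> e * norm (y - x)" if "0 < e" for e
    using assms(4) that fx by (auto simp: has_derivative_within_alt)
  have "0 \<le> \<gamma> \<bullet> \<nu>"
  proof (rule ccontr)
    assume neg: "\<not> 0 \<le> \<gamma> \<bullet> \<nu>"
    \<comment> \<open>With this tolerance the error at \<open>x + t \<nu>\<close> is half of
      \<open>t |\<gamma> \<bullet> \<nu>|\<close>, too small to make \<open>f\<close> nonnegative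
      there.\<close>
    define e where "e = - (\<gamma> \<bullet> \<nu>) / (2 * norm \<nu>)"
    have n\<nu>: "0 < norm \<nu>" using \<nu> by (metis inner_gt_zero_iff zero_less_norm_iff)
    then have e: "0 < e" unfolding e_def using neg by (intro divide_pos_pos) auto
    obtain d1 where d1: "d1 > 0" "\<forall>y\<in>closure \<Omega>. norm (y - x) < d1 \<longrightarrow> \<bar>f y - \<gamma> \<bullet> (y - x)\<bar> \<le> e * norm (y - x)"
      using approx[OF e] by auto
    obtain d2 where d2: "d2 > 0" "\<And>t. 0 < t \<Longrightarrow> t < d2 \<Longrightarrow> x + t *\<^sub>R \<nu> \<in> \<Omega>"
      using local_defining_function_sides(1)[OF assms(1-3), of \<nu>] \<nu> unfolding \<nu>_def by auto
    have "0 < d1 / norm \<nu>" using d1(1) n\<nu> by (rule divide_pos_pos)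
    then obtain t where t: "0 < t" "t < d2" "t < d1 / norm \<nu>"
      using field_lbound_gt_zero[of d2 "d1 / norm \<nu>"] d2(1) by blast
    have y: "x + t *\<^sub>R \<nu> \<in> \<Omega>" using d2 t by auto
    then have "\<bar>f (x + t *\<^sub>R \<nu>) - \<gamma> \<bullet> (t *\<^sub>R \<nu>)\<bar> \<le> e * norm (t *\<^sub>R \<nu>)"
      using d1(2)[rule_format, of "x + t *\<^sub>R \<nu>"] closure_subset[of \<Omega>] t n\<nu> by (auto simp: pos_less_divide_eq)
    moreover have "0 \<le> f (x + t *\<^sub>R \<nu>)" using assms(6) y by simp
    moreover have "e * norm (t *\<^sub>R \<nu>) = - (\<gamma> \<bullet> \<nu>) / 2 * t" using t n\<nu> by (simp add: e_def)
    ultimately have "- (t * (\<gamma> \<bullet> \<nu>)) \<le> - (t * (\<gamma> \<bullet> \<nu>)) / 2" by (simp add: mult.commute)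
    moreover have "t * (\<gamma> \<bullet> \<nu>) < 0" using t neg by (simp add: mult_pos_neg)
    ultimately show False by simp
  qed
  have tang: "\<gamma> \<bullet> \<tau> = 0" if \<tau>: "\<nu> \<bullet> \<tau> = 0" for \<tau>
  proof (rule ccontr)
    assume ne: "\<gamma> \<bullet> \<tau> \<noteq> 0"
    define c where "c = \<bar>\<gamma> \<bullet> \<tau>\<bar>"
    have c: "0 < c" using ne by (simp add: c_def)
    \<comment> \<open>The normal deviation and the differentiation error will each cost at most
      \<open>c / 4\<close>, together less than \<open>c\<close>.\<close>
    define \<epsilon> where "\<epsilon> = c / (4 * (\<bar>\<gamma> \<bullet> \<nu>\<bar> + 1))"
    have \<epsilon>: "0 < \<epsilon>" using c by (simp add: \<epsilon>_def)
    define R where "R = norm \<tau> + \<epsilon> * norm \<nu> + 1"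
    have R: "0 < R" using \<epsilon> by (simp add: R_def add_nonneg_pos)
    define e where "e = c / (4 * R)"
    have e: "0 < e" using c R by (simp add: e_def)
    obtain d1 where d1: "d1 > 0" "\<forall>y\<in>closure \<Omega>. norm (y - x) < d1 \<longrightarrow> \<bar>f y - \<gamma> \<bullet> (y - x)\<bar> \<le> e * norm (y - x)"
      using approx[OF e] by auto
    obtain d2 where d2: "d2 > 0" "\<And>t. 0 < t \<Longrightarrow> t < d2 \<Longrightarrow> x + t *\<^sub>R (\<tau> + \<epsilon> *\<^sub>R \<nu>) \<in> \<Omega>"
      using local_defining_function_sides(1)[OF assms(1-3), of "\<tau> + \<epsilon> *\<^sub>R \<nu>"] \<nu> \<tau> \<epsilon>
      by (auto simp: \<nu>_def[symmetric] inner_add_right)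
    obtain d3 where d3: "d3 > 0" "\<And>t. 0 < t \<Longrightarrow> t < d3 \<Longrightarrow> x + t *\<^sub>R (\<tau> - \<epsilon> *\<^sub>R \<nu>) \<notin> \<Omega>"
      using local_defining_function_sides(2)[OF assms(1-3), of "\<tau> - \<epsilon> *\<^sub>R \<nu>"] \<nu> \<tau> \<epsilon>
      by (auto simp: \<nu>_def[symmetric] inner_diff_right)
    have "0 < d1 / R" using d1(1) R by (rule divide_pos_pos)
    then obtain t where t: "0 < t" "t < d2" "t < d3" "t < d1 / R"
      using field_lbound_gt_zero[of "min d2 d3" "d1 / R"] d2(1) d3(1) by auto
    define a b where "a = x + t *\<^sub>R (\<tau> + \<epsilon> *\<^sub>R \<nu>)" and "b = x + t *\<^sub>R (\<tau> - \<epsilon> *\<^sub>R \<nu>)"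
    have "a \<in> \<Omega>" "b \<notin> \<Omega>" using d2(2) d3(2) t by (auto simp: a_def b_def)
    \<comment> \<open>The crossing point is \<open>x + t (\<tau> + s \<nu>)\<close> with
      \<open>|s| \<le> \<epsilon>\<close>, and \<open>f\<close> vanishes there.\<close>
    then have "closed_segment a b \<inter> frontier \<Omega> \<noteq> {}"
      by (intro connected_Int_frontier connected_segment) auto
    then obtain z where z: "z \<in> closed_segment a b" "z \<in> frontier \<Omega>" by auto
    then obtain l where l: "0 \<le> l" "l \<le> 1" "z = (1 - l) *\<^sub>R a + l *\<^sub>R b"
      by (auto simp: in_segment)
    define s where "s = (1 - 2 * l) * \<epsilon>"
    define w where "w = \<tau> + s *\<^sub>R \<nu>"
    have zw: "z - x = t *\<^sub>R w" unfolding l(3) a_def b_def w_def s_def by (simp add: vec_eq_iff algebra_simps)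
    have s: "\<bar>s\<bar> \<le> \<epsilon>"
    proof -
      have "\<bar>1 - 2 * l\<bar> * \<epsilon> \<le> 1 * \<epsilon>" using l \<epsilon> by (intro mult_right_mono) auto
      then show ?thesis using \<epsilon> by (simp add: s_def abs_mult)
    qed
    have w: "norm w \<le> R"
    proof -
      have "norm w \<le> norm \<tau> + \<bar>s\<bar> * norm \<nu>" unfolding w_def by (metis norm_scaleR norm_triangle_ineq)
      also have "\<dots> \<le> R" using s by (simp add: R_def add_increasing2 mult_right_mono)
      finally show ?thesis .
    qed
    have "norm (z - x) < d1"
    proof -
      have "t * norm w \<le> t * R" using w t by (intro mult_left_mono) auto
      also have "\<dots> < d1" using t R by (simp add: pos_less_divide_eq)
      finally show ?thesis using t by (simp add: zw)
    qed
    moreover have "z \<in> closure \<Omega>" using z(2) by (simp add: frontier_def)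
    ultimately have "\<bar>f z - \<gamma> \<bullet> (z - x)\<bar> \<le> e * norm (z - x)" using d1(2) by blast
    then have "t * \<bar>\<gamma> \<bullet> w\<bar> \<le> t * (e * norm w)"
      using assms(5)[OF z(2)] t by (simp add: zw abs_mult mult.left_commute)
    then have "\<bar>\<gamma> \<bullet> w\<bar> \<le> e * norm w" using t by simp
    also have "\<dots> \<le> e * R" using w e by (intro mult_left_mono) auto
    also have "\<dots> = c / 4" using R by (simp add: e_def)
    finally have "\<bar>\<gamma> \<bullet> \<tau> + s * (\<gamma> \<bullet> \<nu>)\<bar> \<le> c / 4" by (simp add: w_def inner_add_right)
    moreover have "\<bar>s * (\<gamma> \<bullet> \<nu>)\<bar> \<le> c / 4"
    proof -
      have "\<bar>s * (\<gamma> \<bullet> \<nu>)\<bar> \<le> \<epsilon> * (\<bar>\<gamma> \<bullet> \<nu>\<bar> + 1)"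
        unfolding abs_mult using s \<epsilon> by (intro mult_mono) auto
      also have "\<dots> = c / 4" using abs_ge_zero[of "\<gamma> \<bullet> \<nu>"] by (simp add: \<epsilon>_def field_simps)
      finally show ?thesis .
    qed
    ultimately show False using c by (simp add: c_def abs_if split: if_splits)
  qed
  define a where "a = (\<gamma> \<bullet> \<nu>) / (\<nu> \<bullet> \<nu>)"
  define y where "y = \<gamma> - a *\<^sub>R \<nu>"
  have "\<nu> \<bullet> y = 0" using \<nu> by (simp add: y_def a_def inner_diff_right inner_commute)
  then have "y \<bullet> y = 0" using tang[of y] by (simp add: y_def inner_diff_left)
  then have "\<gamma> = a *\<^sub>R \<nu>" by (simp add: y_def)
  moreover have "0 \<le> a" using \<open>0 \<le> \<gamma> \<bullet> \<nu>\<close> \<nu> by (simp add: a_def)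
  ultimately show thesis using that by (simp add: \<nu>_def)
qed

text \<open>\<open>u - v\<close> and \<open>w - u\<close> are nonnegative and vanish on the
  boundary, so both gradient differences are nonnegative multiples of one and the same normal
  vector. The three gradients thus lie on a line in this order.\<close>

lemma boundary_gradient_between:
  fixes \<Omega> :: "(real^'n) set"
  assumes "smooth_bounded_domain \<Omega>" "x \<in> frontier \<Omega>"
    and "v differentiable (at x within closure \<Omega>)" "u differentiable (at x within closure \<Omega>)"
      "w differentiable (at x within closure \<Omega>)"
    and "\<And>y. y \<in> frontier \<Omega> \<Longrightarrow> v y = u y \<and> u y = w y" "\<And>y. y \<in> \<Omega> \<Longrightarrow> v y \<le> u y \<and> u y \<le> w y"
  shows "norm (gradient (closure \<Omega>) u x) \<le> max (norm (gradient (closure \<Omega>) v x)) (norm (gradient (closure \<Omega>) w x))"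
proof -
  let ?g = "\<lambda>f. gradient (closure \<Omega>) f x"
  have op: "open \<Omega>" using assms(1) by (simp add: smooth_bounded_domain_def)
  obtain U \<rho> where \<rho>: "local_defining_function \<Omega> x U \<rho>"
    using assms(1,2) unfolding smooth_bounded_domain_def by blast
  note d = gradient_has_derivative[OF assms(3)] gradient_has_derivative[OF assms(4)] gradient_has_derivative[OF assms(5)]
  obtain a where a: "0 \<le> a" "?g u - ?g v = a *\<^sub>R gradient UNIV \<rho> x"
  proof (rule boundary_derivative_normal[OF op \<rho> assms(2)])
    show "((\<lambda>y. u y - v y) has_derivative (\<lambda>h. (?g u - ?g v) \<bullet> h)) (at x within closure \<Omega>)"
      using has_derivative_diff[OF d(2,1)] by (simp add: inner_diff_left)
  qed (use assms(6,7) in auto)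
  obtain b where b: "0 \<le> b" "?g w - ?g u = b *\<^sub>R gradient UNIV \<rho> x"
  proof (rule boundary_derivative_normal[OF op \<rho> assms(2)])
    show "((\<lambda>y. w y - u y) has_derivative (\<lambda>h. (?g w - ?g u) \<bullet> h)) (at x within closure \<Omega>)"
      using has_derivative_diff[OF d(3,2)] by (simp add: inner_diff_left)
  qed (use assms(6,7) in auto)
  have gu: "?g u = ?g v + a *\<^sub>R gradient UNIV \<rho> x" "?g w = ?g v + (a + b) *\<^sub>R gradient UNIV \<rho> x"
    using a(2) b(2) by (auto simp: algebra_simps)
  show ?thesis
  proof (cases "a + b = 0")
    case True
    then have "a = 0" using a(1) b(1) by linarith
    then show ?thesis using gu(1) by simp
  next
    case False
    define l where "l = a / (a + b)"
    have l: "0 \<le> l" "l \<le> 1" "l * (a + b) = a" using a(1) b(1) False by (auto simp: l_def)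
    have "?g u = (1 - l) *\<^sub>R ?g v + l *\<^sub>R ?g w"
      unfolding gu scaleR_add_right scaleR_scaleR l(3) by (simp add: algebra_simps)
    then have "norm (?g u) \<le> (1 - l) * norm (?g v) + l * norm (?g w)"
      using norm_triangle_ineq[of "(1 - l) *\<^sub>R ?g v" "l *\<^sub>R ?g w"] l by simp
    also have "\<dots> \<le> max (norm (?g v)) (norm (?g w))" using l by (intro convex_bound_le) auto
    finally show ?thesis .
  qed
qed

text \<open>The domain may fail to be convex, so the segment goes to a nearest boundary point:
  leaving the domain earlier would produce a nearer one. Along it \<open>u\<close> has Lipschitz
  constant 1.\<close>

lemma abs_le_boundary_plus_diameter:
  fixes \<Omega> :: "(real^'n) set"
  assumes "open \<Omega>" "bounded \<Omega>" "x \<in> closure \<Omega>"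
    and "u differentiable_on closure \<Omega>" "\<And>y. y \<in> closure \<Omega> \<Longrightarrow> norm (gradient (closure \<Omega>) u y) \<le> 1"
    and "\<And>y. y \<in> frontier \<Omega> \<Longrightarrow> \<bar>u y\<bar> \<le> M"
  shows "\<bar>u x\<bar> \<le> M + diameter \<Omega>"
proof (cases "x \<in> \<Omega>")
  case True
  have "frontier \<Omega> \<noteq> {}" using True assms(2) frontier_not_empty[of \<Omega>] not_bounded_UNIV by blast
  moreover have "compact (frontier \<Omega>)" using assms(2) by (rule compact_frontier_bounded)
  ultimately obtain z where z: "z \<in> frontier \<Omega>" "\<And>y. y \<in> frontier \<Omega> \<Longrightarrow> dist x z \<le> dist x y"
    using distance_attains_inf[of "frontier \<Omega>" x] compact_imp_closed by metis
  have zc: "z \<in> closure \<Omega>" using z(1) by (simp add: frontier_def)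
  have seg: "closed_segment x z \<subseteq> closure \<Omega>"
  proof
    fix y assume y: "y \<in> closed_segment x z"
    show "y \<in> closure \<Omega>"
    proof (cases "y \<in> \<Omega>")
      case False
      then have "closed_segment x y \<inter> frontier \<Omega> \<noteq> {}"
        using True by (intro connected_Int_frontier connected_segment) auto
      then obtain w where w: "w \<in> closed_segment x y" "w \<in> frontier \<Omega>" by auto
      have "dist x z \<le> dist x w" by (rule z(2)[OF w(2)])
      moreover have "dist x w + dist w y = dist x y" "dist x y + dist y z = dist x z"
        using w(1) y by (simp_all flip: between_mem_segment add: between)
      ultimately have "dist y z = 0" using zero_le_dist[of w y] zero_le_dist[of y z] by linarith
      then show ?thesis using zc by simp
    qed (use closure_subset in auto)
  qed
  have "norm (u x - u z) \<le> 1 * norm (x - z)"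
  proof (rule differentiable_bound)
    show "(u has_derivative (\<lambda>h. gradient (closure \<Omega>) u y \<bullet> h)) (at y within closed_segment x z)"
      if "y \<in> closed_segment x z" for y
      using seg that assms(4)
      by (intro has_derivative_subset[OF gradient_has_derivative]) (auto simp: differentiable_on_def)
    show "onorm (\<lambda>h. gradient (closure \<Omega>) u y \<bullet> h) \<le> 1" if "y \<in> closed_segment x z" for y
    proof (rule onorm_le)
      fix h
      have "norm (gradient (closure \<Omega>) u y \<bullet> h) \<le> norm (gradient (closure \<Omega>) u y) * norm h"
        by (simp add: Cauchy_Schwarz_ineq2)
      also have "\<dots> \<le> 1 * norm h" using assms(5) seg that by (intro mult_right_mono) auto
      finally show "norm (gradient (closure \<Omega>) u y \<bullet> h) \<le> 1 * norm h" .
    qed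
  qed auto
  moreover have "dist x z \<le> diameter \<Omega>"
    using diameter_bounded_bound[of "closure \<Omega>" x z] assms(2,3) zc by (simp add: diameter_closure bounded_closure)
  moreover have "\<bar>u z\<bar> \<le> M" by (rule assms(6)[OF z(1)])
  ultimately show ?thesis by (simp add: dist_norm)
next
  case False
  then have "x \<in> frontier \<Omega>" using assms(1,3) by (simp add: frontier_def interior_open)
  then show ?thesis using assms(6) diameter_ge_0[OF assms(2)] by force
qed

lemma Ck_on_1_gradient_continuous:
  assumes "Ck_on 1 S f"
  shows "continuous_on S (gradient S f)" "continuous_on S f" "f differentiable_on S"
proof -
  have "f differentiable_on S" "\<forall>b\<in>Basis. continuous_on S (\<lambda>x. frechet_derivative f (at x within S) b)"
    using assms by (simp_all add: One_nat_def)
  then show "continuous_on S f" "f differentiable_on S" "continuous_on S (gradient S f)"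
    unfolding gradient_def[abs_def]
    by (auto intro: differentiable_imp_continuous_on) (intro continuous_intros, simp)
qed

text \<open>Compactness gives the upper bound without which the real supremum would be
  meaningless.\<close>

lemma compact_norm_le_SUP:
  fixes g :: "'a::topological_space \<Rightarrow> 'b::real_normed_vector"
  assumes "compact K" "continuous_on K g" "A \<subseteq> K" "x \<in> A"
  shows "norm (g x) \<le> (SUP x\<in>A. norm (g x))"
proof (rule cSUP_upper[OF assms(4)])
  have "compact ((\<lambda>x. norm (g x)) ` K)" by (intro compact_continuous_image continuous_intros assms)
  then show "bdd_above ((\<lambda>x. norm (g x)) ` A)"
    using assms(3) by (meson bdd_above_mono bounded_imp_bdd_above compact_imp_bounded image_mono)
qed

lemma spacelike_gradient:
  assumes "bounded \<Omega>" "spacelike \<Omega> u" "x \<in> closure \<Omega>"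
  shows "norm (gradient (closure \<Omega>) u x) < 1"
proof -
  have "norm (gradient (closure \<Omega>) u x) \<le> (SUP x\<in>closure \<Omega>. norm (gradient (closure \<Omega>) u x))"
    using assms by (intro compact_norm_le_SUP[of "closure \<Omega>"] Ck_on_1_gradient_continuous)
      (auto simp: spacelike_def)
  then show ?thesis using assms(2) by (simp add: spacelike_def)
qed

text \<open>\<open>graph_sigma\<close> takes derivatives within the closure; at interior points they
  are the ordinary ones, and the differentiability proviso in \<open>admissible\<close> is
  satisfied.\<close>

lemma admissible_interior:
  fixes \<Omega> :: "(real^'n) set"
  assumes "open \<Omega>" "bounded \<Omega>" "admissible k \<Omega> u" "x \<in> \<Omega>"
  shows "gradient (closure \<Omega>) u x = gradient UNIV u x"
    "\<sigma>_admissible k (gradient UNIV u x) (hessian UNIV u x)"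
    "graph_sigma j \<Omega> u x = \<sigma> j (gradient UNIV u x) (hessian UNIV u x)"
    "\<sigma> j (gradient UNIV u x) (hessian UNIV u x) = esym j UNIV (($) (principal_curvatures (closure \<Omega>) u x))"
proof -
  have C2: "Ck_on (Suc (Suc 0)) \<Omega> u" using assms(3) by (simp only: admissible_def numeral_2_eq_2)
  have sub: "\<Omega> \<subseteq> closure \<Omega>" by (rule closure_subset)
  have xc: "x \<in> closure \<Omega>" using assms(4) sub by auto
  show g: "gradient (closure \<Omega>) u x = gradient UNIV u x"
    using assms(1,4) sub interior_maximal by (intro gradient_interior) blast
  note hess = Ck_on_2_hessian[OF assms(1) C2 assms(4)]
  note h = hessian_open[OF assms(1,4) sub hess(1)]
  have p: "norm (gradient (closure \<Omega>) u x) < 1"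
    using spacelike_gradient[OF assms(2) _ xc] assms(3) by (simp add: admissible_def)
  have sym: "transpose (hessian (closure \<Omega>) u x) = hessian (closure \<Omega>) u x" using h(1) hess(2) by simp
  show gs: "graph_sigma j \<Omega> u x = \<sigma> j (gradient UNIV u x) (hessian UNIV u x)" for j
    using graph_sigma_conv(1)[OF p sym] g h(1) by simp
  show "\<sigma> j (gradient UNIV u x) (hessian UNIV u x) = esym j UNIV (($) (principal_curvatures (closure \<Omega>) u x))"
    using graph_sigma_conv(2)[OF p sym] g h(1) by simp
  have "\<forall>j\<in>{1..k}. 0 < graph_sigma j \<Omega> u x"
    using assms(3) xc h(2) by (simp add: admissible_def)
  then show "\<sigma>_admissible k (gradient UNIV u x) (hessian UNIV u x)"
    using p g hess(2) by (simp add: \<sigma>_admissible_def gs)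
qed

text \<open>The root form matches the right-hand side of the equation for the upper barrier
  \<open>uu\<close>, so that a \<open>k\<close>-admissible solution becomes a subsolution of that
  equation.\<close>

lemma \<sigma>_maclaurin:
  fixes \<Omega> :: "(real^'n) set"
  assumes "open \<Omega>" "bounded \<Omega>" "admissible k \<Omega> u" "x \<in> \<Omega>" "2 \<le> k" "k \<le> CARD('n)"
  shows "real CARD('n) * root k (graph_sigma k \<Omega> u x / real (CARD('n) choose k)) \<le> graph_sigma 1 \<Omega> u x"
proof -
  note a = admissible_interior[OF assms(1-4)]
  define \<kappa> where "\<kappa> = principal_curvatures (closure \<Omega>) u x"
  have s: "graph_sigma j \<Omega> u x = esym j UNIV (($) \<kappa>)" for j using a(3,4) by (simp add: \<kappa>_def)
  have G: "garding k UNIV (($) \<kappa>)"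
    using a(2) by (simp add: \<sigma>_admissible_def garding_def s[symmetric] a(3))
  define m where "m = sum (($) \<kappa>) UNIV / CARD('n)"
  have "0 < esym 1 UNIV (($) \<kappa>)" using garding_pos[OF _ G, of 1] assms(5) by simp
  then have m: "0 \<le> m" by (simp add: m_def)
  have C: "0 < real (CARD('n) choose k)" using assms(6) by simp
  have "esym k UNIV (($) \<kappa>) / real (CARD('n) choose k) \<le> m ^ k"
    using maclaurin[OF assms(5) G] C by (simp add: m_def pos_divide_le_eq mult.commute)
  then have "root k (esym k UNIV (($) \<kappa>) / real (CARD('n) choose k)) \<le> root k (m ^ k)"
    using assms(5) by (intro real_root_le_mono) auto
  also have "\<dots> = m" using m assms(5) by (intro real_root_power_cancel) auto
  finally have "real CARD('n) * root k (esym k UNIV (($) \<kappa>) / real (CARD('n) choose k)) \<le> real CARD('n) * m"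
    by (intro mult_left_mono) auto
  then show ?thesis by (simp add: s m_def)
qed

section \<open>The gradient estimate\<close>

text \<open>The bound involves the data only through the listed numbers, so that a single \<theta>
  can be fixed before the data. Its exponent is \<open>2 B\<close> times the oscillation bound
  \<open>2 (|M| + |d|)\<close>.\<close>

lemma dirichlet_gradient_estimate:
  fixes \<Omega> :: "(real^'n) set" and \<psi> :: "(real^'n) \<times> real \<Rightarrow> real" and u ul uu \<phi> :: "real^'n \<Rightarrow> real"
  assumes k: "2 \<le> k" "k \<le> CARD('n)"
    and \<Omega>: "smooth_bounded_domain \<Omega>"
    and \<phi>: "spacelike \<Omega> \<phi>"
    and \<psi>: "smooth_on (closure \<Omega> \<times> UNIV) \<psi>" "\<And>x z. x \<in> closure \<Omega> \<Longrightarrow> 0 < \<psi> (x, z)"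
      "\<And>x z. x \<in> closure \<Omega> \<Longrightarrow> 0 \<le> deriv (\<lambda>s. \<psi> (x, s)) z"
    and ul: "admissible k \<Omega> ul" "\<And>x. x \<in> \<Omega> \<Longrightarrow> \<psi> (x, ul x) \<le> graph_sigma k \<Omega> ul x"
      "\<And>x. x \<in> frontier \<Omega> \<Longrightarrow> ul x = \<phi> x"
    and uu: "admissible 1 \<Omega> uu" "\<And>x. x \<in> \<Omega> \<Longrightarrow> graph_sigma 1 \<Omega> uu x =
         real (CARD('n)) * root k (\<psi> (x, uu x) / real (CARD('n) choose k))"
      "\<And>x. x \<in> frontier \<Omega> \<Longrightarrow> uu x = \<phi> x"
    and u: "Ck_on 3 \<Omega> u" "admissible k \<Omega> u" "\<And>x. x \<in> \<Omega> \<Longrightarrow> graph_sigma k \<Omega> u x = \<psi> (x, u x)"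
      "\<And>x. x \<in> frontier \<Omega> \<Longrightarrow> u x = \<phi> x"
    and \<theta>\<^sub>0: "1 - \<theta>\<^sub>0 = max (SUP x\<in>frontier \<Omega>. norm (gradient (closure \<Omega>) ul x))
                     (SUP x\<in>frontier \<Omega>. norm (gradient (closure \<Omega>) uu x))"
    and d: "diameter \<Omega> = d" and M: "(SUP x\<in>frontier \<Omega>. \<bar>\<phi> x\<bar>) = M"
    and D: "D = closure \<Omega> \<times> {(INF x\<in>\<Omega>. u x)..(SUP x\<in>\<Omega>. u x)}"
    and L: "(SUP q\<in>D. norm (gradient (closure \<Omega> \<times> UNIV) \<psi> q)) = L"
    and c: "(INF q\<in>D. \<psi> q) = c"
    and B: "B = (\<bar>L\<bar> + 1) / (real k * c)"
  shows "0 < c"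
    "\<And>x. x \<in> closure \<Omega> \<Longrightarrow>
      (1 - (1 - \<theta>\<^sub>0)\<^sup>2) * exp (- 4 * B * (\<bar>M\<bar> + \<bar>d\<bar>)) \<le> 1 - (norm (gradient (closure \<Omega>) u x))\<^sup>2"
proof -
  have op: "open \<Omega>" and bd: "bounded \<Omega>" and ne: "\<Omega> \<noteq> {}"
    using \<Omega> by (auto simp: smooth_bounded_domain_def)
  have cl: "compact (closure \<Omega>)" using bd by simp
  have sub: "\<Omega> \<subseteq> closure \<Omega>" by (rule closure_subset)
  have C1: "Ck_on 1 (closure \<Omega>) u" "Ck_on 1 (closure \<Omega>) ul" "Ck_on 1 (closure \<Omega>) uu" "Ck_on 1 (closure \<Omega>) \<phi>"
    using u(2) ul(1) uu(1) \<phi> by (auto simp: admissible_def spacelike_def)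
  have C2: "Ck_on (Suc (Suc 0)) \<Omega> u" "Ck_on (Suc (Suc 0)) \<Omega> ul" "Ck_on (Suc (Suc 0)) \<Omega> uu"
    using u(2) ul(1) uu(1) by (simp_all only: admissible_def numeral_2_eq_2)
  have C3: "Ck_on (Suc (Suc (Suc 0))) \<Omega> u" using u(1) by (simp only: numeral_3_eq_3)
  note contu = Ck_on_1_gradient_continuous(2)[OF C1(1)]
  note Iu = admissible_interior[OF op bd u(2)] and Il = admissible_interior[OF op bd ul(1)]
    and Iuu = admissible_interior[OF op bd uu(1)]
  have small: "norm (gradient (closure \<Omega>) u x) < 1" if "x \<in> closure \<Omega>" for x
    using spacelike_gradient[OF bd _ that] u(2) by (simp add: admissible_def)

  have \<psi>C: "Ck_on 1 (closure \<Omega> \<times> UNIV) \<psi>" using \<psi>(1) by (simp only: smooth_on_def)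
  note cont\<psi> = Ck_on_1_gradient_continuous(1,2)[OF \<psi>C]
  have int: "(x, z) \<in> interior (closure \<Omega> \<times> UNIV)" if "x \<in> \<Omega>" for x and z :: real
    using that op sub by (intro interiorI[of "\<Omega> \<times> UNIV"]) (auto intro: open_Times)
  have \<psi>der: "(\<psi> has_derivative (\<lambda>h. gradient (closure \<Omega> \<times> UNIV) \<psi> (x, z) \<bullet> h)) (at (x, z))"
    if "x \<in> \<Omega>" for x z
  proof -
    have "\<psi> differentiable (at (x, z) within closure \<Omega> \<times> UNIV)"
      using Ck_on_1_gradient_continuous(3)[OF \<psi>C] that sub by (auto simp: differentiable_on_def)
    from gradient_has_derivative[OF this] show ?thesis unfolding at_within_interior[OF int[OF that]] .
  qed
  have \<psi>z: "((\<lambda>s. \<psi> (x, s)) has_real_derivative gradient (closure \<Omega> \<times> UNIV) \<psi> (x, z) \<bullet> (0, 1)) (at z)"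
    if "x \<in> \<Omega>" for x z
  proof -
    have "((\<lambda>s. (x, s)) has_derivative (\<lambda>h. (0, h))) (at z)" by (auto intro!: derivative_eq_intros)
    from has_derivative_compose[OF this \<psi>der[OF that]]
    have "((\<lambda>s. \<psi> (x, s)) has_derivative (\<lambda>h. gradient (closure \<Omega> \<times> UNIV) \<psi> (x, z) \<bullet> (0, h))) (at z)" .
    then show ?thesis unfolding has_field_derivative_def
      by (rule has_derivative_eq_rhs) (auto simp: inner_prod_def)
  qed
  have \<psi>z_nonneg: "0 \<le> gradient (closure \<Omega> \<times> UNIV) \<psi> (x, z) \<bullet> (0, 1)" if "x \<in> \<Omega>" for x z
    using \<psi>(3)[of x z] DERIV_imp_deriv[OF \<psi>z[OF that]] that sub by auto
  have mono: "\<psi> (x, a) \<le> \<psi> (x, b)" if "x \<in> \<Omega>" "a \<le> b" for x a b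
    using \<psi>z \<psi>z_nonneg that by (intro DERIV_nonneg_imp_nondecreasing[of a b "\<lambda>s. \<psi> (x, s)"]) blast+

  have bu: "bdd_below (u ` \<Omega>)" "bdd_above (u ` \<Omega>)"
  proof -
    have "bounded (u ` closure \<Omega>)" by (intro compact_imp_bounded compact_continuous_image contu cl)
    then have "bounded (u ` \<Omega>)" using sub by (meson bounded_subset image_mono)
    then show "bdd_below (u ` \<Omega>)" "bdd_above (u ` \<Omega>)"
      by (auto intro: bounded_imp_bdd_below bounded_imp_bdd_above)
  qed
  have inD: "(x, u x) \<in> D" if "x \<in> \<Omega>" for x
    using that sub cINF_lower[OF bu(1) that] cSUP_upper[OF that bu(2)] by (auto simp: D)
  have Dsub: "D \<subseteq> closure \<Omega> \<times> UNIV" by (auto simp: D)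
  have Dc: "compact D" unfolding D by (intro compact_Times cl compact_Icc)
  have Dne: "D \<noteq> {}" using inD ne by auto
  \<comment> \<open>\<open>D\<close> is compact and \<open>\<psi>\<close> is positive on it, so the
    infimum \<open>c\<close> is positive and \<open>B\<close> is a genuine quotient.\<close>
  obtain q0 where q0: "q0 \<in> D" "\<And>q. q \<in> D \<Longrightarrow> \<psi> q0 \<le> \<psi> q"
    using continuous_attains_inf[OF Dc Dne continuous_on_subset[OF cont\<psi>(2) Dsub]] by auto
  have "\<psi> q0 \<le> c" unfolding c[symmetric] by (rule cINF_greatest[OF Dne q0(2)])
  moreover have "0 < \<psi> q0" using q0(1) \<psi>(2) by (cases q0) (auto simp: D)
  ultimately show cpos: "0 < c" by simp
  have cle: "c \<le> \<psi> (x, u x)" if "x \<in> \<Omega>" for x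
    unfolding c[symmetric] using inD[OF that] q0(2) by (intro cINF_lower bdd_belowI2[of D "\<psi> q0"])
  have Lge: "norm (gradient (closure \<Omega> \<times> UNIV) \<psi> (x, u x)) \<le> L" if "x \<in> \<Omega>" for x
    unfolding L[symmetric]
    by (rule compact_norm_le_SUP[OF Dc continuous_on_subset[OF cont\<psi>(1) Dsub] order_refl inD[OF that]])
  have Bpos: "0 < B" using cpos k by (simp add: B add_nonneg_pos)

  have lower: "ul x \<le> u x" if "x \<in> closure \<Omega>" for x
  proof (rule comparison_principle[OF op bd, of k ul u "\<lambda>x z. \<psi> (x, z)"])
    show "continuous_on (closure \<Omega>) ul" "continuous_on (closure \<Omega>) u"
      using Ck_on_1_gradient_continuous(2) C1 by auto
    show "\<sigma>_admissible k (gradient UNIV ul y) (hessian UNIV ul y)" if "y \<in> \<Omega>" for y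
      by (rule Il(2)[OF that])
    show "\<psi> (y, ul y) \<le> \<sigma> k (gradient UNIV ul y) (hessian UNIV ul y)" if "y \<in> \<Omega>" for y
      using ul(2)[OF that] Il(3)[OF that, of k] by simp
    show "\<sigma> k (gradient UNIV u y) (hessian UNIV u y) \<le> \<psi> (y, u y)" if "y \<in> \<Omega>" for y
      using u(3)[OF that] Iu(3)[OF that, of k] by simp
  qed (use k C2 ul(3) u(4) mono that in auto)
  \<comment> \<open>Comparison for \<open>\<sigma> 1\<close> with \<open>u\<close> as subsolution;
    composing with \<open>root k\<close> keeps the right-hand side nondecreasing in the
    height.\<close>
  have upper: "u x \<le> uu x" if "x \<in> closure \<Omega>" for x
  proof (rule comparison_principle[OF op bd, of 1 u uu "\<lambda>x z. real (CARD('n)) * root k (\<psi> (x, z) / real (CARD('n) choose k))"])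
    show "continuous_on (closure \<Omega>) u" "continuous_on (closure \<Omega>) uu"
      using Ck_on_1_gradient_continuous(2) C1 by auto
    show "\<sigma>_admissible 1 (gradient UNIV u y) (hessian UNIV u y)" if "y \<in> \<Omega>" for y
      using Iu(2)[OF that] k by (simp add: \<sigma>_admissible_def)
    show "real CARD('n) * root k (\<psi> (y, u y) / real (CARD('n) choose k)) \<le> \<sigma> 1 (gradient UNIV u y) (hessian UNIV u y)"
      if "y \<in> \<Omega>" for y
      using \<sigma>_maclaurin[OF op bd u(2) that k] by (simp add: u(3)[OF that] Iu(3)[OF that, symmetric])
    show "\<sigma> 1 (gradient UNIV uu y) (hessian UNIV uu y) \<le> real CARD('n) * root k (\<psi> (y, uu y) / real (CARD('n) choose k))"
      if "y \<in> \<Omega>" for y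
      using uu(2)[OF that] Iuu(3)[OF that, of 1] by simp
    show "real CARD('n) * root k (\<psi> (y, a) / real (CARD('n) choose k)) \<le>
        real CARD('n) * root k (\<psi> (y, b) / real (CARD('n) choose k))" if "y \<in> \<Omega>" "a \<le> b" for y a b
      using k mono[OF that] by (intro mult_left_mono real_root_le_mono divide_right_mono) auto
  qed (use C2 u(4) uu(3) that in auto)

  have bgrad: "norm (gradient (closure \<Omega>) u x) \<le> 1 - \<theta>\<^sub>0" if x: "x \<in> frontier \<Omega>" for x
  proof -
    have fc: "frontier \<Omega> \<subseteq> closure \<Omega>" by (auto simp: frontier_def)
    have "norm (gradient (closure \<Omega>) u x) \<le> max (norm (gradient (closure \<Omega>) ul x)) (norm (gradient (closure \<Omega>) uu x))"
    proof (rule boundary_gradient_between[OF \<Omega> x])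
      show "ul differentiable (at x within closure \<Omega>)" "u differentiable (at x within closure \<Omega>)"
        "uu differentiable (at x within closure \<Omega>)"
        using Ck_on_1_gradient_continuous(3) C1 x fc by (auto simp: differentiable_on_def)
    qed (use ul(3) u(4) uu(3) lower upper sub in auto)
    also have "\<dots> \<le> 1 - \<theta>\<^sub>0"
      unfolding \<theta>\<^sub>0
      by (intro max.mono compact_norm_le_SUP[OF cl _ fc x] Ck_on_1_gradient_continuous(1) C1)
    finally show ?thesis .
  qed
  have osc: "\<bar>u x\<bar> \<le> \<bar>M\<bar> + \<bar>d\<bar>" if "x \<in> closure \<Omega>" for x
  proof -
    have "\<bar>u x\<bar> \<le> M + diameter \<Omega>"
    proof (rule abs_le_boundary_plus_diameter[OF op bd that Ck_on_1_gradient_continuous(3)[OF C1(1)]])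
      show "norm (gradient (closure \<Omega>) u y) \<le> 1" if "y \<in> closure \<Omega>" for y using small[OF that] by simp
      fix y assume y: "y \<in> frontier \<Omega>"
      have "norm (\<phi> y) \<le> (SUP x\<in>frontier \<Omega>. norm (\<phi> x))"
        by (rule compact_norm_le_SUP[OF cl Ck_on_1_gradient_continuous(2)[OF C1(4)] _ y]) (auto simp: frontier_def)
      then show "\<bar>u y\<bar> \<le> M" using u(4)[OF y] M by simp
    qed
    then show ?thesis using d by linarith
  qed

  \<comment> \<open>The square of \<open>w exp (- B u)\<close>: its minimum is the maximum of
    \<open>log (1 / w) + B u\<close>, in a form free of logarithms and square roots.\<close>
  define E where "E x = (1 - (norm (gradient (closure \<Omega>) u x))\<^sup>2) * exp (- 2 * B * u x)" for x
  have "continuous_on (closure \<Omega>) E"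
    unfolding E_def by (intro continuous_intros contu Ck_on_1_gradient_continuous(1) C1)
  then obtain y where y: "y \<in> closure \<Omega>" "\<And>x. x \<in> closure \<Omega> \<Longrightarrow> E y \<le> E x"
    using continuous_attains_inf[OF cl, of E] ne sub by (metis closure_eq_empty)
  \<comment> \<open>Where the gradient vanishes, the right-hand side is 1 and the claim is trivial;
    an interior minimum with nonzero gradient is excluded by \<open>B k c = |L| + 1\<close>.\<close>
  have a0: "1 - (1 - \<theta>\<^sub>0)\<^sup>2 \<le> 1 - (norm (gradient (closure \<Omega>) u y))\<^sup>2"
  proof (cases "y \<in> \<Omega>")
    case False
    then have "y \<in> frontier \<Omega>" using y(1) op by (simp add: frontier_def interior_open)
    then show ?thesis using bgrad by (simp add: power_mono)
  next
    case True
    have "gradient UNIV u y = 0"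
    proof (rule ccontr)
      assume ne0: "gradient UNIV u y \<noteq> 0"
      have "B * (real k * \<psi> (y, u y)) \<le> L"
      proof (rule interior_tilt_maximum[OF op C3 True _ Iu(2)[OF True] _ \<psi>der[OF True] \<psi>z_nonneg[OF True] Lge[OF True] ne0])
        show "\<sigma> k (gradient UNIV u x) (hessian UNIV u x) = \<psi> (x, u x)" if "x \<in> \<Omega>" for x
          using u(3)[OF that] Iu(3)[OF that] by simp
        show "(1 - (norm (gradient UNIV u y))\<^sup>2) * exp (- 2 * B * u y) \<le>
            (1 - (norm (gradient UNIV u x))\<^sup>2) * exp (- 2 * B * u x)" if "x \<in> \<Omega>" for x
          using y(2)[of x] that sub Iu(1)[OF that] Iu(1)[OF True] by (auto simp: E_def)
      qed (use k in auto)
      moreover have "B * (real k * c) \<le> B * (real k * \<psi> (y, u y))"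
        using Bpos cle[OF True] by (intro mult_left_mono) auto
      moreover have "B * (real k * c) = \<bar>L\<bar> + 1" using cpos k by (simp add: B)
      ultimately show False by linarith
    qed
    then show ?thesis using Iu(1)[OF True] by simp
  qed
  fix x assume x: "x \<in> closure \<Omega>"
  let ?S = "\<bar>M\<bar> + \<bar>d\<bar>"
  have "(1 - (1 - \<theta>\<^sub>0)\<^sup>2) * exp (- 4 * B * ?S) \<le> (1 - (norm (gradient (closure \<Omega>) u y))\<^sup>2) * exp (- 4 * B * ?S)"
    using a0 by (intro mult_right_mono) auto
  also have "\<dots> \<le> (1 - (norm (gradient (closure \<Omega>) u y))\<^sup>2) * exp (- 2 * B * u y + 2 * B * u x)"
  proof (rule mult_left_mono)
    have "B * (u y - u x) \<le> B * (2 * ?S)"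
      using osc[OF x] osc[OF y(1)] Bpos by (intro mult_left_mono) (auto simp: abs_le_iff)
    then show "exp (- 4 * B * ?S) \<le> exp (- 2 * B * u y + 2 * B * u x)" by (simp add: algebra_simps)
    show "0 \<le> 1 - (norm (gradient (closure \<Omega>) u y))\<^sup>2"
      using small[OF y(1)] by (simp add: power_le_one)
  qed
  also have "\<dots> = E y * exp (2 * B * u x)" unfolding E_def exp_add by (simp only: mult.assoc)
  also have "\<dots> \<le> E x * exp (2 * B * u x)" using y(2)[OF x] by (intro mult_right_mono) auto
  also have "\<dots> = 1 - (norm (gradient (closure \<Omega>) u x))\<^sup>2"
    by (simp add: E_def mult.assoc flip: exp_add)
  finally show "(1 - (1 - \<theta>\<^sub>0)\<^sup>2) * exp (- 4 * B * ?S) \<le> 1 - (norm (gradient (closure \<Omega>) u x))\<^sup>2" .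
qed

text \<open>The dependence of \<theta> is encoded by the order of quantifiers: it is chosen when
  only the listed numbers are fixed, before the domain and the functions.\<close>

theorem theorem3p3:
  fixes k :: nat and \<theta>\<^sub>0 d M L c :: real
  assumes k: "2 \<le> k" "k \<le> CARD('n::finite) - 1"
    and \<theta>\<^sub>0: "0 < \<theta>\<^sub>0" "\<theta>\<^sub>0 < 1"
  shows "\<exists>\<theta>::real. 0 < \<theta> \<and> \<theta> < 1 \<and>
    (\<forall>(\<Omega> :: (real^'n) set) (\<phi> :: real^'n \<Rightarrow> real) (\<psi> :: (real^'n) \<times> real \<Rightarrow> real)
       (ul :: real^'n \<Rightarrow> real) (uu :: real^'n \<Rightarrow> real) (u :: real^'n \<Rightarrow> real).
      smooth_bounded_domain \<Omega> \<and> admissible_domain (k - 1) \<Omega> \<and>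
      spacelike \<Omega> \<phi> \<and>
      smooth_on (closure \<Omega> \<times> UNIV) \<psi> \<and>
      (\<forall>x\<in>closure \<Omega>. \<forall>z. \<psi> (x, z) > 0 \<and> deriv (\<lambda>s. \<psi> (x, s)) z \<ge> 0) \<and>
      admissible k \<Omega> ul \<and>
      (\<forall>x\<in>\<Omega>. graph_sigma k \<Omega> ul x \<ge> \<psi> (x, ul x)) \<and> (\<forall>x\<in>frontier \<Omega>. ul x = \<phi> x) \<and>
      admissible 1 \<Omega> uu \<and>
      (\<forall>x\<in>\<Omega>. graph_sigma 1 \<Omega> uu x =
         real (CARD('n)) * root k (\<psi> (x, uu x) / real (CARD('n) choose k))) \<and>
      (\<forall>x\<in>frontier \<Omega>. uu x = \<phi> x) \<and>
      Ck_on 3 \<Omega> u \<and> Ck_on 1 (closure \<Omega>) u \<and> admissible k \<Omega> u \<and>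
      (\<forall>x\<in>\<Omega>. graph_sigma k \<Omega> u x = \<psi> (x, u x)) \<and> (\<forall>x\<in>frontier \<Omega>. u x = \<phi> x) \<and>
      1 - \<theta>\<^sub>0 = max (SUP x\<in>frontier \<Omega>. norm (gradient (closure \<Omega>) ul x))
                     (SUP x\<in>frontier \<Omega>. norm (gradient (closure \<Omega>) uu x)) \<and>
      diameter \<Omega> = d \<and>
      (SUP x\<in>frontier \<Omega>. \<bar>\<phi> x\<bar>) = M \<and>
      (let D = closure \<Omega> \<times> {(INF x\<in>\<Omega>. u x)..(SUP x\<in>\<Omega>. u x)} in
         (SUP q\<in>D. norm (gradient (closure \<Omega> \<times> UNIV) \<psi> q)) = L \<and>
         (INF q\<in>D. \<psi> q) = c)
      \<longrightarrow> (SUP x\<in>closure \<Omega>. norm (gradient (closure \<Omega>) u x)) \<le> 1 - \<theta>)"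
proof -
  define B where "B = (\<bar>L\<bar> + 1) / (real k * c)"
  \<comment> \<open>Nothing is known yet about the sign of \<open>c\<close>; the absolute value of
    \<open>B\<close> keeps \<open>\<kappa>\<close> between 0 and 1 in every case. Once data are
    given, \<open>c\<close> is positive and \<open>|B| = B\<close>.\<close>
  define \<kappa> where "\<kappa> = (1 - (1 - \<theta>\<^sub>0)\<^sup>2) * exp (- 4 * \<bar>B\<bar> * (\<bar>M\<bar> + \<bar>d\<bar>))"
  have "0 < (1 - \<theta>\<^sub>0)\<^sup>2" "(1 - \<theta>\<^sub>0)\<^sup>2 < 1" using \<theta>\<^sub>0 by (auto simp: power_less_one_iff)
  then have a0: "0 < 1 - (1 - \<theta>\<^sub>0)\<^sup>2" "1 - (1 - \<theta>\<^sub>0)\<^sup>2 < 1" by auto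
  have "exp (- 4 * \<bar>B\<bar> * (\<bar>M\<bar> + \<bar>d\<bar>)) \<le> 1" by simp
  then have "\<kappa> \<le> (1 - (1 - \<theta>\<^sub>0)\<^sup>2) * 1" unfolding \<kappa>_def using a0 by (intro mult_left_mono) auto
  then have "\<kappa> < 1" using order.strict_trans1[OF _ a0(2)] by simp
  moreover have "0 < \<kappa>" using a0 by (simp add: \<kappa>_def)
  ultimately have \<kappa>: "0 < \<kappa>" "\<kappa> < 1" by auto
  \<comment> \<open>Chosen so that \<open>1 - |Du|^2 \<ge> \<kappa>\<close> gives
    \<open>|Du| \<le> 1 - \<theta>\<close>.\<close>
  define \<theta> where "\<theta> = 1 - sqrt (1 - \<kappa>)"
  have \<theta>: "0 < \<theta>" "\<theta> < 1" using \<kappa> by (auto simp: \<theta>_def)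
  have kn: "k \<le> CARD('n)" using k by simp
  show ?thesis
  proof (intro exI[of _ \<theta>] conjI allI impI \<theta>, unfold Let_def, elim conjE, goal_cases)
    case (1 \<Omega> \<phi> \<psi> ul uu u)
    note est = dirichlet_gradient_estimate[OF k(1) kn, of \<Omega> \<phi> \<psi> ul uu u, OF 1(1,3,4) _ _ 1(6) _ _ 1(9) _ _ 1(12,14) _ _ 1(17,18,19) refl 1(20,21) B_def]
    have \<psi>: "\<And>x z. x \<in> closure \<Omega> \<Longrightarrow> 0 < \<psi> (x, z)" "\<And>x z. x \<in> closure \<Omega> \<Longrightarrow> 0 \<le> deriv (\<lambda>s. \<psi> (x, s)) z"
      using 1(5) by auto
    have c: "0 < c"
      by (rule est(1)) (use 1 \<psi> in auto)
    then have B: "\<bar>B\<bar> = B" using k by (simp add: B_def)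
    have ne: "closure \<Omega> \<noteq> {}" using 1(1) by (simp add: smooth_bounded_domain_def)
    show ?case
    proof (rule cSUP_least[OF ne])
      fix x assume x: "x \<in> closure \<Omega>"
      have "\<kappa> \<le> 1 - (norm (gradient (closure \<Omega>) u x))\<^sup>2"
        unfolding \<kappa>_def B by (rule est(2)) (use 1 \<psi> x in auto)
      then have "(norm (gradient (closure \<Omega>) u x))\<^sup>2 \<le> 1 - \<kappa>" by simp
      then have "norm (gradient (closure \<Omega>) u x) \<le> sqrt (1 - \<kappa>)" by (rule real_le_rsqrt)
      then show "norm (gradient (closure \<Omega>) u x) \<le> 1 - \<theta>" by (simp add: \<theta>_def)
    qed
  qed
qed

end
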